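(* The group $T_B$ of dyadic rearrangements of the basilica is generated by the four elements $\alpha,\beta,\gamma,\delta$.
   Context: Identify the unit circle $S^1$ with $\mathbb{R}/\mathbb{Z}$. An arc $\{a,b\}$ is a hyperbolic geodesic of the closed unit disk joining two distinct points $a,b\in S^1$. The primary arc of a closed interval $[a,b]$ of the circle is the arc joining $a+\tfrac14(b-a)$ and $b-\tfrac14(b-a)$ (so it cuts the interval into three pieces with length ratio $1:2:1$). Arc diagrams: start with the two arcs $\{1/3,2/3\}$ and $\{1/6,5/6\}$, whose endpoints divide the circle into the four intervals $[1/6,1/3]$, $[1/3,2/3]$, $[2/3,5/6]$, $[-1/6,1/6]$. Finitely many times (possibly zero), choose one of the current intervals and add its primary arc, which replaces that interval by three intervals. Any finite collection of arcs obtained this way is an arc diagram. It is regarded as a 2-complex on the closed disk: the vertices are the arc endpoints, the edges are the arcs and the circle intervals between consecutive endpoints, and the faces are the complementary regions. Two arc diagrams are isomorphic if there is an orientation-preserving isomorphism of these 2-complexes (so circle intervals go to circle intervals and arcs to arcs). Given an isomorphism $\varphi\colon\mathcal{D}\to\mathcal{R}$ of arc diagrams, let $f\colon S^1\to S^1$ be the orientation-preserving piecewise-linear homeomorphism sending each interval of $\mathcal{D}$ linearly onto the corresponding interval of $\mathcal{R}$. Such an $f$ is called a dyadic rearrangement of the basilica, and $T_B$ is the set of all of them; it is a group under composition. The elements $\alpha,\beta,\gamma,\delta\in T_B$ are the following orientation-preserving piecewise-linear homeomorphisms: - $\alpha$ maps $1/3,2/3$ to $1/6,5/6$ respectively and is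 linear on $[-1/3,1/3]$ (onto $[-1/6,1/6]$) and on $[1/3,2/3]$ (onto $[1/6,5/6]$); - $\beta$ is the identity on $[-1/6,1/6]$, maps $1/6,\,2/3,\,17/24,\,5/6$ to $1/6,\,7/24,\,1/3,\,5/6$ respectively, and is linear on each interval between consecutive listed points of $[1/6,5/6]$; - $\gamma$ is the identity outside $[1/6,1/3]$, maps $1/6,\,7/24,\,29/96,\,1/3$ to $1/6,\,19/96,\,5/24,\,1/3$ respectively, and is linear on each interval between consecutive listed points of $[1/6,1/3]$; - $\delta(\theta)=\theta+1/2$. *)

theory Defs
  imports
    "HOL-Analysis.Analysis"
    "HOL-Algebra.Bij"
    "HOL-Algebra.Generated_Groups"
begin

text \<open>
  The circle is the unit circle of the complex plane, identified with the reals modulo the integers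
  through \<open>pt\<close>. Points of the circle are given by real representatives throughout.
\<close>

abbreviation S1 :: "complex set" where
  "S1 \<equiv> sphere 0 1"

definition pt :: "real \<Rightarrow> complex" where
  "pt \<theta> = cis (2 * pi * \<theta>)"


section \<open>Arc diagrams\<close>

text \<open>
  The arc \<open>{a, b}\<close> is given by its set of two endpoints. As a subset of the disk it is
  \<open>convex hull {a, b}\<close>, the hyperbolic geodesic from \<open>a\<close> to \<open>b\<close> in the Klein model.
\<close>

definition primary_arc :: "real \<Rightarrow> real \<Rightarrow> complex set" where
  "primary_arc a b = {pt (a + (b - a) / 4), pt (b - (b - a) / 4)}"

definition circle_interval :: "complex set set \<Rightarrow> real \<Rightarrow> real \<Rightarrow> bool" where
  "circle_interval D a b \<longleftrightarrow>
     a < b \<and> pt a \<in> \<Union>D \<and> pt b \<in> \<Union>D \<and> (\<forall>x. a < x \<and> x < b \<longrightarrow> pt x \<notin> \<Union>D)"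

inductive arc_diagram :: "complex set set \<Rightarrow> bool" where
  base: "arc_diagram {{pt (1/3), pt (2/3)}, {pt (1/6), pt (5/6)}}"
| expand: "arc_diagram D \<Longrightarrow> circle_interval D a b \<Longrightarrow> arc_diagram (insert (primary_arc a b) D)"


section \<open>The 2-complex of an arc diagram\<close>

text \<open>
  Cells are subsets of the closed disk. Vertices and edges are closed cells, faces are open cells,
  and a cell \<open>c\<close> is incident to a cell \<open>d\<close> if \<open>c \<subseteq> closure d\<close>.
\<close>

definition vertex_cells :: "complex set set \<Rightarrow> complex set set" where
  "vertex_cells D = {{v} | v. v \<in> \<Union>D}"

definition arc_edges :: "complex set set \<Rightarrow> complex set set" where
  "arc_edges D = {convex hull A | A. A \<in> D}"

definition circle_edges :: "complex set set \<Rightarrow> complex set set" where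
  "circle_edges D = {pt ` {a..b} | a b. circle_interval D a b}"

definition faces :: "complex set set \<Rightarrow> complex set set" where
  "faces D = components (ball 0 1 - \<Union>(arc_edges D))"

definition cells :: "complex set set \<Rightarrow> complex set set" where
  "cells D = vertex_cells D \<union> arc_edges D \<union> circle_edges D \<union> faces D"

text \<open>
  These complexes are regular, so an isomorphism is a bijection of the cells that preserves and
  reflects incidence. It preserves orientation if it maps the circle intervals, all directed
  counterclockwise, to circle intervals with the same direction.
\<close>

definition diagram_iso ::
    "(complex set \<Rightarrow> complex set) \<Rightarrow> complex set set \<Rightarrow> complex set set \<Rightarrow> bool" where
  "diagram_iso \<phi> D R \<longleftrightarrow>
     bij_betw \<phi> (vertex_cells D) (vertex_cells R) \<and>
     bij_betw \<phi> (arc_edges D) (arc_edges R) \<and>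
     bij_betw \<phi> (circle_edges D) (circle_edges R) \<and>
     bij_betw \<phi> (faces D) (faces R) \<and>
     (\<forall>c\<in>cells D. \<forall>d\<in>cells D. c \<subseteq> closure d \<longleftrightarrow> \<phi> c \<subseteq> closure (\<phi> d)) \<and>
     (\<forall>a b. circle_interval D a b \<longrightarrow>
        (\<exists>c d. circle_interval R c d \<and> \<phi> (pt ` {a..b}) = pt ` {c..d} \<and>
               \<phi> {pt a} = {pt c} \<and> \<phi> {pt b} = {pt d}))"


section \<open>Dyadic rearrangements of the basilica\<close>

definition maps_linearly ::
    "(complex \<Rightarrow> complex) \<Rightarrow> real \<Rightarrow> real \<Rightarrow> real \<Rightarrow> real \<Rightarrow> bool" where
  "maps_linearly f a b c d \<longleftrightarrow> (\<forall>t\<in>{0..1}. f (pt (a + t * (b - a))) = pt (c + t * (d - c)))"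

text \<open>
  Maps of the circle are extensional functions on \<open>S1\<close>, as in \<open>BijGroup S1\<close>. Since the intervals
  of \<open>D\<close> cover the circle, \<open>\<phi>\<close> determines \<open>f\<close>, which is then automatically an orientation-preserving
  homeomorphism.
\<close>

definition TB :: "(complex \<Rightarrow> complex) set" where
  "TB = {f \<in> extensional S1. \<exists>D R \<phi>. arc_diagram D \<and> arc_diagram R \<and> diagram_iso \<phi> D R \<and>
           (\<forall>a b c d. circle_interval D a b \<longrightarrow> circle_interval R c d \<longrightarrow>
              \<phi> (pt ` {a..b}) = pt ` {c..d} \<longrightarrow> maps_linearly f a b c d)}"

text \<open>
  \<open>interpolate ps\<close> is the piecewise-linear function through the points \<open>ps\<close> of the plane (with
  increasing abscissae). If these span exactly one period and start at \<open>(a, _)\<close>, then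
  \<open>pl_circle ps\<close> is the induced map of the circle, computed with representatives
  in \<open>{a..<a + 1}\<close>.
\<close>

fun interpolate :: "(real \<times> real) list \<Rightarrow> real \<Rightarrow> real" where
  "interpolate ((a, c) # (b, d) # ps) x =
     (if x \<le> b then c + (d - c) / (b - a) * (x - a) else interpolate ((b, d) # ps) x)"
| "interpolate _ x = 0"

definition pl_circle :: "(real \<times> real) list \<Rightarrow> complex \<Rightarrow> complex" where
  "pl_circle ps =
     (\<lambda>z\<in>S1. pt (interpolate ps
        (THE x. fst (hd ps) \<le> x \<and> x < fst (hd ps) + 1 \<and> pt x = z)))"

definition alpha :: "complex \<Rightarrow> complex" where
  "alpha = pl_circle [(-1/3, -1/6), (1/3, 1/6), (2/3, 5/6)]"

definition beta :: "complex \<Rightarrow> complex" where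
  "beta = pl_circle [(-1/6, -1/6), (1/6, 1/6), (2/3, 7/24), (17/24, 1/3), (5/6, 5/6)]"

definition gamma :: "complex \<Rightarrow> complex" where
  "gamma = pl_circle [(1/6, 1/6), (7/24, 19/96), (29/96, 5/24), (1/3, 1/3), (7/6, 7/6)]"

definition delta :: "complex \<Rightarrow> complex" where
  "delta = pl_circle [(0, 1/2), (1, 3/2)]"

end

theory Submission
  imports Defs "HOL-Library.Confluence"
begin

text \<open>
  An element of \<open>TB\<close> is best described by a lift to the real line: an increasing bijection \<open>F\<close> with
  \<open>F (x + 1) = F x + 1\<close> that is affine on the circle intervals of an arc diagram and carries its arcs
  to the arcs of an arc diagram (\<open>rearr\<close>, \<open>TB_eq\<close>). From an isomorphism of 2-complexes one obtains
  such an \<open>F\<close> by lifting along \<open>pt\<close>, and the incidences between vertices and arcs show that arcs go to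
  arcs. Conversely \<open>F\<close> has to induce a bijection of the faces. Since arcs do not cross, a face consists
  of the points of the open disk that are on the same side of every arc as some circle point that is
  not a vertex (\<open>faces_eq\<close>). For circle points, being on the same side of an arc is a matter of
  cyclic order, and \<open>F\<close> preserves the cyclic order.

  Expansions of different intervals commute, so two arc diagrams have a common expansion; and \<open>F\<close>
  carries expansions to expansions, because the primary arc divides its interval in a fixed ratio.
  Hence the maps with such a lift form a group (\<open>rearr_subgroup\<close>), and it contains the four generators.

  Let \<open>G\<close> be the group that they generate. Each interval that arises by subdivision is carried affinely
  by \<open>G\<close> onto \<open>[1/3, 2/3]\<close> or \<open>[1/6, 1/3]\<close> (\<open>modelled_children\<close>): the inductive step is a
  calculation with \<open>\<alpha>\<close>, \<open>\<beta>\<close> and \<open>\<delta>\<close> for the three parts of these two intervals. On \<open>[1/6, 5/6]\<close>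
  and on \<open>[1/6, 1/3]\<close> the inverses of \<open>\<beta>\<close> and \<open>\<gamma>\<close> act as tree rotations, so by conjugation \<open>G\<close>
  contains a rotation inside every such interval (\<open>rotation_exists\<close>). Rotations bring any outermost
  arc of a subdivided interval into the position of the primary arc (\<open>raise_arc_to_root\<close>). Therefore a
  rearrangement of one interval can be composed with rotations until it fixes the primary arc; then it
  splits into rearrangements of the three parts, and induction on the subdivision shows that it
  belongs to \<open>G\<close> (\<open>interval_rearrangement_generated\<close>).

  Finally \<open>G\<close> carries every arc, in both orientations, to the arc from \<open>1/6\<close> to \<open>5/6\<close>
  (\<open>base_arc_returns\<close>). So an arbitrary rearrangement can be composed with an element of \<open>G\<close> to fix this
  arc, and then it is the product of a rearrangement of \<open>[1/6, 5/6]\<close> and one of \<open>[5/6, 7/6]\<close>.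
\<close>


section \<open>Points of the circle\<close>

lemma pt_eq_iff: "pt x = pt y \<longleftrightarrow> (\<exists>k::int. x = y + of_int k)"
proof -
  have "pt x = pt y \<longleftrightarrow> (\<exists>k::int. 2 * pi * x = 2 * pi * y + 2*pi * of_int k)"
  proof -
    have "pt x = pt y \<longleftrightarrow> (\<exists>n::int. \<i> * complex_of_real (2 * pi * x) = \<i> * complex_of_real (2 * pi * y) + (of_int (2*n) * pi) * \<i>)"
      unfolding pt_def cis_conv_exp exp_eq by simp
    also have "\<dots> \<longleftrightarrow> (\<exists>k::int. 2 * pi * x = 2 * pi * y + 2*pi * of_int k)"
    proof -
      have "(\<i> * complex_of_real (2 * pi * x) = \<i> * complex_of_real (2 * pi * y) + (of_int (2*n) * pi) * \<i>)
         \<longleftrightarrow> (2 * pi * x = 2 * pi * y + 2*pi * of_int n)" for n :: int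
        by (auto simp: complex_eq_iff algebra_simps)
      then show ?thesis by blast
    qed
    finally show ?thesis .
  qed
  also have "\<dots> \<longleftrightarrow> (\<exists>k::int. x = y + of_int k)"
  proof -
    have "(2 * pi * x = 2 * pi * y + 2*pi * of_int k) \<longleftrightarrow> x = y + of_int k" for k::int
      by (metis distrib_left mult_cancel_left mult_eq_0_iff pi_neq_zero zero_neq_numeral)
    then show ?thesis by blast
  qed
  finally show ?thesis .
qed

lemma pt_add_int [simp]: "pt (x + of_int k) = pt x"
  using pt_eq_iff by blast

lemma pt_add_one [simp]: "pt (x + 1) = pt x"
  using pt_add_int[of x 1] by simp

lemma norm_pt [simp]: "cmod (pt x) = 1"
  by (simp add: pt_def)

lemma pt_eq_near: "pt x = pt y \<Longrightarrow> \<bar>x - y\<bar> < 1 \<Longrightarrow> x = y"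
  unfolding pt_eq_iff by (metis of_int_abs add_diff_cancel_left' add.right_neutral of_int_0 of_int_less_1_iff zabs_less_one_iff)

lemma shift_into_period: "\<exists>k::int. a \<le> x + of_int k \<and> x + of_int k < a + 1"
  for a x :: real
  by (rule exI[of _ "- \<lfloor>x - a\<rfloor>"]) (simp; linarith)

lemma S1_obtain_pt:
  assumes "z \<in> S1" obtains x where "a \<le> x" "x < a + 1" "z = pt x"
proof -
  have "z = cis (Arg z)" using assms cis_Arg[of z] by (cases "z = 0") (auto simp: sgn_eq)
  then have "z = pt (Arg z / (2*pi))" by (simp add: pt_def)
  moreover obtain k :: int where "a \<le> Arg z / (2*pi) + of_int k" "Arg z / (2*pi) + of_int k < a + 1"
    using shift_into_period by blast
  ultimately show ?thesis using that[of "Arg z / (2*pi) + of_int k"] by simp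
qed

lemma S1_obtain_pt':
  assumes "z \<in> S1" obtains x where "a < x" "x \<le> a + 1" "z = pt x"
proof -
  obtain x where x: "a \<le> x" "x < a + 1" "z = pt x" using S1_obtain_pt[OF assms] by blast
  show ?thesis
  proof (cases "x = a")
    case True then show ?thesis using that[of "a+1"] x by simp
  next
    case False then show ?thesis using that[of x] x by simp
  qed
qed

lemma continuous_on_pt: "continuous_on S pt"
  unfolding pt_def cis_conv_exp by (intro continuous_intros)

lemma finite_pt_vimage:
  assumes "finite W" shows "finite {x. a \<le> x \<and> x \<le> b \<and> pt x \<in> W}"
proof -
  have one: "finite {x. a \<le> x \<and> x \<le> b \<and> pt x = w}" for w
  proof (cases "\<exists>y. pt y = w")
    case True
    then obtain y where y: "pt y = w" by blast
    have "{x. a \<le> x \<and> x \<le> b \<and> pt x = w} \<subseteq> (\<lambda>k::int. y + of_int k) ` {\<lfloor>a - y\<rfloor>..\<lceil>b - y\<rceil>}"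
    proof
      fix x assume "x \<in> {x. a \<le> x \<and> x \<le> b \<and> pt x = w}"
      then obtain k :: int where k: "x = y + of_int k" "a \<le> x" "x \<le> b" using y pt_eq_iff by auto
      then have "k \<in> {\<lfloor>a - y\<rfloor>..\<lceil>b - y\<rceil>}" by (auto; linarith)
      then show "x \<in> (\<lambda>k::int. y + of_int k) ` {\<lfloor>a - y\<rfloor>..\<lceil>b - y\<rceil>}" using k by blast
    qed
    then show ?thesis using finite_surj by blast
  qed auto
  have "{x. a \<le> x \<and> x \<le> b \<and> pt x \<in> W} = (\<Union>w\<in>W. {x. a \<le> x \<and> x \<le> b \<and> pt x = w})" by auto
  then show ?thesis using one assms by simp
qed

section \<open>Circle intervals\<close>

lemma circle_interval_shift:
  "circle_interval D a b \<Longrightarrow> circle_interval D (a + of_int k) (b + of_int k)"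
proof -
  assume ci: "circle_interval D a b"
  have "pt x \<notin> \<Union>D" if "a + of_int k < x" "x < b + of_int k" for x
  proof -
    have "a < x - of_int k" "x - of_int k < b" using that by auto
    then have "pt (x - of_int k) \<notin> \<Union>D" using ci unfolding circle_interval_def by blast
    then show ?thesis using pt_add_int[of "x - of_int k" k] by simp
  qed
  then show ?thesis using ci unfolding circle_interval_def by auto
qed

lemma circle_interval_unique:
  assumes "circle_interval D a b" "circle_interval D c d" "a < x" "x < b" "c < x" "x < d"
  shows "a = c" "b = d"
proof -
  have "\<not> (c < a)" "\<not> (a < c)" "\<not> (b < d)" "\<not> (d < b)"
    using assms unfolding circle_interval_def by (meson less_trans)+
  then show "a = c" "b = d" by auto
qed

lemma vertex_before:
  assumes "finite W" "W \<subseteq> S1" "W \<noteq> {}"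
  obtains a where "a < x" "x - 1 \<le> a" "pt a \<in> W" "\<forall>y. a < y \<and> y < x \<longrightarrow> pt y \<notin> W"
proof -
  define Q where "Q = {y. x - 1 \<le> y \<and> y < x \<and> pt y \<in> W}"
  have "finite Q" by (rule finite_subset[OF _ finite_pt_vimage[OF assms(1), of "x-1" x]]) (auto simp: Q_def)
  moreover obtain w where "w \<in> W" using assms by blast
  then obtain y where "x - 1 \<le> y" "y < x - 1 + 1" "w = pt y" using S1_obtain_pt assms by blast
  then have "y \<in> Q" using \<open>w \<in> W\<close> by (auto simp: Q_def)
  ultimately have "Max Q \<in> Q" "\<forall>y\<in>Q. y \<le> Max Q" using Max_in by auto
  then show ?thesis
  proof (intro that[of "Max Q"])
    show "\<forall>y. Max Q < y \<and> y < x \<longrightarrow> pt y \<notin> W"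
    proof (intro allI impI notI)
      fix y assume y: "Max Q < y \<and> y < x" "pt y \<in> W"
      moreover have "x - 1 \<le> Max Q" using \<open>Max Q \<in> Q\<close> by (simp add: Q_def)
      ultimately have "y \<in> Q" by (simp add: Q_def)
      then show False using y \<open>\<forall>y\<in>Q. y \<le> Max Q\<close> by force
    qed
  qed (use \<open>Max Q \<in> Q\<close> in \<open>auto simp: Q_def\<close>)
qed

lemma vertex_after:
  assumes "finite W" "W \<subseteq> S1" "W \<noteq> {}"
  obtains b where "x < b" "b \<le> x + 1" "pt b \<in> W" "\<forall>y. x < y \<and> y < b \<longrightarrow> pt y \<notin> W"
proof -
  define Q where "Q = {y. x < y \<and> y \<le> x + 1 \<and> pt y \<in> W}"
  have "finite Q" by (rule finite_subset[OF _ finite_pt_vimage[OF assms(1), of "x" "x+1"]]) (auto simp: Q_def)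
  moreover obtain w where "w \<in> W" using assms by blast
  then obtain y where "x < y" "y \<le> x + 1" "w = pt y" using S1_obtain_pt' assms by blast
  then have "y \<in> Q" using \<open>w \<in> W\<close> by (auto simp: Q_def)
  ultimately have "Min Q \<in> Q" "\<forall>y\<in>Q. Min Q \<le> y" using Min_in by auto
  then show ?thesis
  proof (intro that[of "Min Q"])
    show "\<forall>y. x < y \<and> y < Min Q \<longrightarrow> pt y \<notin> W"
    proof (intro allI impI notI)
      fix y assume y: "x < y \<and> y < Min Q" "pt y \<in> W"
      moreover have "Min Q \<le> x + 1" using \<open>Min Q \<in> Q\<close> by (simp add: Q_def)
      ultimately have "y \<in> Q" by (simp add: Q_def)
      then show False using y \<open>\<forall>y\<in>Q. Min Q \<le> y\<close> by force
    qed
  qed (use \<open>Min Q \<in> Q\<close> in \<open>auto simp: Q_def\<close>)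
qed

text \<open>
  With two distinct vertices every circle interval is shorter than the circle
  (\<open>circle_interval_length\<close>).
\<close>

definition vertices_ok :: "complex set set \<Rightarrow> bool" where
  "vertices_ok D \<longleftrightarrow> finite (\<Union>D) \<and> \<Union>D \<subseteq> S1 \<and> (\<exists>u\<in>\<Union>D. \<exists>v\<in>\<Union>D. u \<noteq> v)"

lemma circle_interval_right:
  assumes "vertices_ok D"
  obtains a b where "circle_interval D a b" "a \<le> x" "x < b"
proof -
  have W: "finite (\<Union>D)" "\<Union>D \<subseteq> S1" "\<Union>D \<noteq> {}" using assms unfolding vertices_ok_def by auto
  obtain b where b: "x < b" "pt b \<in> \<Union>D" "\<forall>y. x < y \<and> y < b \<longrightarrow> pt y \<notin> \<Union>D"
    using vertex_after[OF W] by metis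
  show ?thesis
  proof (cases "pt x \<in> \<Union>D")
    case True then show ?thesis using that[of x b] b unfolding circle_interval_def by auto
  next
    case False
    obtain a where a: "a < x" "pt a \<in> \<Union>D" "\<forall>y. a < y \<and> y < x \<longrightarrow> pt y \<notin> \<Union>D"
      using vertex_before[OF W] by metis
    have "circle_interval D a b" unfolding circle_interval_def
      using a b False by (metis less_trans linorder_less_linear)
    then show ?thesis using that a b by auto
  qed
qed

lemma circle_interval_left:
  assumes "vertices_ok D"
  obtains a b where "circle_interval D a b" "a < x" "x \<le> b"
proof -
  have W: "finite (\<Union>D)" "\<Union>D \<subseteq> S1" "\<Union>D \<noteq> {}" using assms unfolding vertices_ok_def by auto
  obtain a where a: "a < x" "pt a \<in> \<Union>D" "\<forall>y. a < y \<and> y < x \<longrightarrow> pt y \<notin> \<Union>D"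
    using vertex_before[OF W] by metis
  show ?thesis
  proof (cases "pt x \<in> \<Union>D")
    case True then show ?thesis using that[of a x] a unfolding circle_interval_def by auto
  next
    case False
    obtain b where b: "x < b" "pt b \<in> \<Union>D" "\<forall>y. x < y \<and> y < b \<longrightarrow> pt y \<notin> \<Union>D"
      using vertex_after[OF W] by metis
    have "circle_interval D a b" unfolding circle_interval_def
      using a b False by (metis less_trans linorder_less_linear)
    then show ?thesis using that a b by auto
  qed
qed

lemma circle_interval_length:
  assumes "vertices_ok D" "circle_interval D a b" shows "b < a + 1"
proof -
  obtain w where w: "w \<in> \<Union>D" "w \<noteq> pt a" "w \<in> S1" using assms unfolding vertices_ok_def by blast
  obtain x where x: "a \<le> x" "x < a + 1" "w = pt x" using S1_obtain_pt[OF w(3)] by blast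
  then have "a < x" using w by (cases "x = a") auto
  then have "b \<le> x" using assms(2) x w unfolding circle_interval_def by (metis not_le)
  then show ?thesis using x by simp
qed

text \<open>
  The midpoint of the first interval is not a vertex, so a translate of it lies inside the second
  interval, and circle intervals with a common interior point coincide.
\<close>

lemma circle_interval_image_eq:
  assumes "circle_interval D a b" "circle_interval D c d" "pt ` {a..b} = pt ` {c..d}"
  obtains k :: int where "c = a + of_int k" "d = b + of_int k"
proof -
  define m where "m = (a+b)/2"
  have m: "a < m" "m < b" using assms(1) unfolding circle_interval_def m_def by auto
  then have "pt m \<in> pt ` {c..d}" using assms(3) by (metis atLeastAtMost_iff image_eqI less_imp_le)
  then obtain y where y: "c \<le> y" "y \<le> d" "pt y = pt m" by auto
  then obtain k :: int where k: "y = m + of_int k" using pt_eq_iff by blast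
  have "pt y \<notin> \<Union>D" using y(3) m assms(1) unfolding circle_interval_def by auto
  then have "y \<noteq> c" "y \<noteq> d" using assms(2) unfolding circle_interval_def by auto
  then have "c < y" "y < d" using y by auto
  then have "c = a + of_int k" "d = b + of_int k"
    using circle_interval_unique[OF circle_interval_shift[OF assms(1), of k] assms(2), of y] m k by auto
  then show ?thesis using that by blast
qed

section \<open>Lifts of circle homeomorphisms\<close>

text \<open>
  The lifts to the real line of the orientation-preserving homeomorphisms of the circle; an increasing
  surjection of the line is continuous.
\<close>

definition homeo_lift :: "(real \<Rightarrow> real) \<Rightarrow> bool" where
  "homeo_lift F \<longleftrightarrow> strict_mono F \<and> surj F \<and> (\<forall>x. F (x + 1) = F x + 1)"

lemma homeo_lift_less: "homeo_lift F \<Longrightarrow> F x < F y \<longleftrightarrow> x < y"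
  unfolding homeo_lift_def using strict_mono_less by blast

lemma homeo_lift_le: "homeo_lift F \<Longrightarrow> F x \<le> F y \<longleftrightarrow> x \<le> y"
  unfolding homeo_lift_def using strict_mono_less_eq by blast

lemma homeo_lift_eq: "homeo_lift F \<Longrightarrow> F x = F y \<longleftrightarrow> x = y"
  unfolding homeo_lift_def using strict_mono_eq by blast

lemma homeo_lift_surj: "homeo_lift F \<Longrightarrow> \<exists>x. y = F x"
  unfolding homeo_lift_def by (metis surjD)

lemma homeo_lift_add_nat: "homeo_lift F \<Longrightarrow> F (x + of_nat n) = F x + of_nat n"
proof (induction n)
  case (Suc n)
  have "F (x + real (Suc n)) = F ((x + real n) + 1)" by (simp add: algebra_simps)
  also have "\<dots> = F x + real n + 1" using Suc unfolding homeo_lift_def by metis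
  finally show ?case by simp
qed simp

lemma homeo_lift_add_int: "homeo_lift F \<Longrightarrow> F (x + of_int k) = F x + of_int k"
proof (cases "k \<ge> 0")
  case True
  assume "homeo_lift F" then show ?thesis using homeo_lift_add_nat[of F x "nat k"] True by simp
next
  case False
  assume "homeo_lift F" then show ?thesis using homeo_lift_add_nat[of F "x + of_int k" "nat (-k)"] False by simp
qed

lemma homeo_lift_add_one: "homeo_lift F \<Longrightarrow> F (x + 1) = F x + 1"
  unfolding homeo_lift_def by blast

lemma homeo_lift_pt_eq: "homeo_lift F \<Longrightarrow> pt (F x) = pt (F y) \<longleftrightarrow> pt x = pt y"
  unfolding pt_eq_iff by (metis homeo_lift_add_int homeo_lift_eq)

lemma homeo_lift_image_Icc: assumes "homeo_lift F" shows "F ` {a..b} = {F a..F b}"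
proof
  show "F ` {a..b} \<subseteq> {F a..F b}" using homeo_lift_le[OF assms] by auto
  show "{F a..F b} \<subseteq> F ` {a..b}"
  proof
    fix y assume y: "y \<in> {F a..F b}"
    obtain x where "y = F x" using homeo_lift_surj[OF assms] by blast
    then show "y \<in> F ` {a..b}" using y homeo_lift_le[OF assms] by auto
  qed
qed

lemma homeo_lift_comp: "homeo_lift F \<Longrightarrow> homeo_lift G \<Longrightarrow> homeo_lift (F \<circ> G)"
  unfolding homeo_lift_def using comp_surj[of G F] by (auto simp: strict_mono_def simp del: o_apply) (simp_all)

lemma homeo_lift_id: "homeo_lift (\<lambda>x. x)"
  unfolding homeo_lift_def by (auto simp: strict_mono_def)

lemma homeo_lift_translate: "homeo_lift (\<lambda>x. x + c)"
  unfolding homeo_lift_def strict_mono_def surj_def by (auto intro: exI[of _ "_ - c"])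

lemma homeo_lift_inv: assumes "homeo_lift F" shows "homeo_lift (the_inv F)"
proof -
  have bij: "bij F" using assms unfolding homeo_lift_def bij_def by (simp add: strict_mono_imp_inj_on)
  have 1: "F (the_inv F x) = x" for x using bij by (simp add: f_the_inv_into_f bij_betw_def)
  have 2: "the_inv F (F x) = x" for x using bij by (simp add: the_inv_f_f bij_betw_def)
  have "strict_mono (the_inv F)" unfolding strict_mono_def using homeo_lift_less[OF assms] 1 by metis
  moreover have "surj (the_inv F)" using 2 by (metis surjI)
  moreover have "the_inv F (x+1) = the_inv F x + 1" for x
    using homeo_lift_eq[OF assms, of "the_inv F (x+1)" "the_inv F x + 1"] homeo_lift_add_one[OF assms] 1 by simp
  ultimately show ?thesis unfolding homeo_lift_def by blast
qed

lemma homeo_lift_inv_f: "homeo_lift F \<Longrightarrow> the_inv F (F x) = x"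
  unfolding homeo_lift_def by (simp add: the_inv_f_f strict_mono_imp_inj_on)

lemma homeo_lift_f_inv: "homeo_lift F \<Longrightarrow> F (the_inv F x) = x"
  unfolding homeo_lift_def by (simp add: f_the_inv_into_f strict_mono_imp_inj_on)

text \<open>
  The choice of the representative does not matter when \<open>F\<close> commutes with integer translations
  (\<open>circ_pt\<close>).
\<close>

definition circ :: "(real \<Rightarrow> real) \<Rightarrow> complex \<Rightarrow> complex" where
  "circ F = (\<lambda>z\<in>S1. pt (F (SOME x. pt x = z)))"

lemma circ_pt: assumes "homeo_lift F" shows "circ F (pt x) = pt (F x)"
proof -
  have "pt (SOME y. pt y = pt x) = pt x" by (rule someI) simp
  then show ?thesis unfolding circ_def using homeo_lift_pt_eq[OF assms] by simp
qed

lemma circ_extensional [simp]: "circ F \<in> extensional S1"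
  by (simp add: circ_def)

lemma circ_eqI:
  assumes "f \<in> extensional S1" "homeo_lift F" "\<And>x. f (pt x) = pt (F x)"
  shows "f = circ F"
proof (rule extensionalityI[OF assms(1) circ_extensional])
  fix z assume "z \<in> S1"
  then obtain x where "z = pt x" using S1_obtain_pt by metis
  then show "f z = circ F z" using assms circ_pt by simp
qed

lemma circ_comp:
  assumes "homeo_lift F" "homeo_lift G" shows "compose S1 (circ F) (circ G) = circ (F \<circ> G)"
  by (rule circ_eqI) (auto simp: assms homeo_lift_comp circ_pt compose_def)

lemma circ_id: "circ (\<lambda>x. x) = (\<lambda>z\<in>S1. z)"
  by (rule circ_eqI[symmetric]) (auto simp: homeo_lift_id)

lemma circ_Bij: assumes "homeo_lift F" shows "circ F \<in> Bij S1"
proof -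
  have "inj_on (circ F) S1"
  proof (rule inj_onI)
    fix z w assume "z \<in> S1" "w \<in> S1" "circ F z = circ F w"
    then show "z = w" using S1_obtain_pt circ_pt[OF assms] homeo_lift_pt_eq[OF assms] by metis
  qed
  moreover have "circ F ` S1 = S1"
  proof
    show "circ F ` S1 \<subseteq> S1" unfolding circ_def by auto
    show "S1 \<subseteq> circ F ` S1"
    proof
      fix z assume "z \<in> S1"
      then obtain x where "z = pt x" using S1_obtain_pt by metis
      then have "z = circ F (pt (the_inv F x))" using circ_pt[OF assms] homeo_lift_f_inv[OF assms] by simp
      then show "z \<in> circ F ` S1" by simp
    qed
  qed
  ultimately show ?thesis unfolding Bij_def bij_betw_def by simp
qed

lemma circ_mult:
  assumes "homeo_lift F" "homeo_lift G"
  shows "circ F \<otimes>\<^bsub>BijGroup S1\<^esub> circ G = circ (F \<circ> G)"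
  using assms by (simp add: BijGroup_def circ_Bij circ_comp)

lemma circ_one: "\<one>\<^bsub>BijGroup S1\<^esub> = circ (\<lambda>x. x)"
  by (simp add: BijGroup_def circ_id)

lemma circ_inv:
  assumes "homeo_lift F" shows "inv\<^bsub>BijGroup S1\<^esub> (circ F) = circ (the_inv F)"
proof -
  interpret group "BijGroup S1" by (rule group_BijGroup)
  have "the_inv F \<circ> F = (\<lambda>x. x)" using homeo_lift_inv_f[OF assms] by auto
  then have "circ (the_inv F) \<otimes>\<^bsub>BijGroup S1\<^esub> circ F = \<one>\<^bsub>BijGroup S1\<^esub>"
    by (simp only: circ_mult[OF homeo_lift_inv[OF assms] assms] circ_one)
  moreover have "circ F \<in> carrier (BijGroup S1)" "circ (the_inv F) \<in> carrier (BijGroup S1)"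
    using circ_Bij assms homeo_lift_inv by (auto simp: BijGroup_def)
  ultimately show ?thesis by (intro inv_equality)
qed

definition push :: "(real \<Rightarrow> real) \<Rightarrow> complex set set \<Rightarrow> complex set set" where
  "push F D = (`) (circ F) ` D"

lemma Union_push: "\<Union>(push F D) = circ F ` \<Union>D"
  unfolding push_def by blast

lemma pt_in_push:
  assumes "homeo_lift F" "\<Union>D \<subseteq> S1" shows "pt (F x) \<in> \<Union>(push F D) \<longleftrightarrow> pt x \<in> \<Union>D"
proof -
  have "inj_on (circ F) S1" using circ_Bij[OF assms(1)] unfolding Bij_def bij_betw_def by simp
  then have "circ F (pt x) \<in> circ F ` \<Union>D \<longleftrightarrow> pt x \<in> \<Union>D" using assms(2) by (auto dest!: inj_onD)
  then show ?thesis unfolding Union_push circ_pt[OF assms(1)] .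
qed

lemma circle_interval_push:
  assumes "homeo_lift F" "\<Union>D \<subseteq> S1"
  shows "circle_interval (push F D) (F a) (F b) \<longleftrightarrow> circle_interval D a b"
proof -
  have "(\<forall>y. F a < y \<and> y < F b \<longrightarrow> pt y \<notin> \<Union>(push F D)) \<longleftrightarrow>
        (\<forall>x. F a < F x \<and> F x < F b \<longrightarrow> pt (F x) \<notin> \<Union>(push F D))"
    using homeo_lift_surj[OF assms(1)] by metis
  then show ?thesis
    unfolding circle_interval_def pt_in_push[OF assms] homeo_lift_less[OF assms(1)] by blast
qed

lemma push_comp:
  assumes "homeo_lift F" "homeo_lift G" "\<Union>D \<subseteq> S1" shows "push F (push G D) = push (F \<circ> G) D"
proof -
  have "circ F ` circ G ` A = circ (F \<circ> G) ` A" if "A \<in> D" for A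
  proof -
    have "circ F (circ G z) = circ (F \<circ> G) z" if "z \<in> A" for z
      using circ_comp[OF assms(1,2)] that \<open>A \<in> D\<close> assms(3) by (metis UnionI compose_eq subsetD)
    then show ?thesis by (auto simp: image_iff)
  qed
  then show ?thesis unfolding push_def image_image by (rule image_cong[OF refl])
qed

lemma push_id: "\<Union>D \<subseteq> S1 \<Longrightarrow> push (\<lambda>x. x) D = D"
proof -
  assume "\<Union>D \<subseteq> S1"
  then have "circ (\<lambda>x. x) ` A = A" if "A \<in> D" for A
    using that unfolding circ_id by (force simp: image_iff)
  then show ?thesis unfolding push_def by simp
qed

lemma push_insert: "push F (insert A D) = insert (circ F ` A) (push F D)"
  unfolding push_def by simp

definition affine_on :: "(real \<Rightarrow> real) \<Rightarrow> real \<Rightarrow> real \<Rightarrow> bool" where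
  "affine_on F a b \<longleftrightarrow> (\<exists>m c. \<forall>x\<in>{a..b}. F x = m * x + c)"

lemma affine_on_subset: "affine_on F a b \<Longrightarrow> a \<le> c \<Longrightarrow> d \<le> b \<Longrightarrow> affine_on F c d"
  unfolding affine_on_def by (meson atLeastAtMost_iff order_trans)

lemma affine_on_cong: "(\<And>x. a \<le> x \<Longrightarrow> x \<le> b \<Longrightarrow> F x = G x) \<Longrightarrow> affine_on F a b = affine_on G a b"
  unfolding affine_on_def by auto

lemma affine_on_comp:
  assumes "affine_on F a b" "affine_on G (F a) (F b)" "mono_on {a..b} F"
  shows "affine_on (G \<circ> F) a b"
proof -
  obtain m c where F: "\<forall>x\<in>{a..b}. F x = m * x + c" using assms(1) unfolding affine_on_def by blast
  obtain n d where G: "\<forall>x\<in>{F a..F b}. G x = n * x + d" using assms(2) unfolding affine_on_def by blast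
  have "G (F x) = (n*m) * x + (n*c+d)" if "x \<in> {a..b}" for x
  proof -
    have "F x \<in> {F a..F b}" using that assms(3) by (auto simp: monotone_on_def)
    then show ?thesis using F G that by (simp add: algebra_simps)
  qed
  then show ?thesis unfolding affine_on_def by auto
qed

lemma affine_on_param:
  assumes "affine_on F a b" "0 \<le> t" "t \<le> 1" "a \<le> b"
  shows "F (a + t * (b - a)) = F a + t * (F b - F a)"
proof -
  obtain m c where F: "\<forall>x\<in>{a..b}. F x = m * x + c" using assms(1) unfolding affine_on_def by blast
  have "t * (b - a) \<le> 1 * (b - a)" using assms by (intro mult_right_mono) auto
  then have "a + t * (b - a) \<in> {a..b}" using assms by auto
  then show ?thesis using F assms by (simp add: algebra_simps)
qed

lemma homeo_lift_mono_on: "homeo_lift F \<Longrightarrow> mono_on A F"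
  by (simp add: monotone_on_def homeo_lift_le)

lemma affine_on_inv:
  assumes "homeo_lift F" "affine_on F a b" "a < b" shows "affine_on (the_inv F) (F a) (F b)"
proof -
  obtain m c where F: "\<forall>x\<in>{a..b}. F x = m * x + c" using assms(2) unfolding affine_on_def by blast
  have "F a < F b" using assms homeo_lift_less by blast
  then have m: "m \<noteq> 0" using F assms(3) by auto
  have "the_inv F y = (1/m) * y + (-c/m)" if "y \<in> {F a..F b}" for y
  proof -
    have "y \<in> F ` {a..b}" using that homeo_lift_image_Icc[OF assms(1)] by simp
    then obtain x where x: "x \<in> {a..b}" "y = F x" by (elim imageE)
    have "y = m * x + c" using x F by blast
    then have "(1/m) * y + (-c/m) = x" using m by (simp add: divide_simps)
    then show ?thesis using x homeo_lift_inv_f[OF assms(1)] by simp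
  qed
  then show ?thesis unfolding affine_on_def by blast
qed

section \<open>Expansions of arc diagrams\<close>

abbreviation base_diagram :: "complex set set" where
  "base_diagram \<equiv> {{pt (1/3), pt (2/3)}, {pt (1/6), pt (5/6)}}"

definition expansion_step :: "complex set set \<Rightarrow> complex set set \<Rightarrow> bool" where
  "expansion_step D E \<longleftrightarrow> (\<exists>a b. circle_interval D a b \<and> E = insert (primary_arc a b) D)"

lemma arc_diagram_iff_expansion: "arc_diagram D \<longleftrightarrow> expansion_step\<^sup>*\<^sup>* base_diagram D"
proof
  show "arc_diagram D \<Longrightarrow> expansion_step\<^sup>*\<^sup>* base_diagram D"
  proof (induction rule: arc_diagram.induct)
    case (expand D a b)
    then have "expansion_step D (insert (primary_arc a b) D)" unfolding expansion_step_def by blast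
    then show ?case using expand.IH by simp
  qed simp
  show "expansion_step\<^sup>*\<^sup>* base_diagram D \<Longrightarrow> arc_diagram D"
    by (induction rule: rtranclp_induct) (auto simp: expansion_step_def intro: arc_diagram.intros)
qed

lemma base_diagram_subset: "arc_diagram D \<Longrightarrow> base_diagram \<subseteq> D"
  by (induction rule: arc_diagram.induct) auto

lemma pt_third_neq: "pt (1/3) \<noteq> pt (2/3)"
  using pt_eq_near[of "1/3" "2/3"] by auto

lemma arc_diagram_finite_Union: "arc_diagram D \<Longrightarrow> finite (\<Union>D)"
  by (induction rule: arc_diagram.induct) (auto simp: primary_arc_def)

lemma arc_diagram_finite: "arc_diagram D \<Longrightarrow> finite D"
  using arc_diagram_finite_Union finite_UnionD by blast

lemma arc_diagram_subset_S1: "arc_diagram D \<Longrightarrow> \<Union>D \<subseteq> S1"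
  by (induction rule: arc_diagram.induct) (auto simp: primary_arc_def)

lemma arc_diagram_vertices_ok:
  assumes "arc_diagram D" shows "vertices_ok D"
proof -
  have "pt (1/3) \<in> \<Union>D" "pt (2/3) \<in> \<Union>D" using base_diagram_subset[OF assms] by auto
  then show ?thesis unfolding vertices_ok_def
    using arc_diagram_finite_Union[OF assms] arc_diagram_subset_S1[OF assms] pt_third_neq by blast
qed

lemma arc_diagram_arcs:
  assumes "arc_diagram D" "A \<in> D" obtains p q where "p < q" "q < p + 1" "A = {pt p, pt q}"
proof -
  have "\<forall>A\<in>D. \<exists>p q. p < q \<and> q < p + 1 \<and> A = {pt p, pt q}"
    using assms(1)
  proof (induction rule: arc_diagram.induct)
    case base
    have "(1/3::real) < 2/3 \<and> 2/3 < 1/3 + (1::real) \<and> (1/6::real) < 5/6 \<and> 5/6 < 1/6 + (1::real)" by simp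
    then show ?case by blast
  next
    case (expand D a b)
    then have "a < b" "b < a + 1"
      using circle_interval_length[OF arc_diagram_vertices_ok] by (auto simp: circle_interval_def)
    then have "a + (b - a) / 4 < b - (b - a) / 4 \<and> b - (b - a) / 4 < a + (b - a) / 4 + 1" by (simp add: field_simps)
    then have "\<exists>p q. p < q \<and> q < p + 1 \<and> primary_arc a b = {pt p, pt q}" unfolding primary_arc_def by blast
    then show ?case using expand.IH by simp
  qed
  then show ?thesis using assms(2) that by blast
qed

lemma circle_interval_refine:
  assumes "vertices_ok D" "\<Union>D \<subseteq> \<Union>E" "circle_interval E c d"
  obtains a b where "circle_interval D a b" "a \<le> c" "d \<le> b"
proof -
  obtain a b where ab: "circle_interval D a b" "a \<le> c" "c < b" using circle_interval_right[OF assms(1)] by blast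
  have "pt b \<in> \<Union>E" using ab(1) assms(2) unfolding circle_interval_def by blast
  then have "d \<le> b" using ab(3) assms(3) unfolding circle_interval_def by (metis not_le)
  then show ?thesis using that ab by blast
qed

lemma primary_arc_shift: "primary_arc (a + of_int k) (b + of_int k) = primary_arc a b"
proof -
  have "a + of_int k + (b + of_int k - (a + of_int k)) / 4 = a + (b - a)/4 + of_int k"
       "b + of_int k - (b + of_int k - (a + of_int k)) / 4 = b - (b - a)/4 + of_int k" by auto
  then show ?thesis unfolding primary_arc_def by (simp only: pt_add_int)
qed

text \<open>
  The new vertices are interior to the expanded interval, and circle intervals with a common interior
  point are translates of each other.
\<close>

lemma circle_interval_after_expansion:
  assumes "circle_interval D a b" "circle_interval D c d" "primary_arc a b \<noteq> primary_arc c d"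
  shows "circle_interval (insert (primary_arc a b) D) c d"
proof -
  have *: "pt x \<noteq> pt y" if xy: "c < x" "x < d" "a < y" "y < b" for x y
  proof
    assume "pt x = pt y"
    then obtain k :: int where k: "x = y + of_int k" using pt_eq_iff by blast
    have "c = a + of_int k" "d = b + of_int k"
      using circle_interval_unique[OF circle_interval_shift[OF assms(1), of k] assms(2), of x] xy k by auto
    then show False using assms(3) primary_arc_shift by simp
  qed
  have "a < b" using assms(1) unfolding circle_interval_def by blast
  then have "pt x \<notin> primary_arc a b" if "c < x" "x < d" for x
    using *[OF that, of "a + (b - a) / 4"] *[OF that, of "b - (b - a) / 4"]
    unfolding primary_arc_def by (simp add: field_simps)
  then show ?thesis using assms(2) unfolding circle_interval_def by auto
qed

text \<open>
  Expansions of different intervals commute, and expanding the same interval by two representatives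
  adds the same arc.
\<close>

lemma expansion_confluent: "confluentp expansion_step"
proof (rule strong_confluentp_imp_confluentp, rule strong_confluentpI)
  fix D E1 E2 assume "expansion_step D E1" "expansion_step D E2"
  then obtain a b c d where ab: "circle_interval D a b" "E1 = insert (primary_arc a b) D"
    and cd: "circle_interval D c d" "E2 = insert (primary_arc c d) D" unfolding expansion_step_def by blast
  show "\<exists>u. expansion_step\<^sup>*\<^sup>* E1 u \<and> expansion_step\<^sup>=\<^sup>= E2 u"
  proof (cases "primary_arc a b = primary_arc c d")
    case True then show ?thesis using ab cd by auto
  next
    case False
    have "expansion_step E1 (insert (primary_arc c d) E1)"
      using circle_interval_after_expansion[OF ab(1) cd(1) False] ab(2) unfolding expansion_step_def by blast
    moreover have "expansion_step E2 (insert (primary_arc a b) E2)"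
      using circle_interval_after_expansion[OF cd(1) ab(1)] False cd(2) unfolding expansion_step_def by metis
    moreover have "insert (primary_arc c d) E1 = insert (primary_arc a b) E2" using ab cd by auto
    ultimately show ?thesis by auto
  qed
qed

lemma common_expansion:
  assumes "arc_diagram D" "arc_diagram D'"
  obtains E where "expansion_step\<^sup>*\<^sup>* D E" "expansion_step\<^sup>*\<^sup>* D' E"
  using expansion_confluent assms unfolding arc_diagram_iff_expansion by (meson confluentpD)

section \<open>Rearrangements by lifts\<close>

definition rearr :: "(real \<Rightarrow> real) \<Rightarrow> complex set set \<Rightarrow> bool" where
  "rearr F D \<longleftrightarrow> homeo_lift F \<and> arc_diagram D \<and> arc_diagram (push F D) \<and>
     (\<forall>a b. circle_interval D a b \<longrightarrow> affine_on F a b)"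

abbreviation rearrangements :: "(complex \<Rightarrow> complex) set" where
  "rearrangements \<equiv> {circ F | F. \<exists>D. rearr F D}"

lemma circ_primary_arc:
  assumes "homeo_lift F" "affine_on F a b" "a < b"
  shows "circ F ` primary_arc a b = primary_arc (F a) (F b)"
proof -
  have "a + (b - a) / 4 = a + (1/4) * (b - a)" "b - (b - a) / 4 = a + (3/4) * (b - a)"
       "F a + (F b - F a) / 4 = F a + (1/4) * (F b - F a)" "F b - (F b - F a) / 4 = F a + (3/4) * (F b - F a)"
    by (auto simp: field_simps)
  moreover have "F (a + (1/4) * (b - a)) = F a + (1/4) * (F b - F a)" "F (a + (3/4) * (b - a)) = F a + (3/4) * (F b - F a)"
    by (rule affine_on_param[OF assms(2)]; use assms(3) in simp)+
  ultimately show ?thesis unfolding primary_arc_def by (simp add: circ_pt[OF assms(1)])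
qed

text \<open>
  Affine maps preserve the ratio \<open>1:2:1\<close>, so \<open>F\<close> carries the primary arc of an interval of \<open>D\<close> to
  the primary arc of the image interval.
\<close>

lemma rearr_expansion_step:
  assumes "rearr F D" "expansion_step D E" shows "rearr F E"
proof -
  obtain a b where ab: "circle_interval D a b" "E = insert (primary_arc a b) D"
    using assms(2) unfolding expansion_step_def by blast
  have F: "homeo_lift F" "arc_diagram D" "arc_diagram (push F D)" "\<And>a b. circle_interval D a b \<Longrightarrow> affine_on F a b"
    using assms(1) unfolding rearr_def by auto
  have "circ F ` primary_arc a b = primary_arc (F a) (F b)"
    using circ_primary_arc F ab unfolding circle_interval_def by blast
  moreover have "circle_interval (push F D) (F a) (F b)"
    using circle_interval_push[OF F(1) arc_diagram_subset_S1[OF F(2)]] ab by blast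
  ultimately have "arc_diagram (push F E)" using F(3) ab(2) push_insert arc_diagram.expand by metis
  moreover have "affine_on F c d" if cd: "circle_interval E c d" for c d
  proof -
    obtain a b where "circle_interval D a b" "a \<le> c" "d \<le> b"
      using circle_interval_refine[OF arc_diagram_vertices_ok[OF F(2)] _ cd] ab(2) by auto
    then show ?thesis using F(4) affine_on_subset by blast
  qed
  moreover have "arc_diagram E" using F(2) ab arc_diagram.expand by blast
  ultimately show ?thesis using F(1) unfolding rearr_def by blast
qed

lemma rearr_expansion: "expansion_step\<^sup>*\<^sup>* D E \<Longrightarrow> rearr F D \<Longrightarrow> rearr F E"
  by (induction rule: rtranclp_induct) (auto intro: rearr_expansion_step)

lemma push_inv:
  assumes "homeo_lift F" "\<Union>D \<subseteq> S1"
  shows "push (the_inv F) (push F D) = D" "push F (push (the_inv F) D) = D"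
proof -
  have "the_inv F \<circ> F = (\<lambda>x. x)" "F \<circ> the_inv F = (\<lambda>x. x)"
    using homeo_lift_inv_f[OF assms(1)] homeo_lift_f_inv[OF assms(1)] by auto
  then show "push (the_inv F) (push F D) = D" "push F (push (the_inv F) D) = D"
    using push_comp[OF homeo_lift_inv[OF assms(1)] assms(1) assms(2)]
      push_comp[OF assms(1) homeo_lift_inv[OF assms(1)] assms(2)] push_id[OF assms(2)] by auto
qed

lemma circle_interval_pushE:
  assumes "homeo_lift F" "\<Union>D \<subseteq> S1" "circle_interval (push F D) c d"
  obtains a b where "c = F a" "d = F b" "circle_interval D a b"
proof -
  obtain a b where "c = F a" "d = F b" using homeo_lift_surj[OF assms(1)] by metis
  then show ?thesis using that assms circle_interval_push by blast
qed

lemma rearr_inv: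
  assumes "rearr F D" shows "rearr (the_inv F) (push F D)"
proof -
  have F: "homeo_lift F" "arc_diagram D" "arc_diagram (push F D)" "\<And>a b. circle_interval D a b \<Longrightarrow> affine_on F a b"
    using assms(1) unfolding rearr_def by auto
  note S = arc_diagram_subset_S1[OF F(2)]
  have "affine_on (the_inv F) c d" if cd: "circle_interval (push F D) c d" for c d
  proof -
    obtain a b where "c = F a" "d = F b" "circle_interval D a b" using circle_interval_pushE[OF F(1) S cd] .
    then show ?thesis using affine_on_inv[OF F(1) F(4)] unfolding circle_interval_def by blast
  qed
  then show ?thesis unfolding rearr_def using F homeo_lift_inv push_inv[OF F(1) S] by simp
qed

lemma rearr_comp_same:
  assumes "rearr F D" "rearr G (push F D)" shows "rearr (G \<circ> F) D"
proof -
  have F: "homeo_lift F" "arc_diagram D" "\<And>a b. circle_interval D a b \<Longrightarrow> affine_on F a b"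
    using assms(1) unfolding rearr_def by auto
  have G: "homeo_lift G" "arc_diagram (push G (push F D))" "\<And>a b. circle_interval (push F D) a b \<Longrightarrow> affine_on G a b"
    using assms(2) unfolding rearr_def by auto
  note S = arc_diagram_subset_S1[OF F(2)]
  show ?thesis unfolding rearr_def
    using homeo_lift_comp[OF G(1) F(1)] F(2) G(2) push_comp[OF G(1) F(1) S]
      affine_on_comp[OF F(3) G(3) homeo_lift_mono_on[OF F(1)]] circle_interval_push[OF F(1) S] by simp
qed

text \<open>
  Take a common expansion \<open>E\<close> of the target of \<open>F\<close> and the source of \<open>G\<close>; the composite is affine on
  the circle intervals of the diagram that \<open>F\<close> carries to \<open>E\<close>.
\<close>

lemma rearr_comp:
  assumes "rearr F D" "rearr G D'" obtains E where "rearr (G \<circ> F) E"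
proof -
  have F: "homeo_lift F" "arc_diagram D" "arc_diagram (push F D)" using assms(1) unfolding rearr_def by auto
  have "arc_diagram D'" using assms(2) unfolding rearr_def by auto
  then obtain E where E: "expansion_step\<^sup>*\<^sup>* (push F D) E" "expansion_step\<^sup>*\<^sup>* D' E"
    using common_expansion F(3) by blast
  have 1: "rearr (the_inv F) E" using rearr_expansion[OF E(1) rearr_inv[OF assms(1)]] .
  have 2: "rearr G E" using rearr_expansion[OF E(2) assms(2)] .
  have S: "\<Union>E \<subseteq> S1" using 2 arc_diagram_subset_S1 unfolding rearr_def by blast
  have FF: "the_inv (the_inv F) = F"
  proof
    fix x show "the_inv (the_inv F) x = F x"
      using homeo_lift_inv_f[OF homeo_lift_inv[OF F(1)], of "F x"] homeo_lift_inv_f[OF F(1)] by simp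
  qed
  have "rearr F (push (the_inv F) E)" using rearr_inv[OF 1] FF by simp
  then have "rearr (G \<circ> F) (push (the_inv F) E)" using rearr_comp_same push_inv(2)[OF F(1) S] 2 by metis
  then show ?thesis using that by blast
qed

lemma rearr_id: "rearr (\<lambda>x. x) base_diagram"
proof -
  have *: "arc_diagram base_diagram" by (rule arc_diagram.base)
  have "affine_on (\<lambda>x. x) a b" for a b unfolding affine_on_def by (intro exI[of _ 1] exI[of _ 0]) simp
  then show ?thesis unfolding rearr_def using * homeo_lift_id push_id[OF arc_diagram_subset_S1[OF *]] by simp
qed

lemma rearr_subgroup: "subgroup rearrangements (BijGroup S1)"
proof -
  interpret group "BijGroup S1" by (rule group_BijGroup)
  show ?thesis
  proof (rule subgroupI)
    show "rearrangements \<subseteq> carrier (BijGroup S1)"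
      unfolding rearr_def BijGroup_def using circ_Bij by auto
    show "rearrangements \<noteq> {}" using rearr_id by blast
    show "inv\<^bsub>BijGroup S1\<^esub> a \<in> rearrangements" if "a \<in> rearrangements" for a
      using that circ_inv rearr_inv unfolding rearr_def by blast
    show "a \<otimes>\<^bsub>BijGroup S1\<^esub> b \<in> rearrangements"
      if ab: "a \<in> rearrangements" "b \<in> rearrangements" for a b
    proof -
      obtain F G D D' where *: "a = circ F" "b = circ G" "rearr F D" "rearr G D'" using ab by blast
      then have "homeo_lift F" "homeo_lift G" unfolding rearr_def by auto
      then have "a \<otimes>\<^bsub>BijGroup S1\<^esub> b = circ (F \<circ> G)" using * circ_mult by simp
      moreover obtain E where "rearr (F \<circ> G) E" using rearr_comp[OF *(4,3)] by blast
      ultimately show ?thesis by blast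
    qed
  qed
qed

section \<open>Sides of a chord\<close>

text \<open>
  The cross product of \<open>b - a\<close> and \<open>x - a\<close>: zero on the line through \<open>a\<close> and \<open>b\<close>, positive to its
  left when it is directed from \<open>a\<close> to \<open>b\<close>.
\<close>

definition side :: "complex \<Rightarrow> complex \<Rightarrow> complex \<Rightarrow> real" where
  "side a b x = Im (cnj (b - a) * (x - a))"

lemma side_swap: "side b a x = - side a b x"
  unfolding side_def by (simp add: algebra_simps)

lemma side_affine: "side a b ((1 - t) *\<^sub>R x + t *\<^sub>R y) = (1 - t) * side a b x + t * side a b y"
  unfolding side_def by (simp add: algebra_simps)

lemma side_endpoint [simp]: "side a b a = 0" "side a b b = 0"
  unfolding side_def by (simp_all add: algebra_simps)

lemma continuous_on_side: "continuous_on S (side a b)"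
  unfolding side_def by (intro continuous_intros)

lemma cis_diff: "cis (2 * u) - cis (2 * v) = (2 * \<i> * complex_of_real (sin (u - v))) * cis (u + v)"
proof -
  have h: "(2 * u + 2 * v) / 2 = u + v" "(2 * u - 2 * v) / 2 = u - v" "(2 * v - 2 * u) / 2 = v - u" by simp_all
  have "cos (2 * u) - cos (2 * v) = 2 * sin (u+v) * sin (v-u)" "sin (2 * u) - sin (2 * v) = 2 * sin (u-v) * cos (u+v)"
    using cos_diff_cos[of "2 * u" "2 * v"] sin_diff_sin[of "2 * u" "2 * v"] unfolding h by auto
  moreover have "sin (v - u) = - sin (u - v)" by (metis minus_diff_eq sin_minus)
  ultimately show ?thesis by (simp add: complex_eq_iff mult_ac)
qed

text \<open>
  Differences of points of the circle are multiples of \<open>cis\<close> by half-angle sines, and the phases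
  cancel up to a third sine. The sign therefore depends on the cyclic order of the three points only.
\<close>

lemma side_pt:
  "side (pt p) (pt q) (pt x) = 4 * sin (pi * (q - p)) * sin (pi * (x - p)) * sin (pi * (x - q))"
proof -
  have pt2: "pt x = cis (2 * (pi * x))" for x by (simp add: pt_def mult.assoc)
  let ?s = "sin (pi * q - pi * p)" and ?t = "sin (pi * x - pi * p)"
  have "cnj (pt q - pt p) * (pt x - pt p) =
      complex_of_real (4 * ?s * ?t) * (cnj (cis (pi * q + pi * p)) * cis (pi * x + pi * p))"
    unfolding pt2 cis_diff by (simp add: mult_ac)
  also have "cnj (cis (pi * q + pi * p)) * cis (pi * x + pi * p) = cis (pi * x - pi * q)"
    unfolding cis_cnj cis_mult by simp
  finally show ?thesis unfolding side_def by (simp add: right_diff_distrib)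
qed

lemma sin_pi_pos: "0 < u \<Longrightarrow> u < 1 \<Longrightarrow> sin (pi * u) > 0"
  by (rule sin_gt_zero) auto

lemma sin_pi_neg: assumes "-1 < u" "u < 0" shows "sin (pi * u) < 0"
  using sin_pi_pos[of "-u"] assms by simp

lemma side_pt_pos:
  assumes "p < q" "q < x" "x < p + 1" shows "side (pt p) (pt q) (pt x) > 0"
  unfolding side_pt using sin_pi_pos[of "q-p"] sin_pi_pos[of "x-p"] sin_pi_pos[of "x-q"] assms by simp

lemma side_pt_neg:
  assumes "p < x" "x < q" "q < p + 1" shows "side (pt p) (pt q) (pt x) < 0"
  unfolding side_pt using sin_pi_pos[of "q-p"] sin_pi_pos[of "x-p"] sin_pi_neg[of "x-q"] assms
  by (simp add: mult_pos_neg)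

lemma two_points_S1:
  assumes "a \<in> S1" "b \<in> S1" "a \<noteq> b" obtains p q where "a = pt p" "b = pt q" "p < q" "q < p + 1"
proof -
  obtain p where p: "a = pt p" using S1_obtain_pt[OF assms(1)] by metis
  obtain q where q: "p \<le> q" "q < p + 1" "b = pt q" using S1_obtain_pt[OF assms(2)] by metis
  then have "p < q" using assms(3) p by (cases "p = q") auto
  then show ?thesis using that p q by blast
qed

lemma sgn_side_circ:
  assumes F: "homeo_lift F" and "a \<in> S1" "b \<in> S1" "a \<noteq> b" "z \<in> S1"
  shows "sgn (side (circ F a) (circ F b) (circ F z)) = sgn (side a b z)"
proof -
  obtain p q where pq: "a = pt p" "b = pt q" "p < q" "q < p + 1" using two_points_S1 assms by metis
  obtain x where x: "p \<le> x" "x < p + 1" "z = pt x" using S1_obtain_pt[OF assms(5)] by metis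
  have c: "circ F a = pt (F p)" "circ F b = pt (F q)" "circ F z = pt (F x)" using pq x circ_pt[OF F] by auto
  have l: "F p < F q" "F q < F p + 1" using pq homeo_lift_less[OF F] homeo_lift_add_one[OF F] by metis+
  consider "x = p" | "x = q" | "p < x" "x < q" | "q < x" using x by linarith
  then show ?thesis
  proof cases
    case 3
    then have "F p < F x" "F x < F q" using homeo_lift_less[OF F] by auto
    then show ?thesis using side_pt_neg[of p x q] side_pt_neg[of "F p" "F x" "F q"] 3 pq x c l by simp
  next
    case 4
    then have "F q < F x" "F x < F p + 1"
      using homeo_lift_less[OF F] homeo_lift_add_one[OF F] x by metis+
    then show ?thesis using side_pt_pos[of p q x] side_pt_pos[of "F p" "F q" "F x"] 4 pq x c l by simp
  qed (use pq x c in auto)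
qed

lemma side_S1_nonzero:
  assumes "a \<in> S1" "b \<in> S1" "a \<noteq> b" "z \<in> S1" "z \<noteq> a" "z \<noteq> b" shows "side a b z \<noteq> 0"
proof -
  obtain p q where pq: "a = pt p" "b = pt q" "p < q" "q < p + 1" using two_points_S1 assms by metis
  obtain x where x: "p \<le> x" "x < p + 1" "z = pt x" using S1_obtain_pt[OF assms(4)] by metis
  consider "x = p" | "x = q" | "p < x" "x < q" | "q < x" using x by linarith
  then show ?thesis
  proof cases
    case 3 then show ?thesis using side_pt_neg[of p x q] pq x by simp
  next
    case 4 then show ?thesis using side_pt_pos[of p q x] pq x by simp
  qed (use pq x assms in auto)
qed

lemma chord_side_zero:
  assumes "x \<in> convex hull {a, b}" shows "side a b x = 0"
proof -
  obtain t where "x = (1 - t) *\<^sub>R a + t *\<^sub>R b"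
    using assms unfolding segment_convex_hull[symmetric] by (auto simp: in_segment)
  then show ?thesis using side_affine[of a b t a b] by simp
qed

text \<open>
  The point \<open>a + t (b - a)\<close> of the line has squared norm \<open>1 - t (1 - t) |b - a|\<^sup>2\<close>, which exceeds \<open>1\<close>
  unless \<open>0 \<le> t \<le> 1\<close>.
\<close>

lemma side_zero_chord:
  assumes "a \<in> S1" "b \<in> S1" "a \<noteq> b" "x \<in> cball 0 1" "side a b x = 0" shows "x \<in> convex hull {a, b}"
proof -
  define d where "d = b - a"
  have d0: "d \<noteq> 0" using assms by (simp add: d_def)
  define r where "r = Re (cnj d * (x - a))"
  define t where "t = r / (cmod d)^2"
  have "cnj d * (x - a) = complex_of_real r"
    using assms(5) unfolding side_def d_def r_def by (simp add: complex_eq_iff)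
  also have "r = t * (cmod d)^2" using d0 by (simp add: t_def)
  also have "complex_of_real (t * (cmod d)^2) = cnj d * (t *\<^sub>R d)"
    using complex_norm_square[of d] by (simp add: scaleR_conv_of_real mult_ac)
  finally have "cnj d * (x - a) = cnj d * (t *\<^sub>R d)" .
  then have "x - a = t *\<^sub>R d" using d0 by (metis complex_cnj_zero_iff mult_left_cancel)
  then have xt: "x = (1 - t) *\<^sub>R a + t *\<^sub>R b" unfolding d_def by (simp add: algebra_simps)
  have "(norm x)^2 = 1 - t * (1 - t) * (norm d)^2"
  proof -
    have "(norm x)^2 = (1-t)^2 * (norm a)^2 + 2 * (t * (1-t)) * (a \<bullet> b) + t^2 * (norm b)^2"
      unfolding xt power2_norm_eq_inner inner_add_left inner_add_right inner_scaleR_left inner_scaleR_right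
        inner_commute[of b a] by (simp add: power2_eq_square algebra_simps)
    moreover have "(norm d)^2 = (norm a)^2 + (norm b)^2 - 2 * (a \<bullet> b)"
      unfolding d_def power2_norm_eq_inner inner_diff_left inner_diff_right inner_commute[of b a] by simp
    moreover have "norm a = 1" "norm b = 1" using assms by auto
    ultimately have nx: "(norm x)^2 = (1-t)^2 + 2 * (t * (1-t)) * (a \<bullet> b) + t^2"
      and nd: "(norm d)^2 = 2 - 2 * (a \<bullet> b)" by simp_all
    show ?thesis unfolding nx nd by (simp add: power2_eq_square algebra_simps)
  qed
  moreover have "(norm x)^2 \<le> 1" using assms(4) by (simp add: power_le_one)
  ultimately have "0 \<le> (t * (1 - t)) * (norm d)^2" by simp
  then have "0 \<le> t * (1 - t)" using d0 by (simp add: zero_le_mult_iff)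
  then have "0 \<le> t" "t \<le> 1" by (auto simp: zero_le_mult_iff)
  then show ?thesis using xt unfolding segment_convex_hull[symmetric] by (auto simp: in_segment)
qed

text \<open>
  Arcs are unordered pairs; exchanging \<open>a\<close> and \<open>b\<close> changes the sign of both factors.
\<close>

definition same_side :: "complex set \<Rightarrow> complex \<Rightarrow> complex \<Rightarrow> bool" where
  "same_side A y z \<longleftrightarrow> (\<exists>a b. A = {a, b} \<and> side a b y * side a b z > 0)"

definition weak_side :: "complex set \<Rightarrow> complex \<Rightarrow> complex \<Rightarrow> bool" where
  "weak_side A y z \<longleftrightarrow> (\<exists>a b. A = {a, b} \<and> side a b y * side a b z \<ge> 0)"

lemma same_side_pair: "same_side {a, b} y z \<longleftrightarrow> side a b y * side a b z > 0"
  unfolding same_side_def using side_swap[of a b] by (auto simp: doubleton_eq_iff)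

lemma weak_side_pair: "weak_side {a, b} y z \<longleftrightarrow> side a b y * side a b z \<ge> 0"
  unfolding weak_side_def using side_swap[of a b] by (auto simp: doubleton_eq_iff)

lemma same_side_sym: "same_side A y z \<Longrightarrow> same_side A z y"
  unfolding same_side_def by (auto simp: mult.commute)

lemma same_side_trans:
  assumes "same_side A x y" "same_side A y z" shows "same_side A x z"
proof -
  obtain a b where A: "A = {a, b}" using assms unfolding same_side_def by blast
  show ?thesis using assms unfolding A same_side_pair by (auto simp: zero_less_mult_iff)
qed

lemma same_side_circ:
  assumes F: "homeo_lift F" and "A = {a, b}" "a \<in> S1" "b \<in> S1" "a \<noteq> b" "z \<in> S1" "w \<in> S1"
  shows "same_side (circ F ` A) (circ F z) (circ F w) \<longleftrightarrow> same_side A z w"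
    and "weak_side (circ F ` A) (circ F z) (circ F w) \<longleftrightarrow> weak_side A z w"
proof -
  have *: "sgn (side (circ F a) (circ F b) (circ F z) * side (circ F a) (circ F b) (circ F w)) =
    sgn (side a b z * side a b w)"
    unfolding sgn_mult using sgn_side_circ[OF F assms(3-5)] assms by simp
  then show "same_side (circ F ` A) (circ F z) (circ F w) \<longleftrightarrow> same_side A z w"
    unfolding assms(2) image_insert image_empty same_side_pair by (metis sgn_greater)
  show "weak_side (circ F ` A) (circ F z) (circ F w) \<longleftrightarrow> weak_side A z w"
    using * unfolding assms(2) image_insert image_empty weak_side_pair by (metis sgn_less not_less)
qed

section \<open>Faces of arc diagrams\<close>

definition noncrossing :: "complex set set \<Rightarrow> bool" where
  "noncrossing D \<longleftrightarrow> (\<forall>A\<in>D. \<forall>B\<in>D. A \<noteq> B \<longrightarrow> (\<forall>u\<in>B. \<forall>v\<in>B. same_side A u v))"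

lemma noncrossing_pairI:
  assumes "\<And>u. u \<in> {c, d} \<Longrightarrow> side a b u > 0" "u \<in> {c, d}" "v \<in> {c, d}"
  shows "same_side {a, b} u v"
  unfolding same_side_pair using assms(1)[OF assms(2)] assms(1)[OF assms(3)] by simp

text \<open>
  The interval that receives a new arc contains no vertex, so both ends of the new arc are on the same
  side of each old arc. All old vertices are in the complement of that interval, so they are on the
  same side of the new arc.
\<close>

lemma arc_diagram_noncrossing: "arc_diagram D \<Longrightarrow> noncrossing D"
proof (induction rule: arc_diagram.induct)
  case base
  have "same_side {pt (1/3), pt (2/3)} u v" if "u \<in> {pt (1/6), pt (5/6)}" "v \<in> {pt (1/6), pt (5/6)}" for u v
  proof (rule noncrossing_pairI[OF _ that])
    fix u assume "u \<in> {pt (1/6), pt (5/6)}"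
    then show "side (pt (1/3)) (pt (2/3)) u > 0"
      using side_pt_pos[of "1/3" "2/3" "5/6"] side_pt_pos[of "1/3" "2/3" "1/6 + 1"] pt_add_one[of "1/6"] by auto
  qed
  moreover have "same_side {pt (5/6), pt (1/6)} u v" if "u \<in> {pt (1/3), pt (2/3)}" "v \<in> {pt (1/3), pt (2/3)}" for u v
  proof (rule noncrossing_pairI[OF _ that])
    fix u assume "u \<in> {pt (1/3), pt (2/3)}"
    then show "side (pt (5/6)) (pt (1/6)) u > 0"
      using side_pt_neg[of "1/6" "1/3" "5/6"] side_pt_neg[of "1/6" "2/3" "5/6"] side_swap[of "pt (5/6)" "pt (1/6)"] by auto
  qed
  moreover have "{pt (5/6), pt (1/6)} = {pt (1/6), pt (5/6)}" by blast
  ultimately show ?case unfolding noncrossing_def by auto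
next
  case (expand D a b)
  define n1 n2 where "n1 = a + (b - a)/4" and "n2 = b - (b - a)/4"
  have ab: "a < b" "b < a + 1"
    using expand circle_interval_length[OF arc_diagram_vertices_ok] by (auto simp: circle_interval_def)
  have n: "a < n1" "n1 < n2" "n2 < b" using ab by (auto simp: n1_def n2_def field_simps)
  have N: "primary_arc a b = {pt n1, pt n2}" by (simp add: primary_arc_def n1_def n2_def)
  have rep: "\<exists>x. b \<le> x \<and> x \<le> a + 1 \<and> v = pt x" if "v \<in> \<Union>D" for v
  proof -
    have "v \<in> S1" using that arc_diagram_subset_S1 expand by blast
    then obtain x where x: "a < x" "x \<le> a + 1" "v = pt x" using S1_obtain_pt' by metis
    then have "b \<le> x" using expand.hyps(2) that unfolding circle_interval_def by (metis not_le)
    then show ?thesis using x by blast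
  qed
  have new_old: "same_side (primary_arc a b) u v" if uv: "u \<in> B" "v \<in> B" "B \<in> D" for u v B
  proof -
    have "side (pt n1) (pt n2) w > 0" if wB: "w \<in> B" for w
    proof -
      obtain x where "b \<le> x" "x \<le> a + 1" "w = pt x" using rep[of w] uv(3) wB by blast
      then show ?thesis using side_pt_pos[of n1 n2 x] n by simp
    qed
    then show ?thesis unfolding N same_side_pair using uv by simp
  qed
  have old_new: "same_side B u v" if uv: "u \<in> primary_arc a b" "v \<in> primary_arc a b" "B \<in> D" for u v B
  proof -
    obtain p q where pq: "B = {pt p, pt q}" "p < q" "q < p + 1"
      using arc_diagram_arcs[OF expand.hyps(1) uv(3)] by metis
    obtain p' where p': "b \<le> p'" "p' \<le> a + 1" "pt p = pt p'" using rep[of "pt p"] uv(3) pq by blast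
    obtain q' where q': "b \<le> q'" "q' \<le> a + 1" "pt q = pt q'" using rep[of "pt q"] uv(3) pq by blast
    have "p' \<noteq> q'" using pt_eq_near[of p q] pq p' q' by auto
    then obtain r s where rs: "B = {pt r, pt s}" "r < s" "b \<le> r" "s \<le> a + 1"
      using p' q' pq by (metis insert_commute linorder_neqE_linordered_idom)
    have "side (pt r) (pt s) w > 0" if w: "w \<in> primary_arc a b" for w
    proof -
      obtain x where x: "a < x" "x < b" "w = pt x" using w n unfolding N
        by (metis insertE less_trans singletonD)
      then have "w = pt (x + 1)" by simp
      then show ?thesis using side_pt_pos[of r s "x + 1"] rs x by simp
    qed
    then show ?thesis unfolding rs(1) same_side_pair using uv by simp
  qed
  show ?case unfolding noncrossing_def
  proof (intro ballI impI)
    fix A B u v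
    assume *: "A \<in> insert (primary_arc a b) D" "B \<in> insert (primary_arc a b) D" "A \<noteq> B" "u \<in> B" "v \<in> B"
    consider "A = primary_arc a b" "B \<in> D" | "A \<in> D" "B = primary_arc a b" | "A \<in> D" "B \<in> D" using * by blast
    then show "same_side A u v"
    proof cases
      case 1 then show ?thesis using new_old[OF *(4,5)] by simp
    next
      case 2 then show ?thesis using old_new[of u v A] * by simp
    next
      case 3 then show ?thesis using expand.IH * unfolding noncrossing_def by simp
    qed
  qed
qed

lemma arc_diagram_arc_ends:
  assumes "arc_diagram D" "A \<in> D" obtains a b where "A = {a, b}" "a \<noteq> b" "a \<in> S1" "b \<in> S1"
proof -
  obtain p q where "A = {pt p, pt q}" "p < q" "q < p + 1" using arc_diagram_arcs[OF assms] by metis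
  then show ?thesis using that[of "pt p" "pt q"] pt_eq_near[of p q] by auto
qed

lemma same_side_refl:
  assumes "arc_diagram D" "A \<in> D" "z \<in> S1" "z \<notin> A" shows "same_side A z z"
proof -
  obtain a b where ab: "A = {a, b}" "a \<noteq> b" "a \<in> S1" "b \<in> S1" using arc_diagram_arc_ends assms by metis
  then have "side a b z \<noteq> 0" using side_S1_nonzero[OF ab(3,4,2) assms(3)] assms(4) by blast
  then show ?thesis unfolding ab(1) same_side_pair by (simp add: zero_less_mult_iff; linarith)
qed

definition arc_complement :: "complex set set \<Rightarrow> complex set" where
  "arc_complement D = ball 0 1 - \<Union>(arc_edges D)"

lemma arc_complement_iff:
  assumes "arc_diagram D"
  shows "y \<in> arc_complement D \<longleftrightarrow> y \<in> ball 0 1 \<and> (\<forall>A\<in>D. same_side A y y)"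
proof -
  have "y \<in> convex hull A \<longleftrightarrow> \<not> same_side A y y" if "A \<in> D" "y \<in> ball 0 1" for A
  proof -
    obtain a b where ab: "A = {a, b}" "a \<noteq> b" "a \<in> S1" "b \<in> S1" using arc_diagram_arc_ends assms \<open>A \<in> D\<close> by metis
    have "y \<in> cball 0 1" using that(2) by simp
    then have "y \<in> convex hull A \<longleftrightarrow> side a b y = 0"
      unfolding ab(1) using chord_side_zero side_zero_chord ab by blast
    then show ?thesis unfolding ab(1) same_side_pair using not_real_square_gt_zero by simp
  qed
  then show ?thesis unfolding arc_complement_def arc_edges_def by blast
qed

lemma convex_side_pos: "convex {x. side a b x * c > 0}"
proof -
  have "(u * side a b x + v * side a b y) * c > 0" if "side a b x * c > 0" "side a b y * c > 0" "0 \<le> u" "0 \<le> v" "u + v = 1" for x y u v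
  proof -
    have "u * (side a b x * c) + v * (side a b y * c) > 0"
      using that by (metis add_nonneg_pos add_pos_nonneg less_eq_real_def mult_nonneg_nonneg mult_pos_pos zero_less_one add.right_neutral)
    then show ?thesis by (simp add: algebra_simps)
  qed
  moreover have "side a b (u *\<^sub>R x + v *\<^sub>R y) = u * side a b x + v * side a b y" if "u + v = 1" for u v x y
  proof -
    have "u = 1 - v" using that by simp
    then show ?thesis using side_affine[of a b v x y] by simp
  qed
  ultimately show ?thesis unfolding convex_def by simp
qed

lemma convex_same_side: "convex {x. same_side A x z}"
proof (cases "\<exists>a b. A = {a, b}")
  case True
  then obtain a b where "A = {a, b}" by blast
  then show ?thesis using convex_side_pos[of a b "side a b z"] by (simp add: same_side_pair)
next
  case False
  then have "{x. same_side A x z} = {}" unfolding same_side_def by blast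
  then show ?thesis by simp
qed

lemma same_side_Collect_Int:
  "{x \<in> S. \<forall>A\<in>D. same_side A x z} = S \<inter> (\<Inter>A\<in>D. {x. same_side A x z})"
  by blast

lemma convex_same_sides: "convex S \<Longrightarrow> convex {x \<in> S. \<forall>A\<in>D. same_side A x z}"
  unfolding same_side_Collect_Int by (intro convex_Int convex_INT convex_same_side)

lemma same_side_connected:
  assumes "connected T" "x \<in> T" "y \<in> T" "\<And>w. w \<in> T \<Longrightarrow> side a b w \<noteq> 0"
  shows "same_side {a, b} x y"
proof -
  have conn: "connected (side a b ` T)" by (intro connected_continuous_image continuous_on_side assms(1))
  have xy: "side a b x \<in> side a b ` T" "side a b y \<in> side a b ` T" "0 \<notin> side a b ` T" using assms by auto
  have "\<not> (side a b x < 0 \<and> 0 < side a b y)" "\<not> (side a b y < 0 \<and> 0 < side a b x)"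
    using connectedD_interval[OF conn xy(1,2), of 0] connectedD_interval[OF conn xy(2,1), of 0] xy(3)
    by (auto simp: less_imp_le)
  then show ?thesis unfolding same_side_pair using assms(4)[OF assms(2)] assms(4)[OF assms(3)]
    by (simp add: zero_less_mult_iff; linarith)
qed

text \<open>
  The points with prescribed sides form a convex set, and a connected set that avoids the arcs cannot
  change sides.
\<close>

lemma connected_component_arc_complement:
  assumes "arc_diagram D" "y \<in> arc_complement D"
  shows "connected_component_set (arc_complement D) y = {x \<in> ball 0 1. \<forall>A\<in>D. same_side A x y}"
proof
  show "{x \<in> ball 0 1. \<forall>A\<in>D. same_side A x y} \<subseteq> connected_component_set (arc_complement D) y"
  proof (rule connected_component_maximal)
    show "y \<in> {x \<in> ball 0 1. \<forall>A\<in>D. same_side A x y}" using assms arc_complement_iff by auto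
    show "connected {x \<in> ball 0 1. \<forall>A\<in>D. same_side A x y}" by (intro convex_connected convex_same_sides convex_ball)
    show "{x \<in> ball 0 1. \<forall>A\<in>D. same_side A x y} \<subseteq> arc_complement D"
      unfolding arc_complement_iff[OF assms(1)] subset_iff using same_side_trans same_side_sym by blast
  qed
  show "connected_component_set (arc_complement D) y \<subseteq> {x \<in> ball 0 1. \<forall>A\<in>D. same_side A x y}"
  proof
    fix x assume "x \<in> connected_component_set (arc_complement D) y"
    then obtain T where T: "connected T" "T \<subseteq> arc_complement D" "x \<in> T" "y \<in> T"
      by (auto simp: connected_component_def)
    have "same_side A x y" if "A \<in> D" for A
    proof -
      obtain a b where ab: "A = {a, b}" using arc_diagram_arc_ends assms(1) \<open>A \<in> D\<close> by metis
      have "side a b w \<noteq> 0" if "w \<in> T" for w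
        using T(2) that \<open>A \<in> D\<close> arc_complement_iff[OF assms(1)] unfolding ab by (force simp: same_side_pair)
      then show ?thesis unfolding ab using same_side_connected[OF T(1,3,4)] by blast
    qed
    moreover have "x \<in> ball 0 1" using T unfolding arc_complement_def by blast
    ultimately show "x \<in> {x \<in> ball 0 1. \<forall>A\<in>D. same_side A x y}" by blast
  qed
qed

lemma same_side_circle_path:
  assumes "arc_diagram D" "B \<in> D" "x \<le> x'" "\<And>y. x \<le> y \<Longrightarrow> y \<le> x' \<Longrightarrow> pt y \<notin> B"
  shows "same_side B (pt x) (pt x')"
proof -
  obtain a b where ab: "B = {a, b}" "a \<noteq> b" "a \<in> S1" "b \<in> S1" using arc_diagram_arc_ends assms by metis
  have "side a b w \<noteq> 0" if "w \<in> pt ` {x..x'}" for w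
    using that assms(4) side_S1_nonzero[OF ab(3,4,2), of w] ab(1) by auto
  moreover have "connected (pt ` {x..x'})" by (intro connected_continuous_image continuous_on_pt) simp
  ultimately show ?thesis unfolding ab(1) using same_side_connected assms(3) by (metis atLeastAtMost_iff imageI order_refl)
qed

text \<open>
  Next to its end \<open>a\<close> the arc \<open>A\<close> has circle points on either side. No other arc ends at \<open>a\<close>, so the
  points between \<open>a\<close> and the next vertex are on the same side of the other arcs as \<open>a\<close> itself.
\<close>

lemma near_arc_end:
  assumes D: "arc_diagram D" and A: "A \<in> D" "A = {a, b}" and s: "side a b y \<noteq> 0"
  obtains z where "z \<in> S1" "z \<notin> \<Union>D" "same_side A y z" "\<And>B. B \<in> D \<Longrightarrow> B \<noteq> A \<Longrightarrow> same_side B a z"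
proof -
  have "a \<in> S1" "b \<in> S1" "a \<noteq> b" using arc_diagram_arc_ends[OF D A(1)] A(2) by (metis doubleton_eq_iff)+
  then obtain p q where pq: "a = pt p" "b = pt q" "p < q" "q < p + 1" using two_points_S1 by metis
  have ok: "vertices_ok D" using arc_diagram_vertices_ok[OF D] .
  have v: "pt p \<in> \<Union>D" "pt q \<in> \<Union>D" "pt (q - 1) \<in> \<Union>D" using A pq pt_add_one[of "q - 1"] by auto
  have aB: "a \<notin> B" if BD: "B \<in> D" "B \<noteq> A" for B
  proof
    assume "a \<in> B"
    then have "same_side A a a" using arc_diagram_noncrossing[OF D] BD A(1) unfolding noncrossing_def by simp
    then show False unfolding A(2) same_side_pair by simp
  qed
  show ?thesis
  proof (cases "side a b y < 0")
    case True
    obtain c r where cr: "circle_interval D c r" "c \<le> p" "p < r" using circle_interval_right[OF ok] by blast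
    have rq: "r \<le> q" using cr v pq(3) unfolding circle_interval_def by (metis dual_order.strict_trans1 less_le not_le)
    define z where "z = (p + r) / 2"
    have z: "p < z" "z < r" using cr by (auto simp: z_def)
    have nv: "pt x \<notin> \<Union>D" if "p < x" "x < r" for x using cr that unfolding circle_interval_def by auto
    show ?thesis
    proof (rule that[of "pt z"])
      show "pt z \<notin> \<Union>D" using nv z by blast
      show "same_side A y (pt z)" unfolding A(2) same_side_pair
        using side_pt_neg[of p z q] True z rq pq by (simp add: mult_neg_neg)
      show "same_side B a (pt z)" if "B \<in> D" "B \<noteq> A" for B
        unfolding pq(1)
      proof (rule same_side_circle_path[OF D that(1)])
        show "pt x \<notin> B" if "p \<le> x" "x \<le> z" for x
          using nv[of x] aB[OF \<open>B \<in> D\<close> \<open>B \<noteq> A\<close>] that z pq(1) \<open>B \<in> D\<close> by (cases "x = p") auto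
      qed (use z in simp)
    qed simp
  next
    case False
    obtain l c where lc: "circle_interval D l c" "l < p" "p \<le> c" using circle_interval_left[OF ok] by blast
    have lq: "q - 1 \<le> l" using lc v pq(4) unfolding circle_interval_def
      by (smt (verit))
    define z where "z = (l + p) / 2"
    have z: "l < z" "z < p" using lc by (auto simp: z_def)
    have nv: "pt x \<notin> \<Union>D" if "l < x" "x < p" for x using lc that unfolding circle_interval_def by auto
    show ?thesis
    proof (rule that[of "pt z"])
      show "pt z \<notin> \<Union>D" using nv z by blast
      have "side a b (pt (z + 1)) > 0" unfolding pq(1,2) using side_pt_pos[of p q "z + 1"] z lq pq by simp
      then show "same_side A y (pt z)" unfolding A(2) same_side_pair using s False by simp
      show "same_side B a (pt z)" if "B \<in> D" "B \<noteq> A" for B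
        unfolding pq(1)
      proof (rule same_side_sym, rule same_side_circle_path[OF D that(1)])
        show "pt x \<notin> B" if "z \<le> x" "x \<le> p" for x
          using nv[of x] aB[OF \<open>B \<in> D\<close> \<open>B \<noteq> A\<close>] that z pq(1) \<open>B \<in> D\<close> by (cases "x = p") auto
      qed (use z in simp)
    qed simp
  qed
qed

lemma same_side_along_chord:
  assumes "arc_diagram D" "A \<in> D" "B \<in> D" "A \<noteq> B" "p \<in> convex hull A" "v \<in> A"
  shows "same_side B p v"
proof -
  have "A \<subseteq> {x. same_side B x v}"
    using arc_diagram_noncrossing[OF assms(1)] assms unfolding noncrossing_def by blast
  then have "convex hull A \<subseteq> {x. same_side B x v}" by (rule hull_minimal) (rule convex_same_side)
  then show ?thesis using assms(5) by blast
qed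

text \<open>
  Walk from \<open>y\<close> straight to a vertex until an arc \<open>A\<close> is reached for the first time. There the sides
  with respect to the other arcs are still those of \<open>y\<close>, and they are constant along \<open>A\<close>; so a circle
  point next to an end of \<open>A\<close>, on the side of \<open>y\<close>, has the sides of \<open>y\<close> for all arcs.
\<close>

lemma arc_complement_sees_circle:
  assumes D: "arc_diagram D" and y: "y \<in> arc_complement D"
  obtains z where "z \<in> S1" "z \<notin> \<Union>D" "\<And>A. A \<in> D \<Longrightarrow> same_side A y z"
proof -
  define v where "v = pt (1/3)"
  obtain A0 where A0: "A0 \<in> D" "v \<in> A0" using base_diagram_subset[OF D] by (auto simp: v_def)
  define x where "x t = (1 - t) *\<^sub>R y + t *\<^sub>R v" for t :: real
  have contx: "continuous_on S x" for S unfolding x_def[abs_def] by (intro continuous_intros)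
  have yb: "y \<in> ball 0 1" "\<And>A. A \<in> D \<Longrightarrow> same_side A y y" using y arc_complement_iff[OF D] by auto
  define Q where "Q = {t \<in> {0..1}. \<exists>B\<in>D. \<not> same_side B y (x t)}"
  have "compact Q"
  proof -
    have "closed {t \<in> {0..1}. \<not> same_side B y (x t)}" if BD: "B \<in> D" for B
    proof -
      obtain a b where B: "B = {a, b}" using arc_diagram_arc_ends[OF D BD] by metis
      have "closed {t \<in> {0..1}. side a b y * side a b (x t) \<le> 0}"
      proof (rule continuous_on_closed_Collect_le)
        have "continuous_on {0..1} (side a b \<circ> x)" by (intro continuous_on_compose contx continuous_on_side)
        then show "continuous_on {0..1} (\<lambda>t. side a b y * side a b (x t))" by (intro continuous_intros) (simp add: o_def)
      qed (auto intro: continuous_intros)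
      then show ?thesis unfolding B same_side_pair not_less .
    qed
    moreover have "Q = (\<Union>B\<in>D. {t \<in> {0..1}. \<not> same_side B y (x t)})" unfolding Q_def by blast
    ultimately have "closed Q" using arc_diagram_finite[OF D] by (auto intro: closed_UN)
    moreover have "bounded Q" by (rule bounded_subset[of "{0..1}"]) (auto simp: Q_def)
    ultimately show ?thesis using compact_eq_bounded_closed by blast
  qed
  have "\<not> same_side A0 y (x 1)"
  proof -
    obtain a b where "A0 = {a, b}" using arc_diagram_arc_ends[OF D A0(1)] by metis
    then show ?thesis using A0(2) by (auto simp: x_def same_side_pair)
  qed
  then have "1 \<in> Q" using A0(1) unfolding Q_def by auto
  then obtain t0 where t0: "t0 \<in> Q" "\<And>t. t \<in> Q \<Longrightarrow> t0 \<le> t"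
    using compact_attains_inf[OF \<open>compact Q\<close>] by blast
  then obtain A where A: "A \<in> D" "\<not> same_side A y (x t0)" "0 \<le> t0" "t0 \<le> 1" unfolding Q_def by auto
  have "t0 \<noteq> 0" using A yb(2)[OF A(1)] by (auto simp: x_def)
  then have "0 < t0" using A by simp
  have before: "same_side B y (x t)" if "B \<in> D" "0 \<le> t" "t < t0" for B t
    using t0(2)[of t] that A unfolding Q_def by fastforce
  have weak: "weak_side B y (x t0)" if BD: "B \<in> D" for B
  proof -
    obtain a b where B: "B = {a, b}" using arc_diagram_arc_ends[OF D BD] by metis
    define g where "g t = side a b y * side a b (x t)" for t
    have g: "g t = (1 - t) * g 0 + t * g 1" for t unfolding g_def x_def side_affine by (simp add: algebra_simps)
    have pos: "g 0 > 0" "\<And>t. 0 \<le> t \<Longrightarrow> t < t0 \<Longrightarrow> g t > 0"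
      using before[OF BD] \<open>0 < t0\<close> unfolding B same_side_pair g_def by auto
    have "g t0 \<ge> 0"
    proof (rule ccontr)
      assume n: "\<not> g t0 \<ge> 0"
      \<comment> \<open>The zero of the affine function \<open>g\<close> between \<open>0\<close> and \<open>t0\<close>.\<close>
      define t where "t = t0 * (g 0 / (g 0 - g t0))"
      have d: "g 0 - g t0 > 0" using n pos by auto
      have "g 0 / (g 0 - g t0) < 1" "0 \<le> g 0 / (g 0 - g t0)" using d n pos by (auto simp: field_simps)
      then have "0 \<le> t" "t < t0"
        using mult_strict_left_mono[of "g 0 / (g 0 - g t0)" 1 t0] mult_nonneg_nonneg[of t0 "g 0 / (g 0 - g t0)"] \<open>0 < t0\<close>
        unfolding t_def by linarith+
      moreover have "g t = 0"
      proof -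
        have "g t = g 0 + (g 0 / (g 0 - g t0)) * (t0 * (g 1 - g 0))" using g[of t] unfolding t_def by (simp add: algebra_simps)
        also have "t0 * (g 1 - g 0) = - (g 0 - g t0)" using g[of t0] by (simp add: algebra_simps)
        also have "g 0 / (g 0 - g t0) * - (g 0 - g t0) = - g 0" using d by (simp add: field_simps)
        finally show ?thesis by simp
      qed
      ultimately show False using pos(2) by fastforce
    qed
    then show ?thesis unfolding B weak_side_pair g_def .
  qed
  obtain a b where ab: "A = {a, b}" "a \<noteq> b" "a \<in> S1" "b \<in> S1" using arc_diagram_arc_ends[OF D A(1)] by metis
  have ynz: "side a b y \<noteq> 0" using yb(2)[OF A(1)] unfolding ab(1) same_side_pair by auto
  have "side a b (x t0) = 0"
    using weak[OF A(1)] A(2) ynz unfolding ab(1) same_side_pair weak_side_pair by (metis less_eq_real_def mult_eq_0_iff)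
  moreover have "x t0 \<in> cball 0 1"
  proof -
    have "v \<in> cball 0 1" "y \<in> cball 0 1" using yb by (auto simp: v_def)
    then show ?thesis unfolding x_def using A convex_cball[of 0 1] by (intro convexD) auto
  qed
  ultimately have hull: "x t0 \<in> convex hull A" using side_zero_chord ab by blast
  obtain z where z: "z \<in> S1" "z \<notin> \<Union>D" "same_side A y z" "\<And>B. B \<in> D \<Longrightarrow> B \<noteq> A \<Longrightarrow> same_side B a z"
    using near_arc_end[OF D A(1) ab(1) ynz] by blast
  have "same_side B y z" if BD: "B \<in> D" for B
  proof (cases "B = A")
    case False
    obtain c d where B: "B = {c, d}" using arc_diagram_arc_ends[OF D BD] by metis
    have 1: "same_side B (x t0) a" using same_side_along_chord[OF D A(1) BD _ hull] False ab(1) by blast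
    then have "side c d (x t0) \<noteq> 0" unfolding B same_side_pair by auto
    moreover have "side c d y \<noteq> 0" using yb(2)[OF BD] unfolding B same_side_pair by auto
    ultimately have "same_side B y (x t0)" using weak[OF BD] unfolding B weak_side_pair same_side_pair
      by (metis less_eq_real_def mult_eq_0_iff)
    then show ?thesis using 1 z(4)[OF BD False] same_side_trans by blast
  qed (use z in simp)
  then show ?thesis using that z by blast
qed

definition face :: "complex set set \<Rightarrow> complex \<Rightarrow> complex set" where
  "face D z = {y \<in> ball 0 1. \<forall>A\<in>D. same_side A y z}"

text \<open>
  The midpoint of \<open>z\<close> and a second point of the same circle interval is in the open disk.
\<close>

lemma face_nonempty:
  assumes D: "arc_diagram D" and z: "z \<in> S1" "z \<notin> \<Union>D" obtains y where "y \<in> face D z"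
proof -
  obtain x where x: "z = pt x" using S1_obtain_pt[OF z(1)] by metis
  obtain a b where ab: "circle_interval D a b" "a \<le> x" "x < b"
    using circle_interval_right[OF arc_diagram_vertices_ok[OF D]] by blast
  then have "a \<noteq> x" using z x unfolding circle_interval_def by auto
  define x' where "x' = (x + b) / 2"
  have x': "x < x'" "x' < b" using ab by (auto simp: x'_def)
  have len: "b < a + 1" using circle_interval_length[OF arc_diagram_vertices_ok[OF D] ab(1)] .
  define w where "w = pt x'"
  have "w \<noteq> z" unfolding w_def x using pt_eq_near[of x' x] x' len ab by auto
  have zw: "same_side A w z" if AD: "A \<in> D" for A
    unfolding x w_def
  proof (rule same_side_sym, rule same_side_circle_path[OF D AD])
    show "pt y \<notin> A" if "x \<le> y" "y \<le> x'" for y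
    proof -
      have "a < y" "y < b" using that ab x' \<open>a \<noteq> x\<close> by auto
      then have "pt y \<notin> \<Union>D" using ab(1) unfolding circle_interval_def by simp
      then show ?thesis using AD by blast
    qed
  qed (use x' in simp)
  define y where "y = (1/2) *\<^sub>R w + (1/2) *\<^sub>R z"
  have "(norm (w + z))^2 + (norm (w - z))^2 = 2 * (norm w)^2 + 2 * (norm z)^2"
    by (simp add: power2_norm_eq_inner inner_add_left inner_add_right inner_diff_left inner_diff_right)
  moreover have "norm w = 1" "norm z = 1" unfolding w_def x by simp_all
  moreover have "(norm (w - z))^2 > 0" using \<open>w \<noteq> z\<close> by simp
  ultimately have "(norm (w + z))^2 < 4" by (simp only: one_power2)
  then have "norm (w + z) < 2" using power_less_imp_less_base[of "norm (w + z)" 2 2] by simp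
  moreover have "y = (1/2) *\<^sub>R (w + z)" unfolding y_def by (simp add: scaleR_add_right)
  ultimately have "y \<in> ball 0 1" by simp
  moreover have "same_side A y z" if AD: "A \<in> D" for A
  proof -
    have "z \<in> {x. same_side A x z}" "w \<in> {x. same_side A x z}"
      using zw[OF AD] same_side_refl[OF D AD z(1)] z(2) AD by auto
    then have "y \<in> {x. same_side A x z}" unfolding y_def using convex_same_side[of A z] by (intro convexD) auto
    then show ?thesis by simp
  qed
  ultimately show ?thesis using that unfolding face_def by blast
qed

lemma faces_eq:
  assumes D: "arc_diagram D" shows "faces D = face D ` {z \<in> S1. z \<notin> \<Union>D}"
proof -
  have ff: "face D z = {x \<in> ball 0 1. \<forall>A\<in>D. same_side A x y}"
    if "\<And>A. A \<in> D \<Longrightarrow> same_side A y z" for y z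
  proof -
    have "same_side A x z \<longleftrightarrow> same_side A x y" if "A \<in> D" for A x
      using \<open>\<And>A. A \<in> D \<Longrightarrow> same_side A y z\<close>[OF \<open>A \<in> D\<close>] same_side_trans same_side_sym by blast
    then show ?thesis unfolding face_def by auto
  qed
  have f: "faces D = connected_component_set (arc_complement D) ` arc_complement D"
    unfolding faces_def arc_complement_def components_def by blast
  show ?thesis unfolding f
  proof (intro equalityI subsetI)
    fix c assume "c \<in> connected_component_set (arc_complement D) ` arc_complement D"
    then obtain y where y: "y \<in> arc_complement D" "c = {x \<in> ball 0 1. \<forall>A\<in>D. same_side A x y}"
      using connected_component_arc_complement[OF D] by auto
    obtain z where z: "z \<in> S1" "z \<notin> \<Union>D" "\<And>A. A \<in> D \<Longrightarrow> same_side A y z"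
      using arc_complement_sees_circle[OF D y(1)] by blast
    then show "c \<in> face D ` {z \<in> S1. z \<notin> \<Union>D}" using ff[OF z(3)] y(2) by blast
  next
    fix c assume "c \<in> face D ` {z \<in> S1. z \<notin> \<Union>D}"
    then obtain z where z: "z \<in> S1" "z \<notin> \<Union>D" "c = face D z" by blast
    obtain y where y: "y \<in> face D z" using face_nonempty[OF D z(1,2)] by blast
    then have ss: "\<And>A. A \<in> D \<Longrightarrow> same_side A y z" and "y \<in> ball 0 1" unfolding face_def by auto
    then have "y \<in> arc_complement D" using arc_complement_iff[OF D] same_side_trans same_side_sym by blast
    moreover have "c = connected_component_set (arc_complement D) y"
      unfolding connected_component_arc_complement[OF D \<open>y \<in> arc_complement D\<close>] z(3) using ff[OF ss] .
    ultimately show "c \<in> connected_component_set (arc_complement D) ` arc_complement D" by blast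
  qed
qed

lemma face_eq_iff:
  assumes D: "arc_diagram D" and z: "z \<in> S1" "z \<notin> \<Union>D"
  shows "face D z = face D w \<longleftrightarrow> (\<forall>A\<in>D. same_side A z w)"
proof
  assume *: "face D z = face D w"
  obtain y where "y \<in> face D z" using face_nonempty[OF D z] by blast
  then have "\<forall>A\<in>D. same_side A y z" "\<forall>A\<in>D. same_side A y w" using * unfolding face_def by auto
  then show "\<forall>A\<in>D. same_side A z w" using same_side_sym same_side_trans by blast
next
  assume *: "\<forall>A\<in>D. same_side A z w"
  have "same_side A x z \<longleftrightarrow> same_side A x w" if "A \<in> D" for A x
    using * that same_side_trans same_side_sym by blast
  then show "face D z = face D w" unfolding face_def by auto
qed

lemma same_side_imp_weak_side: "same_side A y z \<Longrightarrow> weak_side A y z"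
  unfolding same_side_def weak_side_def using less_imp_le by blast

text \<open>
  The segment from a point of the face to a point that satisfies the weak conditions stays in the face
  except possibly at its end.
\<close>

lemma closure_face:
  assumes D: "arc_diagram D" and z: "z \<in> S1" "z \<notin> \<Union>D"
  shows "closure (face D z) = {w \<in> cball 0 1. \<forall>A\<in>D. weak_side A w z}"
proof
  have "closed {w. weak_side A w z}" if AD: "A \<in> D" for A
  proof -
    obtain a b where A: "A = {a, b}" using arc_diagram_arc_ends[OF D AD] by metis
    have "closed {w. 0 \<le> side a b w * side a b z}"
      by (intro closed_Collect_le continuous_intros continuous_on_side)
    then show ?thesis unfolding A weak_side_pair .
  qed
  then have "closed (cball 0 1 \<inter> (\<Inter>A\<in>D. {w. weak_side A w z}))" by (intro closed_Int closed_INT closed_cball) auto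
  moreover have "cball 0 1 \<inter> (\<Inter>A\<in>D. {w. weak_side A w z}) = {w \<in> cball 0 1. \<forall>A\<in>D. weak_side A w z}" by blast
  ultimately have "closed {w \<in> cball 0 1. \<forall>A\<in>D. weak_side A w z}" by simp
  moreover have "face D z \<subseteq> {w \<in> cball 0 1. \<forall>A\<in>D. weak_side A w z}"
    unfolding face_def using same_side_imp_weak_side by auto
  ultimately show "closure (face D z) \<subseteq> {w \<in> cball 0 1. \<forall>A\<in>D. weak_side A w z}" by (rule closure_minimal[rotated])
  show "{w \<in> cball 0 1. \<forall>A\<in>D. weak_side A w z} \<subseteq> closure (face D z)"
  proof
    fix w assume w: "w \<in> {w \<in> cball 0 1. \<forall>A\<in>D. weak_side A w z}"
    obtain y where y: "y \<in> face D z" using face_nonempty[OF D z] by blast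
    define g where "g t = (1 - t) *\<^sub>R w + t *\<^sub>R y" for t :: real
    have "g ` {0<..1} \<subseteq> face D z"
    proof clarify
      fix t :: real assume t: "t \<in> {0<..1}"
      have "norm (g t) \<le> norm ((1 - t) *\<^sub>R w) + norm (t *\<^sub>R y)" unfolding g_def by (rule norm_triangle_ineq)
      also have "\<dots> = (1 - t) * norm w + t * norm y" using t by simp
      also have "\<dots> < (1 - t) * 1 + t * 1"
        using w y t by (intro add_le_less_mono mult_left_mono mult_strict_left_mono) (auto simp: face_def)
      finally have "g t \<in> ball 0 1" by simp
      moreover have "same_side A (g t) z" if AD: "A \<in> D" for A
      proof -
        obtain a b where A: "A = {a, b}" using arc_diagram_arc_ends[OF D AD] by metis
        have "side a b w * side a b z \<ge> 0" and pos: "side a b y * side a b z > 0"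
          using w y AD unfolding face_def A by (auto simp: weak_side_pair same_side_pair)
        then have "(1 - t) * (side a b w * side a b z) + t * (side a b y * side a b z) > 0"
          using t mult_nonneg_nonneg[of "1 - t" "side a b w * side a b z"] mult_pos_pos[OF _ pos, of t]
          by (intro add_nonneg_pos) auto
        then show ?thesis unfolding A same_side_pair g_def side_affine by (simp add: algebra_simps)
      qed
      ultimately show "g t \<in> face D z" unfolding face_def by blast
    qed
    moreover have "continuous_on (closure {0<..1}) g" unfolding g_def[abs_def] by (intro continuous_intros)
    ultimately have "g ` closure {0<..1} \<subseteq> closure (face D z)"
      using closure_subset by (intro image_closure_subset) auto
    then have "g 0 \<in> closure (face D z)" by (auto simp: closure_greaterThanAtMost)
    then show "w \<in> closure (face D z)" by (simp add: g_def)
  qed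
qed

section \<open>Rearrangements induce isomorphisms of 2-complexes\<close>

lemma arc_hull_Int_S1:
  assumes "arc_diagram D" "A \<in> D" shows "convex hull A \<inter> S1 = A"
proof -
  obtain a b where ab: "A = {a, b}" "a \<noteq> b" "a \<in> S1" "b \<in> S1" using arc_diagram_arc_ends[OF assms] by metis
  have "z \<in> A" if "z \<in> convex hull A" "z \<in> S1" for z
    using chord_side_zero[of z a b] side_S1_nonzero[OF ab(3,4,2) that(2)] that(1) ab(1) by blast
  moreover have "A \<subseteq> S1" using ab by blast
  ultimately show ?thesis using hull_subset[of A convex] by blast
qed

lemma arc_hull_not_subset_S1:
  assumes "arc_diagram D" "A \<in> D" shows "\<not> convex hull A \<subseteq> S1"
proof
  assume *: "convex hull A \<subseteq> S1"
  obtain a b where ab: "A = {a, b}" "a \<noteq> b" "a \<in> S1" "b \<in> S1" using arc_diagram_arc_ends[OF assms] by metis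
  have "midpoint a b \<in> convex hull A" unfolding ab(1) segment_convex_hull[symmetric] by simp
  then have "midpoint a b \<in> A" using * arc_hull_Int_S1[OF assms] by blast
  then show False using ab by (auto simp: midpoint_eq_iff)
qed

lemma closed_arc_hull:
  assumes "arc_diagram D" "A \<in> D" shows "closure (convex hull A) = convex hull A"
proof -
  have "finite A" using arc_diagram_arc_ends[OF assms] by (metis finite.emptyI finite.insertI)
  then show ?thesis by (intro closure_closed compact_imp_closed finite_imp_compact_convex_hull)
qed

lemma face_Int_S1: "face D z \<inter> S1 = {}"
  unfolding face_def by auto

lemma circle_edge_subset: "pt ` {a..b} \<subseteq> S1"
  by auto

lemma closure_circle_edge: "closure (pt ` {a..b}) = pt ` {a..b}"
  by (intro closure_closed compact_imp_closed compact_continuous_image continuous_on_pt) simp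

lemma hull_subset_iff: "convex T \<Longrightarrow> convex hull A \<subseteq> T \<longleftrightarrow> A \<subseteq> T"
  by (meson hull_minimal hull_subset subset_trans)

lemma face_subset_closure_iff:
  assumes D: "arc_diagram D" and "z \<in> S1" "z \<notin> \<Union>D" "w \<in> S1" "w \<notin> \<Union>D"
  shows "face D z \<subseteq> closure (face D w) \<longleftrightarrow> face D z = face D w"
proof
  assume *: "face D z \<subseteq> closure (face D w)"
  obtain y where y: "y \<in> face D z" using face_nonempty[OF D assms(2,3)] by blast
  have "same_side A z w" if AD: "A \<in> D" for A
  proof -
    obtain a b where A: "A = {a, b}" using arc_diagram_arc_ends[OF D AD] by metis
    have 1: "same_side A y z" using y AD unfolding face_def by blast
    have "weak_side A y w" using * y AD closure_face[OF D assms(4,5)] by blast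
    moreover have "same_side A w w" using same_side_refl[OF D AD] assms AD by blast
    ultimately have "same_side A y w" using 1 unfolding A same_side_pair weak_side_pair
      by (metis less_eq_real_def mult_eq_0_iff order_less_irrefl)
    then show ?thesis using 1 same_side_sym same_side_trans by blast
  qed
  then show "face D z = face D w" using face_eq_iff[OF D assms(2,3)] by blast
qed (simp add: closure_subset)

lemma face_not_subset:
  assumes D: "arc_diagram D" and "z \<in> S1" "z \<notin> \<Union>D"
  shows "\<not> face D z \<subseteq> S1" "A \<in> D \<Longrightarrow> \<not> face D z \<subseteq> convex hull A"
proof -
  obtain y where y: "y \<in> face D z" using face_nonempty[OF D assms(2,3)] by blast
  show "\<not> face D z \<subseteq> S1" using y face_Int_S1 by blast
  assume A: "A \<in> D"
  then obtain a b where ab: "A = {a, b}" using arc_diagram_arc_ends[OF D A] by metis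
  have "same_side A y z" using y A unfolding face_def by blast
  then have "y \<notin> convex hull A" unfolding ab same_side_pair using chord_side_zero by force
  then show "\<not> face D z \<subseteq> convex hull A" using y by blast
qed

lemma convex_closure_face: "convex (closure (face D z))" for D :: "complex set set"
  unfolding face_def by (intro convex_closure convex_same_sides convex_ball)

locale rearrangement =
  fixes F D
  assumes rearr: "rearr F D"
begin

abbreviation "f \<equiv> circ F"
abbreviation "R \<equiv> push F D"

lemma F: "homeo_lift F" and D: "arc_diagram D" and R: "arc_diagram R"
  and affine: "circle_interval D a b \<Longrightarrow> affine_on F a b"
  using rearr unfolding rearr_def by auto

lemma f_inj: "inj_on f S1" and f_onto: "f ` S1 = S1"
  using circ_Bij[OF F] unfolding Bij_def bij_betw_def by auto

lemma f_S1: "z \<in> S1 \<Longrightarrow> f z \<in> S1"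
  using f_onto by blast

lemma f_vertex: "z \<in> S1 \<Longrightarrow> f z \<in> \<Union>R \<longleftrightarrow> z \<in> \<Union>D"
  unfolding Union_push using inj_on_image_mem_iff[OF f_inj _ arc_diagram_subset_S1[OF D]] by blast

lemma arc_S1: "A \<in> D \<Longrightarrow> A \<subseteq> S1"
  using arc_diagram_subset_S1[OF D] by blast

lemma image_subset_iff': "S \<subseteq> S1 \<Longrightarrow> T \<subseteq> S1 \<Longrightarrow> f ` S \<subseteq> f ` T \<longleftrightarrow> S \<subseteq> T"
  using inj_on_image_subset_iff[OF f_inj] .

lemma image_eq_iff': "S \<subseteq> S1 \<Longrightarrow> T \<subseteq> S1 \<Longrightarrow> f ` S = f ` T \<longleftrightarrow> S = T"
  using inj_on_image_eq_iff[OF f_inj] .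

lemma same_side_push:
  assumes "A \<in> D" "z \<in> S1" "w \<in> S1"
  shows "same_side (f ` A) (f z) (f w) \<longleftrightarrow> same_side A z w" "weak_side (f ` A) (f z) (f w) \<longleftrightarrow> weak_side A z w"
proof -
  obtain a b where ab: "A = {a, b}" "a \<noteq> b" "a \<in> S1" "b \<in> S1" using arc_diagram_arc_ends[OF D assms(1)] by metis
  show "same_side (f ` A) (f z) (f w) \<longleftrightarrow> same_side A z w" "weak_side (f ` A) (f z) (f w) \<longleftrightarrow> weak_side A z w"
    using same_side_circ[OF F ab(1,3,4,2) assms(2,3)] by auto
qed

lemma face_push_eq_iff:
  assumes "z \<in> S1" "z \<notin> \<Union>D" "w \<in> S1"
  shows "face R (f z) = face R (f w) \<longleftrightarrow> face D z = face D w"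
proof -
  have "f z \<in> S1" "f z \<notin> \<Union>R" using f_S1 f_vertex assms by auto
  then have "face R (f z) = face R (f w) \<longleftrightarrow> (\<forall>B\<in>R. same_side B (f z) (f w))" using face_eq_iff[OF R] by blast
  also have "\<dots> \<longleftrightarrow> (\<forall>A\<in>D. same_side A z w)" unfolding push_def using same_side_push assms by simp
  finally show ?thesis using face_eq_iff[OF D assms(1,2)] by simp
qed

text \<open>
  Each cell is recovered from the circle: vertices and circle edges lie on it, an arc is the hull of
  its two ends, and a face is determined by a circle point with the same sides.
\<close>

definition cell_map :: "complex set \<Rightarrow> complex set" where
  "cell_map c = (if c \<subseteq> S1 then f ` c
     else if c \<in> arc_edges D then convex hull (f ` (c \<inter> S1))
     else face R (f (SOME z. z \<in> S1 \<and> z \<notin> \<Union>D \<and> face D z = c)))"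

lemma cell_map_circle: "c \<subseteq> S1 \<Longrightarrow> cell_map c = f ` c"
  by (simp add: cell_map_def)

lemma cell_map_arc: "A \<in> D \<Longrightarrow> cell_map (convex hull A) = convex hull (f ` A)"
proof -
  assume A: "A \<in> D"
  then have "convex hull A \<in> arc_edges D" unfolding arc_edges_def by blast
  then show ?thesis using arc_hull_Int_S1[OF D A] arc_hull_not_subset_S1[OF D A] by (simp add: cell_map_def)
qed

lemma face_not_circle: assumes "z \<in> S1" "z \<notin> \<Union>D" shows "\<not> face D z \<subseteq> S1"
  using face_nonempty[OF D assms] face_Int_S1[of D z] by (metis Int_absorb2 empty_iff)

lemma face_not_arc: assumes "z \<in> S1" "z \<notin> \<Union>D" shows "face D z \<notin> arc_edges D"
proof
  assume "face D z \<in> arc_edges D"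
  then obtain A where A: "A \<in> D" "face D z = convex hull A" unfolding arc_edges_def by blast
  then have "A = {}" using face_Int_S1[of D z] arc_hull_Int_S1[OF D A(1)] by simp
  then show False using arc_diagram_arc_ends[OF D A(1)] by (metis insert_not_empty)
qed

lemma cell_map_face:
  assumes "z \<in> S1" "z \<notin> \<Union>D" shows "cell_map (face D z) = face R (f z)"
proof -
  \<comment> \<open>The circle point that \<open>cell_map\<close> picks for this face.\<close>
  define w where "w = (SOME w. w \<in> S1 \<and> w \<notin> \<Union>D \<and> face D w = face D z)"
  have "w \<in> S1 \<and> w \<notin> \<Union>D \<and> face D w = face D z" unfolding w_def by (rule someI[of _ z]) (use assms in simp)
  then have "face R (f w) = face R (f z)" using face_push_eq_iff assms by blast
  then show ?thesis using face_not_circle[OF assms] face_not_arc[OF assms] unfolding cell_map_def w_def by simp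
qed

lemma vertex_cell_circle: "c \<in> vertex_cells D \<Longrightarrow> c \<subseteq> S1"
  unfolding vertex_cells_def using arc_diagram_subset_S1[OF D] by blast

lemma circle_edge_circle: "c \<in> circle_edges D \<Longrightarrow> c \<subseteq> S1"
  unfolding circle_edges_def by auto

lemma bij_vertices: "bij_betw cell_map (vertex_cells D) (vertex_cells R)"
proof -
  have "inj_on cell_map (vertex_cells D)"
    by (rule inj_onI) (metis cell_map_circle vertex_cell_circle image_eq_iff')
  moreover have "vertex_cells R = cell_map ` vertex_cells D"
  proof -
    have "vertex_cells R = (\<lambda>v. {v}) ` \<Union>R" "vertex_cells D = (\<lambda>v. {v}) ` \<Union>D" unfolding vertex_cells_def by auto
    moreover have "cell_map {v} = {f v}" if "v \<in> \<Union>D" for v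
      using cell_map_circle[of "{v}"] arc_diagram_subset_S1[OF D] that by auto
    ultimately show ?thesis unfolding Union_push by (simp add: image_image)
  qed
  ultimately show ?thesis unfolding bij_betw_def by simp
qed

lemma bij_arcs: "bij_betw cell_map (arc_edges D) (arc_edges R)"
proof -
  have eq: "arc_edges D = (\<lambda>A. convex hull A) ` D" "arc_edges R = (\<lambda>A. convex hull A) ` R"
    unfolding arc_edges_def by auto
  have "inj_on cell_map (arc_edges D)"
  proof (rule inj_onI)
    fix c d assume cd: "c \<in> arc_edges D" "d \<in> arc_edges D" "cell_map c = cell_map d"
    then obtain A B where AB: "A \<in> D" "c = convex hull A" "B \<in> D" "d = convex hull B" unfolding eq by blast
    then have "convex hull (f ` A) = convex hull (f ` B)" "f ` A \<in> R" "f ` B \<in> R"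
      using cd(3) cell_map_arc unfolding push_def by auto
    then have "f ` A = f ` B" using arc_hull_Int_S1[OF R] by metis
    then show "c = d" using AB image_eq_iff' arc_S1 by simp
  qed
  moreover have "arc_edges R = cell_map ` arc_edges D"
    unfolding eq unfolding push_def image_image using cell_map_arc by simp
  ultimately show ?thesis unfolding bij_betw_def by simp
qed

lemma cell_map_circle_edge: "cell_map (pt ` {a..b}) = pt ` {F a..F b}"
  using cell_map_circle[OF circle_edge_subset] circ_pt[OF F]
  by (simp add: image_image flip: homeo_lift_image_Icc[OF F])

lemma bij_circle_edges: "bij_betw cell_map (circle_edges D) (circle_edges R)"
proof -
  have "inj_on cell_map (circle_edges D)"
    by (rule inj_onI) (metis cell_map_circle circle_edge_circle image_eq_iff')
  moreover have "circle_edges R = cell_map ` circle_edges D"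
  proof (intro equalityI subsetI)
    fix c assume "c \<in> circle_edges R"
    then obtain a b where "c = pt ` {a..b}" "circle_interval R a b" unfolding circle_edges_def by blast
    then obtain a' b' where "c = cell_map (pt ` {a'..b'})" "circle_interval D a' b'"
      using circle_interval_pushE[OF F arc_diagram_subset_S1[OF D]] cell_map_circle_edge by metis
    then show "c \<in> cell_map ` circle_edges D" unfolding circle_edges_def by blast
  next
    fix c assume "c \<in> cell_map ` circle_edges D"
    then obtain a b where "c = pt ` {F a..F b}" "circle_interval D a b"
      unfolding circle_edges_def using cell_map_circle_edge by auto
    then show "c \<in> circle_edges R"
      using circle_interval_push[OF F arc_diagram_subset_S1[OF D]] unfolding circle_edges_def by blast
  qed
  ultimately show ?thesis unfolding bij_betw_def by simp
qed

lemma bij_faces: "bij_betw cell_map (faces D) (faces R)"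
proof -
  have "inj_on cell_map (faces D)"
    unfolding faces_eq[OF D] by (rule inj_onI) (use cell_map_face face_push_eq_iff in auto)
  moreover have "faces R = cell_map ` faces D"
  proof -
    have "{w \<in> S1. w \<notin> \<Union>R} = f ` {z \<in> S1. z \<notin> \<Union>D}"
    proof (intro equalityI subsetI)
      fix w assume w: "w \<in> {w \<in> S1. w \<notin> \<Union>R}"
      then obtain z where "z \<in> S1" "w = f z" using f_onto by blast
      then show "w \<in> f ` {z \<in> S1. z \<notin> \<Union>D}" using w f_vertex by blast
    next
      fix w assume "w \<in> f ` {z \<in> S1. z \<notin> \<Union>D}"
      then show "w \<in> {w \<in> S1. w \<notin> \<Union>R}" using f_vertex f_S1 by auto
    qed
    then have "faces R = (\<lambda>z. face R (f z)) ` {z \<in> S1. z \<notin> \<Union>D}" unfolding faces_eq[OF R] by (simp add: image_image)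
    also have "\<dots> = cell_map ` face D ` {z \<in> S1. z \<notin> \<Union>D}"
      unfolding image_image by (rule image_cong) (use cell_map_face in auto)
    finally show ?thesis unfolding faces_eq[OF D] .
  qed
  ultimately show ?thesis unfolding bij_betw_def by simp
qed

lemma closure_trace_face:
  assumes "z \<in> S1" "z \<notin> \<Union>D"
  shows "closure (face R (f z)) \<inter> S1 = f ` (closure (face D z) \<inter> S1)"
proof -
  have fz: "f z \<in> S1" "f z \<notin> \<Union>R" using f_S1 f_vertex assms by auto
  have 1: "closure (face D z) \<inter> S1 = {w \<in> S1. \<forall>A\<in>D. weak_side A w z}" unfolding closure_face[OF D assms] by auto
  have 2: "closure (face R (f z)) \<inter> S1 = {w \<in> S1. \<forall>A\<in>D. weak_side (f ` A) w (f z)}"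
    unfolding closure_face[OF R fz] unfolding push_def by auto
  show ?thesis unfolding 1 2
  proof (intro equalityI subsetI)
    fix w assume w: "w \<in> {w \<in> S1. \<forall>A\<in>D. weak_side (f ` A) w (f z)}"
    then obtain u where "u \<in> S1" "w = f u" using f_onto by blast
    then show "w \<in> f ` {w \<in> S1. \<forall>A\<in>D. weak_side A w z}" using w same_side_push(2) assms by auto
  next
    fix w assume "w \<in> f ` {w \<in> S1. \<forall>A\<in>D. weak_side A w z}"
    then show "w \<in> {w \<in> S1. \<forall>A\<in>D. weak_side (f ` A) w (f z)}" using same_side_push(2) assms f_S1 by auto
  qed
qed

lemma cells_cases:
  assumes "c \<in> cells D"
  obtains (circle) "c \<subseteq> S1" "closure c = c" "cell_map c \<subseteq> S1" "closure (cell_map c) = cell_map c"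
  | (arc) A where "A \<in> D" "c = convex hull A" "cell_map c = convex hull (f ` A)"
  | (face) z where "z \<in> S1" "z \<notin> \<Union>D" "c = face D z" "cell_map c = face R (f z)"
proof -
  consider (v) "c \<in> vertex_cells D" | (a) "c \<in> arc_edges D" | (e) "c \<in> circle_edges D" | (f) "c \<in> faces D"
    using assms unfolding cells_def by blast
  then show ?thesis
  proof cases
    case v
    then obtain v where "c = {v}" "v \<in> S1" using vertex_cell_circle unfolding vertex_cells_def by blast
    then show ?thesis using circle cell_map_circle[of c] f_S1 by auto
  next
    case a then show ?thesis using arc cell_map_arc unfolding arc_edges_def by blast
  next
    case e
    then obtain a b where "c = pt ` {a..b}" unfolding circle_edges_def by blast
    then show ?thesis using circle cell_map_circle_edge[of a b] circle_edge_subset closure_circle_edge by metis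
  next
    case f then show ?thesis using face cell_map_face unfolding faces_eq[OF D] by blast
  qed
qed

text \<open>
  Incidence is decided on the circle, where the isomorphism is the map \<open>f\<close> itself.
\<close>

lemma closure_trace:
  assumes "d \<in> cells D" shows "closure (cell_map d) \<inter> S1 = f ` (closure d \<inter> S1)"
  using assms
proof (cases rule: cells_cases)
  case circle
  then show ?thesis using cell_map_circle by (simp add: Int_absorb2)
next
  case (arc A)
  then have "f ` A \<in> R" unfolding push_def by blast
  then show ?thesis using arc closed_arc_hull[OF D] closed_arc_hull[OF R] arc_hull_Int_S1[OF D] arc_hull_Int_S1[OF R] by simp
next
  case (face z)
  then show ?thesis using closure_trace_face by simp
qed

lemma arc_subset_closure_iff:
  assumes A: "A \<in> D" and d: "d \<in> cells D"
  shows "convex hull A \<subseteq> closure d \<longleftrightarrow> convex hull (f ` A) \<subseteq> closure (cell_map d)"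
proof -
  have trace: "A \<subseteq> closure d \<longleftrightarrow> f ` A \<subseteq> closure (cell_map d)"
  proof -
    have "f ` A \<subseteq> S1" using arc_S1[OF A] f_S1 by blast
    then have "f ` A \<subseteq> closure (cell_map d) \<longleftrightarrow> f ` A \<subseteq> f ` (closure d \<inter> S1)" using closure_trace[OF d] by blast
    also have "\<dots> \<longleftrightarrow> A \<subseteq> closure d" using image_subset_iff'[OF arc_S1[OF A]] arc_S1[OF A] by simp
    finally show ?thesis by simp
  qed
  have fA: "f ` A \<in> R" using A unfolding push_def by blast
  show ?thesis using d
  proof (cases rule: cells_cases)
    case circle
    then show ?thesis using arc_hull_not_subset_S1[OF D A] arc_hull_not_subset_S1[OF R fA] by (metis subset_trans)
  next
    case (arc B)
    then have "convex (closure d)" "convex (closure (cell_map d))" by (auto intro: convex_closure convex_convex_hull)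
    then show ?thesis using trace hull_subset_iff by metis
  next
    case (face z)
    then show ?thesis using trace hull_subset_iff convex_closure_face by metis
  qed
qed

lemma incidence:
  assumes c: "c \<in> cells D" and d: "d \<in> cells D"
  shows "c \<subseteq> closure d \<longleftrightarrow> cell_map c \<subseteq> closure (cell_map d)"
  using c
proof (cases rule: cells_cases)
  case circle
  have "cell_map c \<subseteq> closure (cell_map d) \<longleftrightarrow> cell_map c \<subseteq> closure (cell_map d) \<inter> S1" using circle(3) by blast
  also have "\<dots> \<longleftrightarrow> f ` c \<subseteq> f ` (closure d \<inter> S1)"
    unfolding closure_trace[OF d] cell_map_circle[OF circle(1)] ..
  also have "\<dots> \<longleftrightarrow> c \<subseteq> closure d" using image_subset_iff'[OF circle(1)] circle(1) by simp
  finally show ?thesis by simp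
next
  case (arc A)
  then show ?thesis using arc_subset_closure_iff[OF _ d] by simp
next
  case (face z)
  have fz: "f z \<in> S1" "f z \<notin> \<Union>R" using f_S1 f_vertex face by auto
  show ?thesis using d
  proof (cases rule: cells_cases)
    case circle
    then show ?thesis using face_not_subset(1)[OF D face(1,2)] face_not_subset(1)[OF R fz] face by (metis subset_trans)
  next
    case (arc A)
    then have "f ` A \<in> R" unfolding push_def by blast
    then show ?thesis using arc face closed_arc_hull[OF D] closed_arc_hull[OF R]
        face_not_subset(2)[OF D face(1,2)] face_not_subset(2)[OF R fz] by simp
  next
    case (face w)
    have fw: "f w \<in> S1" "f w \<notin> \<Union>R" using f_S1 f_vertex face by auto
    show ?thesis
      using face_subset_closure_iff[OF D \<open>z \<in> S1\<close> \<open>z \<notin> \<Union>D\<close> face(1,2)] face_subset_closure_iff[OF R fz fw]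
        face_push_eq_iff[OF \<open>z \<in> S1\<close> \<open>z \<notin> \<Union>D\<close> face(1)] face \<open>c = face D z\<close> \<open>cell_map c = face R (f z)\<close> by simp
  qed
qed

lemma cell_map_iso: "diagram_iso cell_map D R"
  unfolding diagram_iso_def
proof (intro conjI ballI allI impI)
  fix a b assume ab: "circle_interval D a b"
  have "circle_interval R (F a) (F b)" using circle_interval_push[OF F arc_diagram_subset_S1[OF D]] ab by blast
  moreover have "cell_map {pt x} = {pt (F x)}" for x using cell_map_circle[of "{pt x}"] circ_pt[OF F] by simp
  ultimately show "\<exists>c d. circle_interval R c d \<and> cell_map (pt ` {a..b}) = pt ` {c..d} \<and>
      cell_map {pt a} = {pt c} \<and> cell_map {pt b} = {pt d}"
    using cell_map_circle_edge by blast
qed (use bij_vertices bij_arcs bij_circle_edges bij_faces incidence in blast)+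

lemma in_TB: "circ F \<in> TB"
proof -
  have "maps_linearly f a b c d"
    if ab: "circle_interval D a b" and cd: "circle_interval R c d" and eq: "cell_map (pt ` {a..b}) = pt ` {c..d}" for a b c d
  proof -
    have "circle_interval R (F a) (F b)" using circle_interval_push[OF F arc_diagram_subset_S1[OF D]] ab by blast
    then obtain k :: int where k: "c = F a + of_int k" "d = F b + of_int k"
      using circle_interval_image_eq[OF _ cd] eq cell_map_circle_edge by metis
    show ?thesis unfolding maps_linearly_def
    proof
      fix t :: real assume t: "t \<in> {0..1}"
      have "a \<le> b" using ab unfolding circle_interval_def by simp
      then have "f (pt (a + t * (b - a))) = pt (F a + t * (F b - F a))"
        using affine_on_param[OF affine[OF ab], of t] t circ_pt[OF F] by simp
      also have "\<dots> = pt (F a + t * (F b - F a) + of_int k)" by simp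
      also have "F a + t * (F b - F a) + of_int k = c + t * (d - c)" using k by simp
      finally show "f (pt (a + t * (b - a))) = pt (c + t * (d - c))" .
    qed
  qed
  then show ?thesis unfolding TB_def using D R cell_map_iso circ_extensional by blast
qed

end

section \<open>Isomorphisms of 2-complexes come from rearrangements\<close>

lemma integer_difference_constant:
  fixes h :: "real \<Rightarrow> real"
  assumes "connected S" "continuous_on S h" "\<And>x. x \<in> S \<Longrightarrow> h x \<in> \<int>" "x \<in> S" "y \<in> S"
  shows "h x = h y"
proof -
  have "h constant_on S"
  proof (rule continuous_discrete_range_constant[OF assms(1,2)])
    fix x assume x: "x \<in> S"
    have "1 \<le> norm (h y - h x)" if "y \<in> S" "h y \<noteq> h x" for y
      using Ints_nonzero_abs_ge1[of "h y - h x"] assms(3)[OF x] assms(3)[OF that(1)] that(2) by simp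
    then show "\<exists>e>0. \<forall>y. y \<in> S \<and> h y \<noteq> h x \<longrightarrow> e \<le> norm (h y - h x)" by (intro exI[of _ 1]) auto
  qed
  then show ?thesis using assms(4,5) unfolding constant_on_def by metis
qed

locale diagram_map =
  fixes f D R \<phi>
  assumes ext: "f \<in> extensional S1"
    and D: "arc_diagram D" and R: "arc_diagram R" and iso: "diagram_iso \<phi> D R"
    and lin: "\<And>a b c d. circle_interval D a b \<Longrightarrow> circle_interval R c d \<Longrightarrow>
                \<phi> (pt ` {a..b}) = pt ` {c..d} \<Longrightarrow> maps_linearly f a b c d"
begin

lemma iso_bij: "bij_betw \<phi> (vertex_cells D) (vertex_cells R)" "bij_betw \<phi> (arc_edges D) (arc_edges R)"
    "bij_betw \<phi> (circle_edges D) (circle_edges R)"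
  and iso_incidence: "\<forall>c\<in>cells D. \<forall>d\<in>cells D. c \<subseteq> closure d \<longleftrightarrow> \<phi> c \<subseteq> closure (\<phi> d)"
  and iso_interval: "\<forall>a b. circle_interval D a b \<longrightarrow> (\<exists>c d. circle_interval R c d \<and>
       \<phi> (pt ` {a..b}) = pt ` {c..d} \<and> \<phi> {pt a} = {pt c} \<and> \<phi> {pt b} = {pt d})"
proof -
  from iso[unfolded diagram_iso_def]
  show "bij_betw \<phi> (vertex_cells D) (vertex_cells R)" "bij_betw \<phi> (arc_edges D) (arc_edges R)"
    "bij_betw \<phi> (circle_edges D) (circle_edges R)"
    "\<forall>c\<in>cells D. \<forall>d\<in>cells D. c \<subseteq> closure d \<longleftrightarrow> \<phi> c \<subseteq> closure (\<phi> d)"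
    "\<forall>a b. circle_interval D a b \<longrightarrow> (\<exists>c d. circle_interval R c d \<and>
       \<phi> (pt ` {a..b}) = pt ` {c..d} \<and> \<phi> {pt a} = {pt c} \<and> \<phi> {pt b} = {pt d})"
    by - (elim conjE, assumption)+
qed

lemma matching_interval:
  assumes "circle_interval D a b"
  obtains c d where "circle_interval R c d" "\<phi> (pt ` {a..b}) = pt ` {c..d}" "\<phi> {pt a} = {pt c}"
    "\<And>x. a \<le> x \<Longrightarrow> x \<le> b \<Longrightarrow> f (pt x) = pt (c + (x - a) / (b - a) * (d - c))"
proof -
  obtain c d where cd: "circle_interval R c d" "\<phi> (pt ` {a..b}) = pt ` {c..d}" "\<phi> {pt a} = {pt c}"
    using iso_interval assms by metis
  have "a < b" using assms unfolding circle_interval_def by blast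
  have "f (pt x) = pt (c + (x - a) / (b - a) * (d - c))" if "a \<le> x" "x \<le> b" for x
  proof -
    have "(x - a) / (b - a) \<in> {0..1}" using that \<open>a < b\<close> by simp
    then have "f (pt (a + (x - a) / (b - a) * (b - a))) = pt (c + (x - a) / (b - a) * (d - c))"
      using lin[OF assms cd(1,2)] unfolding maps_linearly_def by blast
    then show ?thesis using \<open>a < b\<close> by simp
  qed
  then show ?thesis using that cd by blast
qed

lemma inner_param:
  fixes a b c d x :: real
  assumes "a < x" "x < b" "c < d"
  shows "c < c + (x - a) / (b - a) * (d - c)" "c + (x - a) / (b - a) * (d - c) < d"
proof -
  have "0 < (x - a) / (b - a)" "(x - a) / (b - a) < 1" using assms by auto
  then have "0 < (x - a) / (b - a) * (d - c)" "(x - a) / (b - a) * (d - c) < 1 * (d - c)"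
    using assms by (intro mult_pos_pos mult_strict_right_mono; simp)+
  then show "c < c + (x - a) / (b - a) * (d - c)" "c + (x - a) / (b - a) * (d - c) < d" by auto
qed

lemma image_vertex: assumes "v \<in> \<Union>D" shows "f v \<in> \<Union>R" "\<phi> {v} = {f v}"
proof -
  obtain x where x: "v = pt x" using S1_obtain_pt arc_diagram_subset_S1[OF D] assms by (metis subsetD)
  obtain a b where ab: "circle_interval D a b" "a \<le> x" "x < b"
    using circle_interval_right[OF arc_diagram_vertices_ok[OF D]] by blast
  have "a = x" using ab assms x unfolding circle_interval_def by force
  obtain c d where cd: "circle_interval R c d" "\<phi> {pt a} = {pt c}"
    "\<And>x. a \<le> x \<Longrightarrow> x \<le> b \<Longrightarrow> f (pt x) = pt (c + (x - a) / (b - a) * (d - c))"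
    using matching_interval[OF ab(1)] by metis
  have "f v = pt c" using cd(3)[of a] ab x \<open>a = x\<close> by simp
  then show "f v \<in> \<Union>R" "\<phi> {v} = {f v}" using cd \<open>a = x\<close> x unfolding circle_interval_def by auto
qed

lemma image_nonvertex:
  assumes "z \<in> S1" "z \<notin> \<Union>D"
  obtains a b c d x y where "circle_interval D a b" "a < x" "x < b" "z = pt x"
    "circle_interval R c d" "c < y" "y < d" "f z = pt y" "y = c + (x - a) / (b - a) * (d - c)"
    "\<phi> (pt ` {a..b}) = pt ` {c..d}"
proof -
  obtain x where x: "z = pt x" using S1_obtain_pt assms(1) by metis
  obtain a b where ab: "circle_interval D a b" "a \<le> x" "x < b"
    using circle_interval_right[OF arc_diagram_vertices_ok[OF D]] by blast
  have "a < x" using ab assms x unfolding circle_interval_def by (cases "a = x") auto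
  obtain c d where cd: "circle_interval R c d" "\<phi> (pt ` {a..b}) = pt ` {c..d}"
    "\<And>x. a \<le> x \<Longrightarrow> x \<le> b \<Longrightarrow> f (pt x) = pt (c + (x - a) / (b - a) * (d - c))"
    using matching_interval[OF ab(1)] by metis
  have "c < d" using cd(1) unfolding circle_interval_def by blast
  show ?thesis
    using that[OF ab(1) \<open>a < x\<close> ab(3) x cd(1) inner_param[OF \<open>a < x\<close> ab(3) \<open>c < d\<close>] _ refl cd(2)] cd(3)[of x] ab x by simp
qed

lemma image_vertex_iff: assumes "z \<in> S1" shows "f z \<in> \<Union>R \<longleftrightarrow> z \<in> \<Union>D"
proof (cases "z \<in> \<Union>D")
  case False
  obtain c d y where "circle_interval R c d" "c < y" "y < d" "f z = pt y"
    using image_nonvertex[OF assms False] by metis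
  then show ?thesis using False unfolding circle_interval_def by auto
qed (use image_vertex in auto)

lemma f_in_S1: assumes "z \<in> S1" shows "f z \<in> S1"
proof (cases "z \<in> \<Union>D")
  case True then show ?thesis using image_vertex(1) arc_diagram_subset_S1[OF R] by blast
next
  case False
  obtain y where "f z = pt y" using image_nonvertex[OF assms False] by metis
  then show ?thesis by simp
qed

text \<open>
  If two points that are not vertices have the same image, the intervals of \<open>R\<close> around the image have a
  common interior point and coincide. As \<open>\<phi>\<close> is injective on circle edges, the two points are in the
  same interval of \<open>D\<close>, where \<open>f\<close> is affine.
\<close>

lemma f_inj: "inj_on f S1"
proof (rule inj_onI)
  fix z w assume zw: "z \<in> S1" "w \<in> S1" "f z = f w"
  show "z = w"
  proof (cases "z \<in> \<Union>D")
    case True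
    then have "w \<in> \<Union>D" using image_vertex_iff zw by metis
    then have "\<phi> {z} = \<phi> {w}" "{z} \<in> vertex_cells D" "{w} \<in> vertex_cells D"
      using image_vertex(2) True zw unfolding vertex_cells_def by auto
    moreover have "inj_on \<phi> (vertex_cells D)" using iso_bij(1) unfolding bij_betw_def by blast
    ultimately show ?thesis by (metis inj_onD the_elem_eq)
  next
    case False
    then have "w \<notin> \<Union>D" using image_vertex_iff zw by metis
    obtain a b c d x y where z: "circle_interval D a b" "a < x" "x < b" "z = pt x"
      "circle_interval R c d" "c < y" "y < d" "f z = pt y" "y = c + (x - a) / (b - a) * (d - c)"
      "\<phi> (pt ` {a..b}) = pt ` {c..d}" using image_nonvertex[OF zw(1) False] by metis
    obtain a' b' c' d' x' y' where w: "circle_interval D a' b'" "a' < x'" "x' < b'" "w = pt x'"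
      "circle_interval R c' d'" "c' < y'" "y' < d'" "f w = pt y'" "y' = c' + (x' - a') / (b' - a') * (d' - c')"
      "\<phi> (pt ` {a'..b'}) = pt ` {c'..d'}" using image_nonvertex[OF zw(2) \<open>w \<notin> \<Union>D\<close>] by metis
    obtain k :: int where k: "y' = y + of_int k" using z(8) w(8) zw(3) pt_eq_iff by metis
    have cd: "c' = c + of_int k" "d' = d + of_int k"
      using circle_interval_unique[OF circle_interval_shift[OF z(5), of k] w(5), of y'] z w k by auto
    have "pt ` {c'..d'} = pt ` {c..d}"
    proof -
      have "{c'..d'} = (\<lambda>t. t + of_int k) ` {c..d}" using cd by simp
      then show ?thesis by (simp only: image_image pt_add_int)
    qed
    then have "\<phi> (pt ` {a..b}) = \<phi> (pt ` {a'..b'})" using z w by simp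
    moreover have "inj_on \<phi> (circle_edges D)" using iso_bij(3) unfolding bij_betw_def by blast
    moreover have "pt ` {a..b} \<in> circle_edges D" "pt ` {a'..b'} \<in> circle_edges D"
      using z(1) w(1) unfolding circle_edges_def by blast+
    ultimately have "pt ` {a..b} = pt ` {a'..b'}" by (metis inj_onD)
    then obtain j :: int where j: "a' = a + of_int j" "b' = b + of_int j" using circle_interval_image_eq[OF z(1) w(1)] by metis
    have "(x - a) / (b - a) * (d - c) = (x' - a') / (b' - a') * (d - c)" using k cd z(9) w(9) by simp
    moreover have "d - c \<noteq> 0" using z(6,7) by simp
    ultimately have "(x - a) / (b - a) = (x' - a') / (b' - a')" by (metis mult_right_cancel)
    then have "x' = x + of_int j" using j z(2,3) by simp
    then show ?thesis using z w by simp
  qed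
qed

lemma continuous_f_pt: "continuous_on UNIV (\<lambda>x. f (pt x))"
proof -
  have on_interval: "continuous_on {a..b} (\<lambda>x. f (pt x))" if "circle_interval D a b" for a b
  proof -
    obtain c d where eq: "\<And>x. a \<le> x \<Longrightarrow> x \<le> b \<Longrightarrow> f (pt x) = pt (c + (x - a) / (b - a) * (d - c))"
      using matching_interval[OF \<open>circle_interval D a b\<close>] by metis
    have "continuous_on {a..b} (\<lambda>x. pt (c + (x - a) / (b - a) * (d - c)))"
      unfolding pt_def cis_conv_exp divide_inverse by (intro continuous_intros)
    then show ?thesis
    proof (rule continuous_on_eq)
      show "pt (c + (x - a) / (b - a) * (d - c)) = f (pt x)" if "x \<in> {a..b}" for x
        using eq[of x] that by simp
    qed
  qed
  have "isCont (\<lambda>x. f (pt x)) x" for x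
  proof -
    obtain a b where ab: "circle_interval D a b" "a < x" "x \<le> b"
      using circle_interval_left[OF arc_diagram_vertices_ok[OF D]] by blast
    obtain a' b' where ab': "circle_interval D a' b'" "a' \<le> x" "x < b'"
      using circle_interval_right[OF arc_diagram_vertices_ok[OF D]] by blast
    have "continuous_on ({a..b} \<union> {a'..b'}) (\<lambda>x. f (pt x))"
      by (intro continuous_on_closed_Un on_interval ab ab') auto
    then have "continuous_on {a<..<b'} (\<lambda>x. f (pt x))"
      by (rule continuous_on_subset) (use ab ab' in auto)
    then show ?thesis using ab ab' by (simp add: continuous_on_eq_continuous_at)
  qed
  then show ?thesis by (simp add: continuous_at_imp_continuous_on)
qed

lemma lift_exists: "\<exists>F. continuous_on UNIV F \<and> (\<forall>x. f (pt x) = pt (F x))"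
proof -
  have nz: "f (pt x) \<noteq> 0" for x using f_in_S1[of "pt x"] by auto
  obtain g where g: "continuous_on UNIV g" "\<And>x. x \<in> UNIV \<Longrightarrow> f (pt x) = exp (g x)"
  proof (rule continuous_logarithm_on_contractible[OF continuous_f_pt convex_imp_contractible[OF convex_UNIV] nz])
    fix g assume "continuous_on UNIV g" "\<And>x. x \<in> UNIV \<Longrightarrow> f (pt x) = exp (g x)"
    then show thesis by (rule that)
  qed
  have "f (pt x) = pt (Im (g x) / (2 * pi))" for x
  proof -
    have "cmod (exp (g x)) = 1" using f_in_S1[of "pt x"] g(2)[of x] by simp
    then have "Re (g x) = 0" by (simp add: norm_exp_eq_Re)
    then show ?thesis using g(2)[of x] by (simp add: pt_def exp_eq_polar)
  qed
  moreover have "continuous_on UNIV (\<lambda>x. Im (g x) / (2 * pi))" by (intro continuous_intros g(1)) simp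
  ultimately show ?thesis by blast
qed

text \<open>
  An end of an arc is a vertex incident to it, so \<open>\<phi>\<close> maps arcs according to their ends.
\<close>

lemma push_eq:
  assumes F: "homeo_lift F" "f = circ F" shows "push F D = R"
proof -
  have *: "f ` A = B" if A: "A \<in> D" and B: "B \<in> R" and AB: "\<phi> (convex hull A) = convex hull B" for A B
  proof -
    have "f v \<in> B" if v: "v \<in> A" for v
    proof -
      have "{v} \<in> cells D" "convex hull A \<in> cells D" using v A unfolding cells_def vertex_cells_def arc_edges_def by blast+
      moreover have "{v} \<subseteq> closure (convex hull A)" using v hull_inc closure_subset by fastforce
      ultimately have "\<phi> {v} \<subseteq> closure (\<phi> (convex hull A))" using iso_incidence by blast
      then have "f v \<in> convex hull B" using image_vertex(2) v A AB closed_arc_hull[OF R B] by auto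
      moreover have "f v \<in> S1" using f_in_S1 v A arc_diagram_subset_S1[OF D] by blast
      ultimately show ?thesis using arc_hull_Int_S1[OF R B] by blast
    qed
    then have sub: "f ` A \<subseteq> B" by blast
    have card2: "card C = 2 \<and> finite C" if CE: "arc_diagram E" "C \<in> E" for C E
      using arc_diagram_arc_ends[OF CE] by (metis card_2_iff finite.emptyI finite.insertI)
    have "A \<subseteq> S1" using A arc_diagram_subset_S1[OF D] by blast
    then have "card (f ` A) = card A" using f_inj by (metis card_image inj_on_subset)
    then show "f ` A = B" using card_subset_eq[OF _ sub] card2[OF D A] card2[OF R B] by simp
  qed
  have bij: "\<phi> ` arc_edges D = arc_edges R" using iso_bij(2) unfolding bij_betw_def by blast
  show ?thesis
  proof (intro equalityI subsetI)
    fix B assume "B \<in> push F D"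
    then obtain A where A: "A \<in> D" "B = f ` A" unfolding push_def F(2) by blast
    then have "\<phi> (convex hull A) \<in> arc_edges R" using bij unfolding arc_edges_def by blast
    then obtain B' where "B' \<in> R" "\<phi> (convex hull A) = convex hull B'" unfolding arc_edges_def by blast
    then show "B \<in> R" using * A by metis
  next
    fix B assume B: "B \<in> R"
    then have "convex hull B \<in> \<phi> ` arc_edges D" using bij unfolding arc_edges_def by blast
    then obtain A where "A \<in> D" "\<phi> (convex hull A) = convex hull B" unfolding arc_edges_def by auto
    then show "B \<in> push F D" using *[OF _ B] unfolding push_def F(2) by blast
  qed
qed

text \<open>
  On a circle interval the lift differs from an increasing affine map by a continuous integer-valued
  function, hence by a constant. So the lift increases, and its period shift is a positive integer,
  which is \<open>1\<close> because \<open>f\<close> is injective.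
\<close>

lemma is_rearr: obtains F where "f = circ F" "rearr F D"
proof -
  obtain F where F: "continuous_on UNIV F" "\<And>x. f (pt x) = pt (F x)" using lift_exists by blast
  have cF: "continuous_on S F" for S using F(1) continuous_on_subset by blast
  have pieces: "\<exists>m e. m > 0 \<and> (\<forall>x\<in>{a..b}. F x = m * x + e)" if ab: "circle_interval D a b" for a b
  proof -
    obtain c d where cd: "circle_interval R c d"
      "\<And>x. a \<le> x \<Longrightarrow> x \<le> b \<Longrightarrow> f (pt x) = pt (c + (x - a) / (b - a) * (d - c))"
      using matching_interval[OF ab] by metis
    have l: "a < b" "c < d" using ab cd(1) unfolding circle_interval_def by auto
    define h where "h x = F x - (c + (x - a) / (b - a) * (d - c))" for x
    have "continuous_on {a..b} h" unfolding h_def divide_inverse by (intro continuous_intros cF)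
    moreover have "h x \<in> \<int>" if "x \<in> {a..b}" for x
    proof -
      have "pt (F x) = pt (c + (x - a) / (b - a) * (d - c))" using cd(2)[of x] F(2)[of x] that by simp
      then show ?thesis unfolding pt_eq_iff h_def by auto
    qed
    ultimately have hc: "h x = h a" if "x \<in> {a..b}" for x
      using integer_difference_constant[of "{a..b}" h x a] that l by auto
    define m where "m = (d - c) / (b - a)"
    have "F x = m * x + (h a + c - m * a)" if x: "x \<in> {a..b}" for x
    proof -
      have "(x - a) / (b - a) * (d - c) = m * (x - a)" by (simp add: m_def)
      then have "h x = F x - (c + m * (x - a))" by (simp only: h_def)
      then show ?thesis using hc[OF x] by (simp add: algebra_simps)
    qed
    moreover have "m > 0" using l by (simp add: m_def)
    ultimately show ?thesis by blast
  qed
  have fin: "finite {z. x < z \<and> z < y \<and> pt z \<in> \<Union>D}" for x y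
    by (rule finite_subset[OF _ finite_pt_vimage[OF arc_diagram_finite_Union[OF D], of x y]]) auto
  have mono: "F x < F y" if "x < y" for x y
    using that
  proof (induction "card {z. x < z \<and> z < y \<and> pt z \<in> \<Union>D}" arbitrary: x y rule: less_induct)
    case less
    show ?case
    proof (cases "\<exists>v. x < v \<and> v < y \<and> pt v \<in> \<Union>D")
      case True
      then obtain v where v: "x < v" "v < y" "pt v \<in> \<Union>D" by blast
      have "{z. x < z \<and> z < v \<and> pt z \<in> \<Union>D} \<subset> {z. x < z \<and> z < y \<and> pt z \<in> \<Union>D}"
           "{z. v < z \<and> z < y \<and> pt z \<in> \<Union>D} \<subset> {z. x < z \<and> z < y \<and> pt z \<in> \<Union>D}"
        using v by auto
      then have "F x < F v" "F v < F y" using less.hyps v psubset_card_mono[OF fin] by blast+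
      then show ?thesis by simp
    next
      case False
      obtain a b where ab: "circle_interval D a b" "a \<le> x" "x < b"
        using circle_interval_right[OF arc_diagram_vertices_ok[OF D]] by blast
      then have "y \<le> b" using False unfolding circle_interval_def by (metis not_le)
      obtain m e where "m > 0" "\<forall>x\<in>{a..b}. F x = m * x + e" using pieces[OF ab(1)] by blast
      then show ?thesis using ab \<open>y \<le> b\<close> less.prems by simp
    qed
  qed
  have per_Ints: "F (x + 1) - F x \<in> \<int>" for x
  proof -
    have "pt (F (x + 1)) = pt (F x)" using F(2)[of "x+1"] F(2)[of x] by simp
    then show ?thesis unfolding pt_eq_iff by auto
  qed
  have per_const: "F (x + 1) - F x = F 1 - F 0" for x
  proof -
    have "continuous_on UNIV (\<lambda>x. F (x + 1) - F x)"
      by (intro continuous_intros cF continuous_on_compose2[OF cF[of UNIV]]) auto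
    then show ?thesis
      using integer_difference_constant[of UNIV "\<lambda>x. F (x + 1) - F x" x 0] per_Ints by simp
  qed
  have "F 1 - F 0 = 1"
  proof -
    obtain k :: int where k: "F 1 - F 0 = of_int k" using per_Ints[of 0] by (auto elim: Ints_cases)
    have "F 0 < F 1" using mono by simp
    then have "k \<ge> 1" using k by linarith
    moreover have "\<not> k \<ge> 2"
    proof
      assume "k \<ge> 2"
      then have "F 0 + 1 < F 1" using k by linarith
      then obtain y where y: "0 \<le> y" "y \<le> 1" "F y = F 0 + 1" using IVT'[of F 0 "F 0 + 1" 1] cF by auto
      then have "f (pt y) = f (pt 0)" using F(2) by simp
      then have "pt y = pt 0" using f_inj by (simp add: inj_on_eq_iff)
      moreover have "y < 1" using y \<open>F 0 + 1 < F 1\<close> by (cases "y = 1") auto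
      ultimately have "y = 0" using pt_eq_near[of y 0] y by simp
      then show False using y by simp
    qed
    ultimately show ?thesis using k by simp
  qed
  then have per: "F (x + 1) = F x + 1" for x using per_const[of x] by simp
  have pern: "F (x + of_nat n) = F x + of_nat n" for x n
  proof (induction n)
    case (Suc n)
    have "F (x + real (Suc n)) = F ((x + real n) + 1)" by (simp add: algebra_simps)
    then show ?case using per[of "x + real n"] Suc by simp
  qed simp
  have "surj F"
  proof (rule surjI)
    fix y
    obtain n :: nat where n: "\<bar>y - F 0\<bar> \<le> of_nat n" using real_arch_simple by blast
    have "F (- of_nat n) = F 0 - of_nat n" using pern[of "- of_nat n" n] by simp
    moreover have "F (of_nat n) = F 0 + of_nat n" using pern[of 0 n] by simp
    ultimately have "\<exists>x\<ge>- of_nat n. x \<le> of_nat n \<and> F x = y" using n cF by (intro IVT') auto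
    then have "\<exists>x. F x = y" by blast
    then show "F (SOME x. F x = y) = y" by (rule someI_ex)
  qed
  then have HF: "homeo_lift F" unfolding homeo_lift_def strict_mono_def using mono per by blast
  have fc: "f = circ F" using circ_eqI[OF ext HF F(2)] .
  have "rearr F D" unfolding rearr_def
    using HF D push_eq[OF HF fc] R pieces unfolding affine_on_def by blast
  then show ?thesis using that fc by blast
qed

end

lemma TB_eq: "TB = rearrangements"
proof
  show "rearrangements \<subseteq> TB" using rearrangement.in_TB rearrangement.intro by blast
  show "TB \<subseteq> rearrangements"
  proof
    fix f assume "f \<in> TB"
    then obtain D R \<phi> where "diagram_map f D R \<phi>" unfolding TB_def diagram_map_def by blast
    then show "f \<in> rearrangements" using diagram_map.is_rearr by blast
  qed
qed

section \<open>Piecewise-linear maps of the circle\<close>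

definition periodic_extension :: "real \<Rightarrow> (real \<Rightarrow> real) \<Rightarrow> real \<Rightarrow> real" where
  "periodic_extension a G x = G (x - of_int \<lfloor>x - a\<rfloor>) + of_int \<lfloor>x - a\<rfloor>"

lemma periodic_extension_eq:
  assumes "G (a + 1) = G a + 1" "a + of_int n \<le> x" "x \<le> a + of_int n + 1"
  shows "periodic_extension a G x = G (x - of_int n) + of_int n"
proof (cases "x = a + of_int n + 1")
  case True
  then have "\<lfloor>x - a\<rfloor> = n + 1" by simp
  then show ?thesis using assms(1) True unfolding periodic_extension_def by (simp add: algebra_simps)
next
  case False
  then have "\<lfloor>x - a\<rfloor> = n" using assms by (simp add: floor_eq_iff)
  then show ?thesis unfolding periodic_extension_def by simp
qed

lemma periodic_extension_homeo_lift:
  assumes per: "G (a + 1) = G a + 1" and mono: "strict_mono_on {a..a + 1} G"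
    and onto: "{G a..G a + 1} \<subseteq> G ` {a..a + 1}"
  shows "homeo_lift (periodic_extension a G)"
  unfolding homeo_lift_def
proof (intro conjI allI)
  define L where "L = periodic_extension a G"
  have rep: "\<exists>n u. a \<le> u \<and> u < a + 1 \<and> x = u + of_int n \<and> L x = G u + of_int n" for x
  proof -
    define n where "n = \<lfloor>x - a\<rfloor>"
    have "a \<le> x - of_int n" "x - of_int n < a + 1" unfolding n_def by linarith+
    then show ?thesis by (intro exI[of _ n] exI[of _ "x - of_int n"]) (simp add: L_def periodic_extension_def n_def)
  qed
  have Gle: "G u \<le> G v" if "a \<le> u" "u \<le> v" "v \<le> a + 1" for u v
    using strict_mono_onD[OF mono, of u v] that by (cases "u = v") auto
  show "strict_mono (periodic_extension a G)" unfolding L_def[symmetric]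
  proof (rule strict_monoI)
    fix x y :: real assume "x < y"
    obtain n u where x: "a \<le> u" "u < a + 1" "x = u + of_int n" "L x = G u + of_int n" using rep by blast
    obtain m v where y: "a \<le> v" "v < a + 1" "y = v + of_int m" "L y = G v + of_int m" using rep by blast
    have "n \<le> m" using x y \<open>x < y\<close> by linarith
    show "L x < L y"
    proof (cases "n = m")
      case True
      then have "u < v" using x y \<open>x < y\<close> by simp
      then have "G u < G v" using strict_mono_onD[OF mono, of u v] x y by simp
      then show ?thesis using x y True by simp
    next
      case False
      then have "of_int n + 1 \<le> (of_int m :: real)" using \<open>n \<le> m\<close> by linarith
      moreover have "G u < G a + 1" using strict_mono_onD[OF mono, of u "a + 1"] x per by simp
      moreover have "G a \<le> G v" using Gle[of a v] y by simp
      ultimately show ?thesis using x y by simp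
    qed
  qed
  show "surj (periodic_extension a G)" unfolding L_def[symmetric]
  proof (rule surjI)
    fix y
    obtain k :: int where k: "G a \<le> y + of_int k" "y + of_int k < G a + 1" using shift_into_period by blast
    then obtain u where u: "a \<le> u" "u \<le> a + 1" "G u = y + of_int k" using onto by force
    have "L (u + of_int (-k)) = y"
      using periodic_extension_eq[OF per, of "-k" "u + of_int (-k)"] u by (simp add: L_def)
    then show "L (SOME x. L x = y) = y" by (rule someI)
  qed
  show "periodic_extension a G (x + 1) = periodic_extension a G x + 1" for x
  proof -
    obtain n u where x: "a \<le> u" "u < a + 1" "x = u + of_int n" "L x = G u + of_int n" using rep by blast
    have "L (x + 1) = G u + of_int (n + 1)"
      unfolding L_def using periodic_extension_eq[OF per, of "n + 1" "x + 1"] x by simp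
    then show ?thesis using x by (simp add: L_def)
  qed
qed

definition increasing_graph :: "(real \<times> real) list \<Rightarrow> bool" where
  "increasing_graph ps \<longleftrightarrow> 2 \<le> length ps \<and> sorted_wrt (\<lambda>p q. fst p < fst q \<and> snd p < snd q) ps"

lemma segment_props:
  fixes a b c d :: real
  assumes "a < b" "c < d"
  defines "s \<equiv> \<lambda>x. c + (d - c) / (b - a) * (x - a)"
  shows "s a = c" "s b = d" "x < y \<Longrightarrow> s x < s y" "s (a + (y - c) * (b - a) / (d - c)) = y"
proof -
  show "x < y \<Longrightarrow> s x < s y"
    unfolding s_def by (intro add_strict_left_mono mult_strict_left_mono) (use assms in auto)
qed (use assms in auto)

lemma interpolate_props:
  assumes "increasing_graph ps"
  shows "interpolate ps (fst (hd ps)) = snd (hd ps)" (is "?A ps")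
    and "interpolate ps (fst (last ps)) = snd (last ps)" (is "?B ps")
    and "strict_mono_on {fst (hd ps)..fst (last ps)} (interpolate ps)" (is "?C ps")
    and "{snd (hd ps)..snd (last ps)} \<subseteq> interpolate ps ` {fst (hd ps)..fst (last ps)}" (is "?D ps")
    and "fst (hd ps) < fst (last ps)" (is "?E ps")
    and "\<And>u v. fst (hd ps) \<le> u \<Longrightarrow> u < v \<Longrightarrow> v \<le> fst (last ps) \<Longrightarrow>
           (\<And>p. p \<in> set ps \<Longrightarrow> \<not> (u < fst p \<and> fst p < v)) \<Longrightarrow> affine_on (interpolate ps) u v" (is "PROP ?F ps")
proof -
  have "?A ps \<and> ?B ps \<and> ?C ps \<and> ?D ps \<and> ?E ps \<and>
     (\<forall>u v. fst (hd ps) \<le> u \<longrightarrow> u < v \<longrightarrow> v \<le> fst (last ps) \<longrightarrow>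
           (\<forall>p\<in>set ps. \<not> (u < fst p \<and> fst p < v)) \<longrightarrow> affine_on (interpolate ps) u v)"
    using assms
  proof (induction ps rule: induct_list012)
    case (3 p q rs)
    obtain a c where p: "p = (a, c)" by (cases p)
    obtain b d where q: "q = (b, d)" by (cases q)
    have abcd: "a < b" "c < d" using 3(3) unfolding increasing_graph_def p q by auto
    define s where "s x = c + (d - c) / (b - a) * (x - a)" for x
    have s: "s a = c" "s b = d" "\<And>x y. x < y \<Longrightarrow> s x < s y" "\<And>y. s (a + (y - c) * (b - a) / (d - c)) = y"
      unfolding s_def using segment_props[OF abcd] by auto
    have I: "interpolate (p # q # rs) x = (if x \<le> b then s x else interpolate (q # rs) x)" for x
      by (simp add: p q s_def)
    have aff: "affine_on (interpolate (p # q # rs)) u v" if "v \<le> b" for u v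
    proof -
      define m where "m = (d - c) / (b - a)"
      have "s x = m * x + (c - m * a)" for x unfolding s_def m_def[symmetric] by (simp add: algebra_simps)
      then show ?thesis unfolding affine_on_def using that
        by (intro exI[of _ m] exI[of _ "c - m * a"]) (simp add: I)
    qed
    show ?case
    proof (cases rs)
      case Nil
      have "\<exists>x. a \<le> x \<and> x \<le> b \<and> s x = y" if y: "c \<le> y" "y \<le> d" for y
      proof (intro exI conjI)
        show "a \<le> a + (y - c) * (b - a) / (d - c)" using y abcd by simp
        have "(y - c) * (b - a) \<le> (d - c) * (b - a)" using y abcd by (intro mult_right_mono) auto
        then show "a + (y - c) * (b - a) / (d - c) \<le> b" using abcd by (simp add: field_simps)
      qed (rule s(4))
      then have "{c..d} \<subseteq> s ` {a..b}" by fastforce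
      moreover have "interpolate (p # q # rs) ` {a..b} = s ` {a..b}" by (rule image_cong) (auto simp: I)
      ultimately have "{c..d} \<subseteq> interpolate (p # q # rs) ` {a..b}" by simp
      moreover have "interpolate (p # q # rs) a = c" "interpolate (p # q # rs) b = d" using I s abcd by simp_all
      moreover have "strict_mono_on {a..b} (interpolate (p # q # rs))" using I s by (auto simp: strict_mono_on_def)
      moreover have ends: "fst (hd (p # q # rs)) = a" "snd (hd (p # q # rs)) = c" "fst (last (p # q # rs)) = b" "snd (last (p # q # rs)) = d"
        by (simp_all add: p q Nil)
      ultimately show ?thesis unfolding ends using aff abcd by blast
    next
      case (Cons r rs')
      have "increasing_graph (q # rs)" using 3(3) unfolding increasing_graph_def Cons by auto
      note IH = 3(2)[OF this]
      have l: "last (p # q # rs) = last (q # rs)" by simp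
      define e where "e = fst (last (q # rs))"
      define g where "g = snd (last (q # rs))"
      have IH': "interpolate (q # rs) b = d" "interpolate (q # rs) e = g" "strict_mono_on {b..e} (interpolate (q # rs))"
        "{d..g} \<subseteq> interpolate (q # rs) ` {b..e}" "b < e"
        "\<And>u v. b \<le> u \<Longrightarrow> u < v \<Longrightarrow> v \<le> e \<Longrightarrow> (\<forall>p\<in>set (q # rs). \<not> (u < fst p \<and> fst p < v)) \<Longrightarrow> affine_on (interpolate (q # rs)) u v"
        using IH unfolding e_def g_def by (auto simp: q)
      have I2: "interpolate (p # q # rs) x = interpolate (q # rs) x" if "b \<le> x" for x
        using that I[of x] s(2) IH'(1) by (cases "x = b") auto
      have mono: "interpolate (p # q # rs) x < interpolate (p # q # rs) y" if xy: "a \<le> x" "x < y" "y \<le> e" for x y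
      proof -
        consider "y \<le> b" | "x < b" "b < y" | "b \<le> x" using xy by linarith
        then show ?thesis
        proof cases
          case 1 then show ?thesis using I s(3) xy by simp
        next
          case 2
          have "interpolate (p # q # rs) x < d" using I s(2) s(3)[of x b] 2 by simp
          also have "d < interpolate (q # rs) y" using strict_mono_onD[OF IH'(3), of b y] IH' 2 xy by simp
          finally show ?thesis using I2 2 by simp
        next
          case 3
          then show ?thesis using I2[of x] I2[of y] strict_mono_onD[OF IH'(3), of x y] xy by simp
        qed
      qed
      have onto: "y \<in> interpolate (p # q # rs) ` {a..e}" if y: "c \<le> y" "y \<le> g" for y
      proof (cases "y \<le> d")
        case True
        define x where "x = a + (y - c) * (b - a) / (d - c)"
        have "(y - c) * (b - a) \<le> (d - c) * (b - a)" using True abcd by (intro mult_right_mono) auto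
        then have "x \<le> b" using abcd by (simp add: field_simps x_def)
        moreover have "a \<le> x" using y abcd by (simp add: x_def)
        moreover have "s x = y" unfolding x_def by (rule s(4))
        ultimately have "x \<in> {a..e}" "interpolate (p # q # rs) x = y" using I IH'(5) by auto
        then show ?thesis by blast
      next
        case False
        then have "y \<in> interpolate (q # rs) ` {b..e}" using IH'(4) y by auto
        then obtain x where "x \<in> {b..e}" "interpolate (q # rs) x = y" by (elim imageE) simp
        then have "x \<in> {a..e}" "interpolate (p # q # rs) x = y" using I2 abcd by auto
        then show ?thesis by blast
      qed
      have affine: "affine_on (interpolate (p # q # rs)) u v"
        if uv: "a \<le> u" "u < v" "v \<le> e" "\<forall>p\<in>set (p # q # rs). \<not> (u < fst p \<and> fst p < v)" for u v
      proof (cases "v \<le> b")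
        case False
        then have "b \<le> u" using uv(4) q by auto
        then have "affine_on (interpolate (q # rs)) u v" using IH'(6)[of u v] uv by simp
        then show ?thesis using affine_on_cong[of u v "interpolate (p # q # rs)" "interpolate (q # rs)"] I2 \<open>b \<le> u\<close> by simp
      qed (rule aff)
      have A: "interpolate (p # q # rs) a = c" using I s abcd by simp
      have B: "interpolate (p # q # rs) e = g" using I2[of e] IH' by simp
      have ends: "fst (hd (p # q # rs)) = a" "snd (hd (p # q # rs)) = c" "fst (last (p # q # rs)) = e" "snd (last (p # q # rs)) = g"
        by (simp_all add: p l e_def g_def)
      have C: "strict_mono_on {a..e} (interpolate (p # q # rs))" using mono by (auto simp: strict_mono_on_def)
      have Dd: "{c..g} \<subseteq> interpolate (p # q # rs) ` {a..e}" using onto by auto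
      have E: "a < e" using abcd IH' by simp
      show ?thesis unfolding ends using A B C Dd E affine by blast
    qed
  qed (auto simp: increasing_graph_def)
  then show "?A ps" "?B ps" "?C ps" "?D ps" "?E ps" "PROP ?F ps" by auto
qed

definition period_graph :: "(real \<times> real) list \<Rightarrow> bool" where
  "period_graph ps \<longleftrightarrow> increasing_graph ps \<and> fst (last ps) = fst (hd ps) + 1 \<and> snd (last ps) = snd (hd ps) + 1"

definition pl_lift :: "(real \<times> real) list \<Rightarrow> real \<Rightarrow> real" where
  "pl_lift ps = periodic_extension (fst (hd ps)) (interpolate ps)"

lemma pl_lift_period:
  assumes "period_graph ps"
  shows "interpolate ps (fst (hd ps) + 1) = interpolate ps (fst (hd ps)) + 1"
  using assms interpolate_props(1,2)[of ps] unfolding period_graph_def by simp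

lemma pl_lift_homeo: assumes "period_graph ps" shows "homeo_lift (pl_lift ps)"
  unfolding pl_lift_def
proof (rule periodic_extension_homeo_lift[OF pl_lift_period[OF assms]])
  have ig: "increasing_graph ps" and e: "fst (last ps) = fst (hd ps) + 1" "snd (last ps) = snd (hd ps) + 1"
    using assms unfolding period_graph_def by auto
  show "strict_mono_on {fst (hd ps)..fst (hd ps) + 1} (interpolate ps)" using interpolate_props(3)[OF ig] e by simp
  show "{interpolate ps (fst (hd ps))..interpolate ps (fst (hd ps)) + 1} \<subseteq> interpolate ps ` {fst (hd ps)..fst (hd ps) + 1}"
    using interpolate_props(4)[OF ig] interpolate_props(1)[OF ig] e by simp
qed

lemma pl_lift_eq_interpolate:
  assumes "period_graph ps" "fst (hd ps) \<le> x" "x \<le> fst (hd ps) + 1" shows "pl_lift ps x = interpolate ps x"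
  using periodic_extension_eq[OF pl_lift_period[OF assms(1)], of 0 x] assms unfolding pl_lift_def by simp

lemma pl_circle_eq_circ: assumes "period_graph ps" shows "pl_circle ps = circ (pl_lift ps)"
proof (rule circ_eqI[OF _ pl_lift_homeo[OF assms]])
  show "pl_circle ps \<in> extensional S1" unfolding pl_circle_def by simp
  fix x
  define a where "a = fst (hd ps)"
  define n where "n = \<lfloor>x - a\<rfloor>"
  define u where "u = x - of_int n"
  have u: "a \<le> u" "u < a + 1" unfolding u_def n_def by linarith+
  have xu: "pt x = pt u" using pt_add_int[of u n] by (simp add: u_def)
  have "(THE y. a \<le> y \<and> y < a + 1 \<and> pt y = pt x) = u"
  proof (rule the_equality)
    fix y assume "a \<le> y \<and> y < a + 1 \<and> pt y = pt x"
    then show "y = u" using pt_eq_near[of y u] u xu by auto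
  qed (use u xu in auto)
  then have "pl_circle ps (pt x) = pt (interpolate ps u)" unfolding pl_circle_def a_def by simp
  also have "\<dots> = pt (interpolate ps u + of_int n)" by simp
  also have "interpolate ps u + of_int n = pl_lift ps x"
    unfolding pl_lift_def periodic_extension_def u_def n_def a_def by simp
  finally show "pl_circle ps (pt x) = pt (pl_lift ps x)" .
qed

text \<open>
  If all breakpoints are vertices, a circle interval has no breakpoint in its interior.
\<close>

lemma pl_lift_affine:
  assumes ps: "period_graph ps" and v: "\<And>p. p \<in> set ps \<Longrightarrow> pt (fst p) \<in> \<Union>D" and ci: "circle_interval D u w"
  shows "affine_on (pl_lift ps) u w"
proof -
  have ig: "increasing_graph ps" and e: "fst (last ps) = fst (hd ps) + 1" using ps unfolding period_graph_def by auto
  have "ps \<noteq> []" using ig unfolding increasing_graph_def by auto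
  define a where "a = fst (hd ps)"
  define n where "n = \<lfloor>u - a\<rfloor>"
  have uw: "u < w" using ci unfolding circle_interval_def by blast
  have u: "a + of_int n \<le> u" "u < a + of_int n + 1" unfolding n_def by linarith+
  have "pt (a + of_int (n + 1)) \<in> \<Union>D" using v[of "hd ps"] \<open>ps \<noteq> []\<close> unfolding pt_add_int a_def by simp
  then have w: "w \<le> a + of_int n + 1" using ci u unfolding circle_interval_def by (metis add.assoc not_le of_int_1 of_int_add)
  have nb: "\<not> (u - of_int n < fst p \<and> fst p < w - of_int n)" if p: "p \<in> set ps" for p
  proof
    assume "u - of_int n < fst p \<and> fst p < w - of_int n"
    then have "u < fst p + of_int n" "fst p + of_int n < w" by auto
    then have "pt (fst p + of_int n) \<notin> \<Union>D" using ci unfolding circle_interval_def by blast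
    then show False using v[OF p] by simp
  qed
  have "affine_on (interpolate ps) (u - of_int n) (w - of_int n)"
    by (rule interpolate_props(6)[OF ig]) (use u w uw nb e in \<open>auto simp: a_def\<close>)
  then obtain m c where mc: "\<forall>x\<in>{u - of_int n..w - of_int n}. interpolate ps x = m * x + c" unfolding affine_on_def by blast
  have "pl_lift ps x = m * x + (c - m * of_int n + of_int n)" if x: "x \<in> {u..w}" for x
  proof -
    have "pl_lift ps x = interpolate ps (x - of_int n) + of_int n"
      unfolding pl_lift_def by (rule periodic_extension_eq[OF pl_lift_period[OF ps]]) (use x u w in \<open>auto simp: a_def\<close>)
    also have "interpolate ps (x - of_int n) = m * (x - of_int n) + c" using mc x by simp
    finally show ?thesis by (simp add: algebra_simps)
  qed
  then show ?thesis unfolding affine_on_def by blast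
qed

lemma pl_circle_in_TB:
  assumes "period_graph ps" "arc_diagram D" "arc_diagram (push (pl_lift ps) D)" "\<And>p. p \<in> set ps \<Longrightarrow> pt (fst p) \<in> \<Union>D"
  shows "pl_circle ps \<in> rearrangements"
proof -
  have "rearr (pl_lift ps) D"
    unfolding rearr_def using pl_lift_homeo[OF assms(1)] pl_lift_affine[OF assms(1,4)] assms(2,3) by blast
  then show ?thesis using pl_circle_eq_circ[OF assms(1)] by blast
qed

section \<open>The four generators are rearrangements\<close>

lemma circle_intervalI:
  assumes "\<Union>D = pt ` V" "a < b" "pt a \<in> \<Union>D" "pt b \<in> \<Union>D"
    "\<And>v. v \<in> V \<Longrightarrow> (v \<le> a \<and> b - 1 \<le> v) \<or> (b \<le> v \<and> v \<le> a + 1)"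
  shows "circle_interval D a b"
  unfolding circle_interval_def
proof (intro conjI allI impI assms(2-4))
  fix x assume x: "a < x \<and> x < b"
  have "pt x \<noteq> pt v" if "v \<in> V" for v
    using pt_eq_near[of x v] assms(5)[OF that] x by auto
  then show "pt x \<notin> \<Union>D" unfolding assms(1) by auto
qed

lemma pt_minus_sixth: "pt (-(1/6)) = pt (5/6)"
  using pt_add_one[of "-(1/6)"] by simp

lemma base_Union: "\<Union>base_diagram = pt ` {1/6, 1/3, 2/3, 5/6}"
  by auto

lemma base_intervals:
  "circle_interval base_diagram (1/3) (2/3)" "circle_interval base_diagram (1/6) (1/3)"
  "circle_interval base_diagram (2/3) (5/6)" "circle_interval base_diagram (-(1/6)) (1/6)"
  by (rule circle_intervalI[OF base_Union]; auto simp: pt_minus_sixth)+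

abbreviation "diagram_mid \<equiv> insert {pt (5/12), pt (7/12)} base_diagram"
abbreviation "diagram_opp \<equiv> insert {pt (-(1/12)), pt (1/12)} base_diagram"
abbreviation "diagram_left \<equiv> insert {pt (5/24), pt (7/24)} base_diagram"
abbreviation "diagram_right \<equiv> insert {pt (17/24), pt (19/24)} base_diagram"

lemma small_diagrams: "arc_diagram diagram_mid" "arc_diagram diagram_opp" "arc_diagram diagram_left" "arc_diagram diagram_right"
  using arc_diagram.expand[OF arc_diagram.base base_intervals(1)] arc_diagram.expand[OF arc_diagram.base base_intervals(2)]
    arc_diagram.expand[OF arc_diagram.base base_intervals(3)] arc_diagram.expand[OF arc_diagram.base base_intervals(4)]
  by (simp_all add: primary_arc_def)

lemma left_Union: "\<Union>diagram_left = pt ` {1/6, 1/3, 2/3, 5/6, 5/24, 7/24}"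
  by auto

lemma left_intervals: "circle_interval diagram_left (7/24) (1/3)" "circle_interval diagram_left (1/6) (5/24)"
  by (rule circle_intervalI[OF left_Union]; auto)+

abbreviation "diagram_left_right \<equiv> insert {pt (29/96), pt (31/96)} diagram_left"
abbreviation "diagram_left_left \<equiv> insert {pt (17/96), pt (19/96)} diagram_left"

lemma left_diagrams: "arc_diagram diagram_left_right" "arc_diagram diagram_left_left"
  using arc_diagram.expand[OF small_diagrams(3) left_intervals(1)] arc_diagram.expand[OF small_diagrams(3) left_intervals(2)]
  by (simp_all add: primary_arc_def)

abbreviation "alpha_graph \<equiv> [(-1/3, -1/6), (1/3, 1/6), (2/3, 5/6)]"
abbreviation "beta_graph \<equiv> [(-1/6, -1/6), (1/6, 1/6), (2/3, 7/24), (17/24, 1/3), (5/6, 5/6)]"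
abbreviation "gamma_graph \<equiv> [(1/6, 1/6), (7/24, 19/96), (29/96, 5/24), (1/3, 1/3), (7/6, 7/6)]"
abbreviation "delta_graph \<equiv> [(0, 1/2), (1, 3/2)]"

lemma period_graphs: "period_graph alpha_graph" "period_graph beta_graph" "period_graph gamma_graph" "period_graph delta_graph"
  by (auto simp: period_graph_def increasing_graph_def)

lemmas alpha_lift = pl_lift_eq_interpolate[OF period_graphs(1)]
lemmas beta_lift = pl_lift_eq_interpolate[OF period_graphs(2)]
lemmas gamma_lift = pl_lift_eq_interpolate[OF period_graphs(3)]
lemma push_pair: "homeo_lift F \<Longrightarrow> circ F ` {pt x, pt y} = {pt (F x), pt (F y)}"
  by (simp add: circ_pt)

lemma pt_representatives: "pt (7/6) = pt (1/6)" "pt (4/3) = pt (1/3)" "pt (-(1/3)) = pt (2/3)" "pt (-(1/12)) = pt (11/12)"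
  using pt_add_one[of "1/6"] pt_add_one[of "1/3"] pt_add_one[of "-(1/3)"] pt_add_one[of "-(1/12)"] by simp_all

lemma alpha_rearr: "alpha \<in> rearrangements"
  unfolding alpha_def
proof (rule pl_circle_in_TB[OF period_graphs(1) small_diagrams(1)])
  have 1: "pl_lift alpha_graph (1/3) = 1/6" "pl_lift alpha_graph (2/3) = 5/6" "pl_lift alpha_graph (1/6) = 1/12"
    "pl_lift alpha_graph (-(1/6)) = -(1/12)" "pl_lift alpha_graph (5/12) = 1/3" "pl_lift alpha_graph (7/12) = 2/3"
    by (subst alpha_lift; simp)+
  have "push (pl_lift alpha_graph) diagram_mid = diagram_opp"
    unfolding push_insert push_pair[OF pl_lift_homeo[OF period_graphs(1)]] 1 pt_minus_sixth[symmetric]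
    by (auto simp: push_def 1)
  then show "arc_diagram (push (pl_lift alpha_graph) diagram_mid)" using small_diagrams by simp
qed (auto simp: pt_representatives)

lemma beta_rearr: "beta \<in> rearrangements"
  unfolding beta_def
proof (rule pl_circle_in_TB[OF period_graphs(2) small_diagrams(4)])
  have 1: "pl_lift beta_graph (1/3) = 5/24" "pl_lift beta_graph (2/3) = 7/24" "pl_lift beta_graph (1/6) = 1/6"
    "pl_lift beta_graph (5/6) = 5/6" "pl_lift beta_graph (17/24) = 1/3" "pl_lift beta_graph (19/24) = 2/3"
    by (subst beta_lift; simp)+
  have "push (pl_lift beta_graph) diagram_right = diagram_left"
    unfolding push_insert push_pair[OF pl_lift_homeo[OF period_graphs(2)]] 1
    by (auto simp: push_def 1)
  then show "arc_diagram (push (pl_lift beta_graph) diagram_right)" using small_diagrams by simp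
qed (auto simp: pt_minus_sixth)

lemma gamma_rearr: "gamma \<in> rearrangements"
  unfolding gamma_def
proof (rule pl_circle_in_TB[OF period_graphs(3) left_diagrams(1)])
  have 1: "pl_lift gamma_graph (1/3) = 1/3" "pl_lift gamma_graph (2/3) = 2/3" "pl_lift gamma_graph (1/6) = 1/6"
    "pl_lift gamma_graph (5/6) = 5/6" "pl_lift gamma_graph (5/24) = 17/96" "pl_lift gamma_graph (7/24) = 19/96"
    "pl_lift gamma_graph (29/96) = 5/24" "pl_lift gamma_graph (31/96) = 7/24"
    by (subst gamma_lift; simp)+
  have "push (pl_lift gamma_graph) diagram_left_right = diagram_left_left"
    unfolding push_insert push_pair[OF pl_lift_homeo[OF period_graphs(3)]] 1
    by (auto simp: push_def 1)
  then show "arc_diagram (push (pl_lift gamma_graph) diagram_left_right)" using left_diagrams by simp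
qed (auto simp: pt_representatives)

text \<open>
  The graph of \<open>\<delta>\<close> breaks at \<open>0\<close>, which is not a vertex of the base diagram; but its lift is a
  translation of the whole line, so \<open>pl_lift_affine\<close> can be bypassed.
\<close>

lemma delta_lift_eq: "pl_lift delta_graph x = x + 1/2"
proof -
  have "0 \<le> x - of_int \<lfloor>x\<rfloor>" "x - of_int \<lfloor>x\<rfloor> < 1" by linarith+
  then show ?thesis unfolding pl_lift_def periodic_extension_def by simp
qed

lemma delta_eq_circ: "delta = circ (\<lambda>x. x + 1/2)"
proof -
  have "pl_lift delta_graph = (\<lambda>x. x + 1/2)" using delta_lift_eq by blast
  then show ?thesis unfolding delta_def pl_circle_eq_circ[OF period_graphs(4)] by simp
qed

lemma delta_rearr: "delta \<in> rearrangements"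
proof -
  have h: "homeo_lift (\<lambda>x. x + 1/2)" by (rule homeo_lift_translate)
  have 1: "pt (1/3 + 1/2) = pt (5/6)" "pt (2/3 + 1/2) = pt (1/6)" "pt (1/6 + 1/2) = pt (2/3)" "pt (5/6 + 1/2) = pt (1/3)"
    using pt_add_one[of "1/6"] pt_add_one[of "1/3"] by simp_all
  have "push (\<lambda>x. x + 1/2) base_diagram = base_diagram"
    unfolding push_insert push_pair[OF h] 1 by (auto simp: push_def)
  moreover have "affine_on (\<lambda>x. x + 1/2) a b" for a b unfolding affine_on_def by (intro exI[of _ 1] exI[of _ "1/2"]) simp
  ultimately have "rearr (\<lambda>x. x + 1/2) base_diagram" unfolding rearr_def using h arc_diagram.base by simp
  then show ?thesis unfolding delta_eq_circ by blast
qed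

section \<open>Intervals that are equivalent under the generated group\<close>

abbreviation TB_gens :: "(complex \<Rightarrow> complex) set" where
  "TB_gens \<equiv> {alpha, beta, gamma, delta}"

definition gen_lift :: "(real \<Rightarrow> real) \<Rightarrow> bool" where
  "gen_lift F \<longleftrightarrow> homeo_lift F \<and> circ F \<in> generate (BijGroup S1) TB_gens"

lemma gens_subset_carrier: "TB_gens \<subseteq> carrier (BijGroup S1)"
  using alpha_rearr beta_rearr gamma_rearr delta_rearr subgroup.subset[OF rearr_subgroup] by blast

lemma gen_lift_homeo: "gen_lift F \<Longrightarrow> homeo_lift F"
  unfolding gen_lift_def by blast

lemma gen_lift_comp: "gen_lift F \<Longrightarrow> gen_lift G \<Longrightarrow> gen_lift (F \<circ> G)"
  unfolding gen_lift_def using homeo_lift_comp circ_mult generate.eng by metis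

lemma gen_lift_inv: "gen_lift F \<Longrightarrow> gen_lift (the_inv F)"
  unfolding gen_lift_def
  using homeo_lift_inv circ_inv group.generate_m_inv_closed[OF group_BijGroup gens_subset_carrier] by metis

lemma gen_lift_translate: "gen_lift (\<lambda>x. x + of_int k)"
proof -
  have "circ (\<lambda>x. x) = circ (\<lambda>x. x + of_int k)"
    by (rule circ_eqI) (simp_all add: homeo_lift_translate circ_pt[OF homeo_lift_id])
  then show ?thesis unfolding gen_lift_def using homeo_lift_translate generate.one[of "BijGroup S1" TB_gens] circ_one by metis
qed

lemma gen_lift_id: "gen_lift (\<lambda>x. x)"
  using gen_lift_translate[of 0] by simp

definition "lift_alpha = pl_lift alpha_graph"
definition "lift_beta = pl_lift beta_graph"
definition "lift_gamma = pl_lift gamma_graph"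

lemma generators_eq_circ: "alpha = circ lift_alpha" "beta = circ lift_beta" "gamma = circ lift_gamma"
  unfolding alpha_def beta_def gamma_def lift_alpha_def lift_beta_def lift_gamma_def
  by (rule pl_circle_eq_circ, rule period_graphs)+

lemma generator_lift_homeo: "homeo_lift lift_alpha" "homeo_lift lift_beta" "homeo_lift lift_gamma"
  unfolding lift_alpha_def lift_beta_def lift_gamma_def by (rule pl_lift_homeo, rule period_graphs)+

lemma gen_lift_alpha: "gen_lift lift_alpha" and gen_lift_beta: "gen_lift lift_beta" and gen_lift_gamma: "gen_lift lift_gamma"
  unfolding gen_lift_def generators_eq_circ[symmetric]
  using generator_lift_homeo generate.incl[of _ TB_gens "BijGroup S1"] by auto

lemma gen_lift_half: "gen_lift (\<lambda>x. x + 1/2)"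
  unfolding gen_lift_def delta_eq_circ[symmetric] using homeo_lift_translate generate.incl[of delta TB_gens "BijGroup S1"] by simp

lemma gen_lift_minus_half: "gen_lift (\<lambda>x. x - 1/2)"
proof -
  have "(\<lambda>x. x + of_int (-1)) \<circ> (\<lambda>x. x + 1/2) = (\<lambda>x. x - 1/2 :: real)" by auto
  then show ?thesis using gen_lift_comp[OF gen_lift_translate[of "-1"] gen_lift_half] by simp
qed

lemma affine_on_shift: "affine_on (\<lambda>x. x + c) a b" "affine_on (\<lambda>x. x - c) a b" "affine_on (\<lambda>x. x) a b"
  unfolding affine_on_def by (rule exI[of _ 1], force)+

lemma gen_affine_comp:
  assumes "gen_lift F" "gen_lift G" "affine_on F a b" "affine_on G (F a) (F b)"
  shows "gen_lift (G \<circ> F)" "affine_on (G \<circ> F) a b"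
  using assms gen_lift_comp affine_on_comp homeo_lift_mono_on[OF gen_lift_homeo] by auto

definition model :: "real \<Rightarrow> real \<Rightarrow> bool" where
  "model a b \<longleftrightarrow> (a = 1/3 \<and> b = 2/3) \<or> (a = 1/6 \<and> b = 1/3)"

text \<open>
  The generated group carries \<open>[a, b]\<close> affinely onto a model interval. By \<open>model_children\<close>, middle
  parts of subdivided intervals are carried to the model \<open>[1/3, 2/3]\<close> and outer parts to the model
  \<open>[1/6, 1/3]\<close>.
\<close>

definition modelled :: "real \<Rightarrow> real \<Rightarrow> bool" where
  "modelled a b \<longleftrightarrow> (\<exists>F. gen_lift F \<and> affine_on F a b \<and> model (F a) (F b))"

lemma modelled_less: "modelled a b \<Longrightarrow> a < b"
proof -
  assume "modelled a b"
  then obtain F where F: "gen_lift F" "model (F a) (F b)" unfolding modelled_def by blast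
  then have "F a < F b" unfolding model_def by auto
  then show "a < b" using homeo_lift_less[OF gen_lift_homeo[OF F(1)]] by blast
qed

lemma modelled_transport:
  assumes "gen_lift F" "affine_on F a b" "modelled (F a) (F b)" shows "modelled a b"
proof -
  obtain G where "gen_lift G" "affine_on G (F a) (F b)" "model (G (F a)) (G (F b))" using assms(3) unfolding modelled_def by blast
  then show ?thesis unfolding modelled_def using gen_affine_comp[OF assms(1) _ assms(2)] by (intro exI[of _ "G \<circ> F"]) auto
qed

lemma modelled_transport_inv:
  assumes "gen_lift F" "affine_on F a b" "a < b" "modelled a b" shows "modelled (F a) (F b)"
  using modelled_transport[OF gen_lift_inv[OF assms(1)] affine_on_inv[OF gen_lift_homeo[OF assms(1)] assms(2,3)]]
    homeo_lift_inv_f[OF gen_lift_homeo[OF assms(1)]] assms(4) by simp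

lemma model_good: "model a b \<Longrightarrow> modelled a b"
  unfolding modelled_def using gen_lift_id affine_on_shift(3) by blast

lemma pl_alpha_values: "lift_alpha (1/3) = 1/6" "lift_alpha (2/3) = 5/6"
  "lift_alpha (5/12) = 1/3" "lift_alpha (7/12) = 2/3"
  unfolding lift_alpha_def by (subst alpha_lift; simp)+

lemma pl_beta_values: "lift_beta (1/6) = 1/6" "lift_beta (1/3) = 5/24" "lift_beta (2/3) = 7/24"
  "lift_beta (17/24) = 1/3" "lift_beta (5/6) = 5/6"
  unfolding lift_beta_def by (subst beta_lift; simp)+

lemma pl_gamma_values: "lift_gamma (1/6) = 1/6" "lift_gamma (7/24) = 19/96"
  "lift_gamma (29/96) = 5/24" "lift_gamma (1/3) = 1/3"
  unfolding lift_gamma_def by (subst gamma_lift; simp)+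

lemma pl_lift_affine_piece:
  assumes "period_graph ps" "fst (hd ps) \<le> u" "u < v" "v \<le> fst (hd ps) + 1"
    "\<And>p. p \<in> set ps \<Longrightarrow> \<not> (u < fst p \<and> fst p < v)"
  shows "affine_on (pl_lift ps) u v"
proof -
  have ig: "increasing_graph ps" and e: "fst (last ps) = fst (hd ps) + 1" using assms(1) unfolding period_graph_def by auto
  have "affine_on (interpolate ps) u v" using interpolate_props(6)[OF ig] assms e by metis
  moreover have "pl_lift ps x = interpolate ps x" if "u \<le> x" "x \<le> v" for x
    using pl_lift_eq_interpolate[OF assms(1)] that assms(2,4) by simp
  ultimately show ?thesis using affine_on_cong[of u v "pl_lift ps" "interpolate ps"] by simp
qed

lemma alpha_affine: "affine_on (lift_alpha) (1/3) (2/3)"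
  unfolding lift_alpha_def by (rule pl_lift_affine_piece[OF period_graphs(1)]) auto

lemma beta_affine: "affine_on (lift_beta) (1/6) (2/3)" "affine_on (lift_beta) (2/3) (17/24)"
    "affine_on (lift_beta) (17/24) (5/6)"
  unfolding lift_beta_def by (rule pl_lift_affine_piece[OF period_graphs(2)]; auto)+

lemma gamma_affine: "affine_on (lift_gamma) (1/6) (7/24)" "affine_on (lift_gamma) (7/24) (29/96)"
    "affine_on (lift_gamma) (29/96) (1/3)"
  unfolding lift_gamma_def by (rule pl_lift_affine_piece[OF period_graphs(3)]; auto)+

lemma modelled_right_half: "modelled (2/3) (5/6)"
  using modelled_transport[OF gen_lift_minus_half affine_on_shift(2)] model_good[of "1/6" "1/3"] by (simp add: model_def)

lemma modelled_beta:
  assumes "affine_on (lift_beta) a b" "a < b" "modelled a b"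
  shows "modelled (lift_beta a) (lift_beta b)"
  using modelled_transport_inv[OF gen_lift_beta assms] .

lemma modelled_left_left: "modelled (1/6) (5/24)"
proof -
  have "modelled (lift_beta (1/6)) (lift_beta (1/3))"
    by (rule modelled_beta) (use affine_on_subset[OF beta_affine(1), of "1/6" "1/3"] model_good[of "1/6" "1/3"] in \<open>auto simp: model_def\<close>)
  then show ?thesis unfolding pl_beta_values .
qed

definition mid_lift :: "(real \<Rightarrow> real) \<Rightarrow> real \<Rightarrow> real \<Rightarrow> bool" where
  "mid_lift F a b \<longleftrightarrow> gen_lift F \<and> affine_on F a b \<and> F a = 1/3 \<and> F b = 2/3"

lemma mid_lift_good: "mid_lift F a b \<Longrightarrow> modelled a b"
  unfolding mid_lift_def modelled_def model_def by blast

text \<open>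
  The map \<open>\<alpha>\<close> stretches \<open>[1/3, 2/3]\<close> onto \<open>[1/6, 5/6]\<close>, whose three parts are the models and the half
  turn \<open>[2/3, 5/6]\<close> of \<open>[1/6, 1/3]\<close>. The inverse of \<open>\<beta>\<close> stretches the left and middle parts of
  \<open>[1/6, 1/3]\<close> onto the models, and translates its right part onto the left part of \<open>[2/3, 5/6]\<close>, which
  is the half turn of the left part of \<open>[1/6, 1/3]\<close>.
\<close>

lemma model_children:
  assumes "model a b"
  shows "modelled a (a + (b - a)/4)" "\<exists>F. mid_lift F (a + (b - a)/4) (b - (b - a)/4)" "modelled (b - (b - a)/4) b"
proof -
  have "modelled a (a + (b - a)/4) \<and> (\<exists>F. mid_lift F (a + (b - a)/4) (b - (b - a)/4)) \<and> modelled (b - (b - a)/4) b"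
    using assms unfolding model_def
  proof
    assume ab: "a = 1/3 \<and> b = 2/3"
    have "modelled (1/3) (5/12)"
      by (rule modelled_transport[OF gen_lift_alpha affine_on_subset[OF alpha_affine]])
         (use model_good[of "1/6" "1/3"] in \<open>simp_all add: pl_alpha_values model_def\<close>)
    moreover have "mid_lift (lift_alpha) (5/12) (7/12)"
      unfolding mid_lift_def using gen_lift_alpha affine_on_subset[OF alpha_affine, of "5/12" "7/12"] by (simp add: pl_alpha_values)
    moreover have "modelled (7/12) (2/3)"
      by (rule modelled_transport[OF gen_lift_alpha affine_on_subset[OF alpha_affine]])
         (use modelled_right_half in \<open>simp_all add: pl_alpha_values\<close>)
    moreover have e3: "a = 1/3" "b = 2/3" using ab by blast+
    then have e: "a + (b - a)/4 = 5/12" "b - (b - a)/4 = 7/12" unfolding e3 by simp_all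
    ultimately show ?thesis unfolding e unfolding e3 by blast
  next
    assume ab: "a = 1/6 \<and> b = 1/3"
    let ?B = "the_inv (lift_beta)"
    have inv: "?B (5/24) = 1/3" "?B (7/24) = 2/3"
      using homeo_lift_inv_f[OF gen_lift_homeo[OF gen_lift_beta], of "1/3"]
        homeo_lift_inv_f[OF gen_lift_homeo[OF gen_lift_beta], of "2/3"] by (simp_all only: pl_beta_values)
    have "affine_on ?B (5/24) (7/24)"
      using affine_on_inv[OF gen_lift_homeo[OF gen_lift_beta] affine_on_subset[OF beta_affine(1), of "1/3" "2/3"]]
      by (simp add: pl_beta_values)
    then have "mid_lift ?B (5/24) (7/24)" unfolding mid_lift_def using gen_lift_inv[OF gen_lift_beta] inv by simp
    moreover have "modelled (2/3) (17/24)"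
      using modelled_transport[OF gen_lift_minus_half affine_on_shift(2), of "2/3" "17/24"] modelled_left_left by simp
    then have "modelled (7/24) (1/3)" using modelled_beta[OF beta_affine(2)] by (simp add: pl_beta_values)
    moreover have e3: "a = 1/6" "b = 1/3" using ab by blast+
    then have e: "a + (b - a)/4 = 5/24" "b - (b - a)/4 = 7/24" unfolding e3 by simp_all
    ultimately show ?thesis using modelled_left_left unfolding e unfolding e3 by blast
  qed
  then show "modelled a (a + (b - a)/4)" "\<exists>F. mid_lift F (a + (b - a)/4) (b - (b - a)/4)" "modelled (b - (b - a)/4) b" by auto
qed

lemma affine_quarters:
  assumes "affine_on F a b" "a < b"
  shows "F (a + (b - a)/4) = F a + (F b - F a)/4" "F (b - (b - a)/4) = F b - (F b - F a)/4"
proof -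
  have "a + (b - a)/4 = a + (1/4) * (b - a)" "b - (b - a)/4 = a + (3/4) * (b - a)" by (auto simp: field_simps)
  then show "F (a + (b - a)/4) = F a + (F b - F a)/4" "F (b - (b - a)/4) = F b - (F b - F a)/4"
    using affine_on_param[OF assms(1), of "1/4"] affine_on_param[OF assms(1), of "3/4"] assms(2)
    by (simp_all add: field_simps)
qed

lemma modelled_children:
  assumes "modelled a b"
  shows "modelled a (a + (b - a)/4)" "\<exists>F. mid_lift F (a + (b - a)/4) (b - (b - a)/4)" "modelled (b - (b - a)/4) b"
proof -
  obtain F where F: "gen_lift F" "affine_on F a b" "model (F a) (F b)" using assms unfolding modelled_def by blast
  have ab: "a < b" using modelled_less[OF assms] .
  note q = affine_quarters[OF F(2) ab]
  have aff: "affine_on F u v" if "a \<le> u" "v \<le> b" for u v using affine_on_subset[OF F(2) that] .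
  have "affine_on F a (a + (b - a)/4)" "affine_on F (b - (b - a)/4) b" 
  proof -
    have le: "a + (b - a)/4 \<le> b" "a \<le> b - (b - a)/4" using ab by (simp_all add: field_simps)
    show "affine_on F a (a + (b - a)/4)" "affine_on F (b - (b - a)/4) b"
      using aff[OF order_refl le(1)] aff[OF le(2) order_refl] by auto
  qed
  then show "modelled a (a + (b - a)/4)" "modelled (b - (b - a)/4) b"
    using modelled_transport[OF F(1)] model_children[OF F(3)] q by metis+
  obtain E where E: "mid_lift E (F a + (F b - F a)/4) (F b - (F b - F a)/4)" using model_children(2)[OF F(3)] by blast
  have "affine_on F (a + (b - a)/4) (b - (b - a)/4)" by (rule aff) (use ab in auto)
  then have "mid_lift (E \<circ> F) (a + (b - a)/4) (b - (b - a)/4)"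
    using E gen_affine_comp[OF F(1), of E] unfolding mid_lift_def by (simp add: q)
  then show "\<exists>F. mid_lift F (a + (b - a)/4) (b - (b - a)/4)" by blast
qed

lemma modelled_middle: "modelled a b \<Longrightarrow> modelled (a + (b - a)/4) (b - (b - a)/4)"
  using modelled_children(2) mid_lift_good by blast

section \<open>Rotations\<close>

text \<open>
  In an interval whose left part is subdivided too, a rotation sends the five pieces, of lengths
  \<open>1:2:1:8:4\<close>, to the five pieces of an interval whose right part is subdivided, of lengths
  \<open>4:8:1:2:1\<close>. It moves the primary arc of the left part to the primary arc of the interval, like a
  rotation of a binary tree. On \<open>[1/6, 5/6]\<close> this is the inverse of \<open>\<beta>\<close>, on \<open>[1/6, 1/3]\<close> that of \<open>\<gamma>\<close>.
\<close>

definition rotation :: "(real \<Rightarrow> real) \<Rightarrow> real \<Rightarrow> real \<Rightarrow> bool" where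
  "rotation S a b \<longleftrightarrow> gen_lift S \<and> S a = a \<and> S b = b \<and> (\<forall>x. b \<le> x \<longrightarrow> x \<le> a + 1 \<longrightarrow> S x = x) \<and>
     S (a + 3/16 * (b - a)) = a + 3/4 * (b - a) \<and> S (a + 1/4 * (b - a)) = a + 13/16 * (b - a) \<and>
     affine_on S a (a + 3/16 * (b - a)) \<and> affine_on S (a + 3/16 * (b - a)) (a + 1/4 * (b - a)) \<and>
     affine_on S (a + 1/4 * (b - a)) b"

lemma rotation_transport:
  assumes F: "gen_lift F" "affine_on F a b" "a < b" and S: "rotation S (F a) (F b)"
  shows "rotation (the_inv F \<circ> S \<circ> F) a b"
proof -
  have hF: "homeo_lift F" using gen_lift_homeo[OF F(1)] .
  have hS: "homeo_lift S" using S gen_lift_homeo unfolding rotation_def by blast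
  define L where "L = F b - F a"
  have par: "F (a + t * (b - a)) = F a + t * L" if "0 \<le> t" "t \<le> 1" for t
    using affine_on_param[OF F(2) that] F(3) unfolding L_def by simp
  have inv: "the_inv F (F a + t * L) = a + t * (b - a)" if "0 \<le> t" "t \<le> 1" for t
    using par[OF that] homeo_lift_inv_f[OF hF] by metis
  let ?S = "the_inv F \<circ> S \<circ> F"
  have S': "S (F a) = F a" "S (F b) = F b" "\<And>x. F b \<le> x \<Longrightarrow> x \<le> F a + 1 \<Longrightarrow> S x = x"
     "S (F a + 3/16 * L) = F a + 3/4 * L" "S (F a + 1/4 * L) = F a + 13/16 * L"
     "affine_on S (F a) (F a + 3/16 * L)" "affine_on S (F a + 3/16 * L) (F a + 1/4 * L)"
     "affine_on S (F a + 1/4 * L) (F b)" "gen_lift S"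
    using S unfolding rotation_def L_def by auto
  have L0: "0 < L" using homeo_lift_less[OF hF] F(3) unfolding L_def by simp
  have Fb: "F b = F a + 1 * L" by (simp add: L_def)
  have ainv: "affine_on (the_inv F) (F a) (F b)" using affine_on_inv[OF hF F(2,3)] .
  have aff: "affine_on ?S (a + s * (b - a)) (a + t * (b - a))"
    if st: "0 \<le> s" "s \<le> t" "t \<le> 1" and A: "affine_on S (F a + s * L) (F a + t * L)" for s t
  proof -
    have "t * (b - a) \<le> 1 * (b - a)" using st F(3) by (intro mult_right_mono) auto
    then have "a + t * (b - a) \<le> a + 1 * (b - a)" by (rule add_left_mono)
    also have "\<dots> = b" by simp
    finally have le2: "a + t * (b - a) \<le> b" .
    have le1: "a \<le> a + s * (b - a)" using st F(3) by simp
    note le = le1 le2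
    have "affine_on F (a + s * (b - a)) (a + t * (b - a))" using affine_on_subset[OF F(2) le] .
    moreover have "affine_on S (F (a + s * (b - a))) (F (a + t * (b - a)))" using A par[of s] par[of t] st by simp
    ultimately have 1: "affine_on (S \<circ> F) (a + s * (b - a)) (a + t * (b - a))"
      using affine_on_comp homeo_lift_mono_on[OF hF] by blast
    have "F a \<le> (S \<circ> F) (a + s * (b - a))" "(S \<circ> F) (a + t * (b - a)) \<le> F b"
      using le homeo_lift_le[OF hF] homeo_lift_le[OF hS] S'(1,2) by (metis comp_apply)+
    then have "affine_on (the_inv F) ((S \<circ> F) (a + s * (b - a))) ((S \<circ> F) (a + t * (b - a)))"
      using affine_on_subset[OF ainv] by blast
    then show ?thesis
      using affine_on_comp[OF 1 _ homeo_lift_mono_on[OF homeo_lift_comp[OF hS hF]]] by (simp add: o_assoc)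
  qed
  have "gen_lift ?S" using gen_lift_comp gen_lift_inv S'(9) F(1) by blast
  moreover have "?S a = a" "?S b = b" using S' homeo_lift_inv_f[OF hF] by auto
  moreover have "?S x = x" if "b \<le> x" "x \<le> a + 1" for x
  proof -
    have "F b \<le> F x" "F x \<le> F a + 1" using that homeo_lift_le[OF hF] homeo_lift_add_one[OF hF] by metis+
    then show ?thesis using S'(3) homeo_lift_inv_f[OF hF] by simp
  qed
  moreover have "?S (a + 3/16 * (b - a)) = a + 3/4 * (b - a)" "?S (a + 1/4 * (b - a)) = a + 13/16 * (b - a)"
    using par[of "3/16"] par[of "1/4"] S'(4,5) inv[of "3/4"] inv[of "13/16"] by simp_all
  moreover have "affine_on ?S a (a + 3/16 * (b - a))" using aff[of 0 "3/16"] S'(6) by simp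
  moreover have "affine_on ?S (a + 3/16 * (b - a)) (a + 1/4 * (b - a))" using aff[of "3/16" "1/4"] S'(7) by simp
  moreover have "affine_on ?S (a + 1/4 * (b - a)) b" using aff[of "1/4" 1] S'(8) Fb by simp
  ultimately show ?thesis unfolding rotation_def by blast
qed

lemma rotation_beta: "rotation (the_inv (lift_beta)) (1/6) (5/6)"
proof -
  let ?B = "lift_beta"
  have h: "homeo_lift ?B" using gen_lift_homeo[OF gen_lift_beta] .
  have v: "the_inv ?B (1/6) = 1/6" "the_inv ?B (7/24) = 2/3" "the_inv ?B (1/3) = 17/24" "the_inv ?B (5/6) = 5/6"
    using homeo_lift_inv_f[OF h, of "1/6"] homeo_lift_inv_f[OF h, of "2/3"] homeo_lift_inv_f[OF h, of "17/24"]
      homeo_lift_inv_f[OF h, of "5/6"] by (simp_all only: pl_beta_values)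
  have "affine_on (the_inv ?B) (1/6) (7/24)" "affine_on (the_inv ?B) (7/24) (1/3)" "affine_on (the_inv ?B) (1/3) (5/6)"
    using affine_on_inv[OF h beta_affine(1)] affine_on_inv[OF h beta_affine(2)] affine_on_inv[OF h beta_affine(3)]
    by (simp_all add: pl_beta_values)
  moreover have "the_inv ?B x = x" if "5/6 \<le> x" "x \<le> 7/6" for x
  proof -
    have "?B (x - 1) = x - 1" unfolding lift_beta_def by (subst beta_lift) (use that in simp_all)
    then have "?B x = x" using homeo_lift_add_one[OF h, of "x - 1"] by simp
    then show ?thesis using homeo_lift_inv_f[OF h, of x] by simp
  qed
  ultimately show ?thesis unfolding rotation_def using gen_lift_inv[OF gen_lift_beta] v by simp
qed

lemma rotation_gamma: "rotation (the_inv (lift_gamma)) (1/6) (1/3)"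
proof -
  let ?B = "lift_gamma"
  have h: "homeo_lift ?B" using gen_lift_homeo[OF gen_lift_gamma] .
  have v: "the_inv ?B (1/6) = 1/6" "the_inv ?B (19/96) = 7/24" "the_inv ?B (5/24) = 29/96" "the_inv ?B (1/3) = 1/3"
    using homeo_lift_inv_f[OF h, of "1/6"] homeo_lift_inv_f[OF h, of "7/24"] homeo_lift_inv_f[OF h, of "29/96"]
      homeo_lift_inv_f[OF h, of "1/3"] by (simp_all only: pl_gamma_values)
  have "affine_on (the_inv ?B) (1/6) (19/96)" "affine_on (the_inv ?B) (19/96) (5/24)" "affine_on (the_inv ?B) (5/24) (1/3)"
    using affine_on_inv[OF h gamma_affine(1)] affine_on_inv[OF h gamma_affine(2)] affine_on_inv[OF h gamma_affine(3)]
    by (simp_all add: pl_gamma_values)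
  moreover have "the_inv ?B x = x" if "1/3 \<le> x" "x \<le> 7/6" for x
  proof -
    have "?B x = x"
    proof (cases "x = 1/3")
      case True show ?thesis unfolding True by (rule pl_gamma_values)
    next
      case False
      then show ?thesis unfolding lift_gamma_def by (subst gamma_lift) (use that in simp_all)
    qed
    then show ?thesis using homeo_lift_inv_f[OF h, of x] by simp
  qed
  ultimately show ?thesis unfolding rotation_def using gen_lift_inv[OF gen_lift_gamma] v by simp
qed

lemma rotation_exists: assumes "modelled a b" obtains S where "rotation S a b"
proof -
  obtain F where F: "gen_lift F" "affine_on F a b" "model (F a) (F b)" using assms unfolding modelled_def by blast
  have ab: "a < b" using modelled_less[OF assms] .
  have "\<exists>S. rotation S (F a) (F b)"
    using F(3) unfolding model_def
  proof
    assume *: "F a = 1/3 \<and> F b = 2/3"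
    have "rotation (the_inv (lift_alpha) \<circ> the_inv (lift_beta) \<circ> lift_alpha) (1/3) (2/3)"
      by (rule rotation_transport[OF gen_lift_alpha alpha_affine]) (simp, simp only: pl_alpha_values rotation_beta)
    then show ?thesis using * by metis
  next
    assume "F a = 1/6 \<and> F b = 1/3"
    then show ?thesis using rotation_gamma by metis
  qed
  then show ?thesis using rotation_transport[OF F(1,2) ab] that by blast
qed

section \<open>Subdivisions of an interval\<close>

text \<open>
  A ternary tree of intervals, recorded by the pairs of ends of the primary arcs at its inner nodes.
\<close>

inductive subdiv :: "real \<Rightarrow> real \<Rightarrow> (real \<times> real) set \<Rightarrow> bool" where
  empty: "a < b \<Longrightarrow> subdiv a b {}"
| node: "subdiv a (a + (b - a)/4) X \<Longrightarrow> subdiv (a + (b - a)/4) (b - (b - a)/4) Y \<Longrightarrow>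
    subdiv (b - (b - a)/4) b Z \<Longrightarrow> subdiv a b (insert (a + (b - a)/4, b - (b - a)/4) (X \<union> Y \<union> Z))"

lemma subdiv_nodeI:
  assumes "subdiv a s X" "subdiv s t Y" "subdiv t b Z" "s = a + (b - a)/4" "t = b - (b - a)/4"
  shows "subdiv a b (insert (s, t) (X \<union> Y \<union> Z))"
  using subdiv.node[of a b X Y Z] assms by simp

lemma subdiv_less: "subdiv a b X \<Longrightarrow> a < b"
  by (induction rule: subdiv.induct) auto

lemma subdiv_range: "subdiv a b X \<Longrightarrow> (p, q) \<in> X \<Longrightarrow> a < p \<and> p < q \<and> q < b"
proof (induction arbitrary: p q rule: subdiv.induct)
  case (node a b X Y Z)
  have less: "a < a + (b - a)/4" "a + (b - a)/4 < b - (b - a)/4" "b - (b - a)/4 < b"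
    using subdiv_less[OF node.hyps(1)] subdiv_less[OF node.hyps(2)] subdiv_less[OF node.hyps(3)] by auto
  consider "p = a + (b - a)/4" "q = b - (b - a)/4" | "(p, q) \<in> X" | "(p, q) \<in> Y" | "(p, q) \<in> Z"
    using node.prems by auto
  then show ?case
  proof cases
    case 1 then show ?thesis using less by simp
  next
    case 2 show ?thesis using node.IH(1)[OF 2] less by linarith
  next
    case 3 show ?thesis using node.IH(2)[OF 3] less by linarith
  next
    case 4 show ?thesis using node.IH(3)[OF 4] less by linarith
  qed
qed simp

lemma subdiv_nodeE:
  assumes "subdiv a b W" "(a + (b - a)/4, b - (b - a)/4) \<in> W"
  obtains X Y Z where "W = insert (a + (b - a)/4, b - (b - a)/4) (X \<union> Y \<union> Z)"
    "subdiv a (a + (b - a)/4) X" "subdiv (a + (b - a)/4) (b - (b - a)/4) Y" "subdiv (b - (b - a)/4) b Z"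
  using assms by (cases rule: subdiv.cases) auto

abbreviation act :: "(real \<Rightarrow> real) \<Rightarrow> (real \<times> real) set \<Rightarrow> (real \<times> real) set" where
  "act F X \<equiv> map_prod F F ` X"

lemma act_comp: "act G (act F X) = act (G \<circ> F) X"
  by (simp add: image_image map_prod_def case_prod_beta o_def)

lemma act_id_on: "(\<And>p q. (p, q) \<in> X \<Longrightarrow> F p = p \<and> F q = q) \<Longrightarrow> act F X = X"
  by (force simp: image_iff)

lemma subdiv_affine_image:
  assumes "subdiv a b X" "affine_on F a b" "F a < F b"
  shows "subdiv (F a) (F b) (act F X)"
  using assms
proof (induction rule: subdiv.induct)
  case (empty a b) then show ?case using subdiv.empty by simp
next
  case (node a b X Y Z)
  define s where "s = a + (b - a)/4"
  define t where "t = b - (b - a)/4"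
  have ab: "a < s" "s < t" "t < b"
    using subdiv_less[OF node.hyps(1)] subdiv_less[OF node.hyps(2)] subdiv_less[OF node.hyps(3)] by (auto simp: s_def t_def)
  note q = affine_quarters[OF node.prems(1) less_trans[OF less_trans[OF ab(1,2)] ab(3)], folded s_def t_def]
  have lt: "F a < F s" "F s < F t" "F t < F b" using q node.prems(2) by (simp_all add: field_simps)
  have aff: "affine_on F a s" "affine_on F s t" "affine_on F t b" using affine_on_subset[OF node.prems(1)] ab by auto
  show ?case
    using subdiv_nodeI[OF node.IH(1)[folded s_def, OF aff(1) lt(1)] node.IH(2)[folded s_def t_def, OF aff(2) lt(2)]
        node.IH(3)[folded t_def, OF aff(3) lt(3)] q]
    by (simp add: s_def[symmetric] t_def[symmetric] image_Un)
qed

definition points :: "real \<Rightarrow> real \<Rightarrow> (real \<times> real) set \<Rightarrow> real set" where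
  "points a b X = {a, b} \<union> fst ` X \<union> snd ` X"

text \<open>
  The leaves of the tree, as intervals between consecutive points.
\<close>

definition gap :: "real \<Rightarrow> real \<Rightarrow> (real \<times> real) set \<Rightarrow> real \<Rightarrow> real \<Rightarrow> bool" where
  "gap a b X x y \<longleftrightarrow> x \<in> points a b X \<and> y \<in> points a b X \<and> x < y \<and> (\<forall>z\<in>points a b X. \<not> (x < z \<and> z < y))"

definition gap_affine :: "(real \<Rightarrow> real) \<Rightarrow> real \<Rightarrow> real \<Rightarrow> (real \<times> real) set \<Rightarrow> bool" where
  "gap_affine F a b X \<longleftrightarrow> (\<forall>x y. gap a b X x y \<longrightarrow> affine_on F x y)"

lemma points_range: "subdiv a b X \<Longrightarrow> x \<in> points a b X \<Longrightarrow> a \<le> x \<and> x \<le> b"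
  using subdiv_range[of a b X] subdiv_less[of a b X] unfolding points_def by fastforce

lemma points_insert: "points a b (insert (s, t) (X \<union> Y \<union> Z)) = points a s X \<union> points s t Y \<union> points t b Z"
  unfolding points_def by auto

lemma gap_avoid: "gap a b X x y \<Longrightarrow> c \<in> points a b X \<Longrightarrow> y \<le> c \<or> c \<le> x"
  unfolding gap_def by (meson not_le)

abbreviation node_set :: "real \<Rightarrow> real \<Rightarrow> (real \<times> real) set \<Rightarrow> (real \<times> real) set \<Rightarrow> (real \<times> real) set \<Rightarrow> (real \<times> real) set"
  where "node_set s t X Y Z \<equiv> insert (s, t) (X \<union> Y \<union> Z)"

context
  fixes a b s t X Y Z
  assumes X: "subdiv a s X" and Y: "subdiv s t Y" and Z: "subdiv t b Z"
begin

lemma node_points_cases: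
  assumes "x \<in> points a b (node_set s t X Y Z)"
  shows "(x \<le> s \<longleftrightarrow> x \<in> points a s X)" "(s \<le> x \<and> x \<le> t \<longleftrightarrow> x \<in> points s t Y)" "(t \<le> x \<longleftrightarrow> x \<in> points t b Z)"
proof -
  have e: "s \<in> points a s X" "s \<in> points s t Y" "t \<in> points s t Y" "t \<in> points t b Z" unfolding points_def by auto
  have "s < t" "a < s" "t < b" using X Y Z subdiv_less by auto
  consider "x \<in> points a s X" | "x \<in> points s t Y" | "x \<in> points t b Z" using assms unfolding points_insert by blast
  note c = this
  show "(x \<le> s \<longleftrightarrow> x \<in> points a s X)"
    using c points_range[OF X, of x] points_range[OF Y, of x] points_range[OF Z, of x] e \<open>s < t\<close>
    by (metis order_antisym not_le order_trans)
  show "(s \<le> x \<and> x \<le> t \<longleftrightarrow> x \<in> points s t Y)"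
    using c points_range[OF X, of x] points_range[OF Y, of x] points_range[OF Z, of x] e \<open>s < t\<close>
    by (metis order_antisym)
  show "(t \<le> x \<longleftrightarrow> x \<in> points t b Z)"
    using c points_range[OF X, of x] points_range[OF Y, of x] points_range[OF Z, of x] e \<open>s < t\<close>
    by (metis order_antisym not_le order_trans)
qed

lemma node_gap_split:
  assumes "gap a b (node_set s t X Y Z) x y"
  shows "gap a s X x y \<or> gap s t Y x y \<or> gap t b Z x y"
proof -
  have st: "s \<in> points a b (node_set s t X Y Z)" "t \<in> points a b (node_set s t X Y Z)" unfolding points_def by auto
  have sub: "points a s X \<subseteq> points a b (node_set s t X Y Z)" "points s t Y \<subseteq> points a b (node_set s t X Y Z)" "points t b Z \<subseteq> points a b (node_set s t X Y Z)"
    unfolding points_insert by auto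
  have xy: "x \<in> points a b (node_set s t X Y Z)" "y \<in> points a b (node_set s t X Y Z)" "x < y" using assms unfolding gap_def by auto
  consider "y \<le> s" | "s \<le> x" "y \<le> t" | "t \<le> x" using gap_avoid[OF assms st(1)] gap_avoid[OF assms st(2)] by blast
  then show ?thesis
  proof cases
    case 1
    then have "x \<le> s" using xy by simp
    then have "x \<in> points a s X" "y \<in> points a s X" using 1 node_points_cases(1)[OF xy(1)] node_points_cases(1)[OF xy(2)] \<open>x \<le> s\<close> by blast+
    then show ?thesis using assms sub unfolding gap_def by blast
  next
    case 2
    then have "x \<le> t" "s \<le> y" using xy by simp_all
    then have "x \<in> points s t Y" "y \<in> points s t Y" using 2 node_points_cases(2)[OF xy(1)] node_points_cases(2)[OF xy(2)] \<open>x \<le> t\<close> \<open>s \<le> y\<close> by blast+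
    then show ?thesis using assms sub unfolding gap_def by blast
  next
    case 3
    then have "t \<le> y" using xy by simp
    then have "x \<in> points t b Z" "y \<in> points t b Z" using 3 node_points_cases(3)[OF xy(1)] node_points_cases(3)[OF xy(2)] \<open>t \<le> y\<close> by blast+
    then show ?thesis using assms sub unfolding gap_def by blast
  qed
qed

lemma node_gap_lift:
  assumes "gap a s X x y \<or> gap s t Y x y \<or> gap t b Z x y" shows "gap a b (node_set s t X Y Z) x y"
proof -
  have sub: "points a s X \<subseteq> points a b (node_set s t X Y Z)" "points s t Y \<subseteq> points a b (node_set s t X Y Z)" "points t b Z \<subseteq> points a b (node_set s t X Y Z)"
    unfolding points_insert by auto
  have "\<not> (x < z \<and> z < y)" if z: "z \<in> points a b (node_set s t X Y Z)" for z
    using assms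
  proof (elim disjE)
    assume g: "gap a s X x y"
    then have "y \<le> s" using points_range[OF X] unfolding gap_def by blast
    then show ?thesis using g node_points_cases(1)[OF z] unfolding gap_def by (meson less_imp_le less_le_trans)
  next
    assume g: "gap s t Y x y"
    then have "s \<le> x" "y \<le> t" using points_range[OF Y] unfolding gap_def by blast+
    then show ?thesis using g node_points_cases(2)[OF z] unfolding gap_def by (meson less_imp_le less_le_trans le_less_trans)
  next
    assume g: "gap t b Z x y"
    then have "t \<le> x" using points_range[OF Z] unfolding gap_def by blast
    then show ?thesis using g node_points_cases(3)[OF z] unfolding gap_def by (meson less_imp_le le_less_trans)
  qed
  then show ?thesis using assms sub unfolding gap_def by blast
qed

lemma node_gap_affine: "gap_affine F a b (node_set s t X Y Z) \<longleftrightarrow> gap_affine F a s X \<and> gap_affine F s t Y \<and> gap_affine F t b Z"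
  unfolding gap_affine_def using node_gap_split node_gap_lift by blast

end

lemma gap_affine_of_affine: "subdiv a b X \<Longrightarrow> affine_on F a b \<Longrightarrow> gap_affine F a b X"
  unfolding gap_affine_def gap_def using points_range affine_on_subset by blast

lemma gap_act:
  assumes H: "strict_mono_on {a..b} H" "H a = a" "H b = b" and X: "subdiv a b X" and g: "gap a b X x y"
  shows "gap a b (act H X) (H x) (H y)"
proof -
  have pts: "points a b (act H X) = H ` points a b X"
    using H(2,3) unfolding points_def by (auto simp: image_Un image_image)
  have r: "\<And>z. z \<in> points a b X \<Longrightarrow> z \<in> {a..b}" using points_range[OF X] by auto
  have lt: "H u < H v \<longleftrightarrow> u < v" if "u \<in> points a b X" "v \<in> points a b X" for u v
    using strict_mono_on_less[OF H(1)] r that by blast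
  show ?thesis using g lt unfolding gap_def pts by blast
qed

lemma gap_affine_comp:
  assumes H: "strict_mono_on {a..b} H" "H a = a" "H b = b" and X: "subdiv a b X"
    and "gap_affine H a b X" "gap_affine R a b (act H X)"
  shows "gap_affine (R \<circ> H) a b X"
  unfolding gap_affine_def
proof (intro allI impI)
  fix x y assume g: "gap a b X x y"
  then have "a \<le> x" "y \<le> b" using points_range[OF X] unfolding gap_def by auto
  then have "mono_on {x..y} H" using strict_mono_on_imp_mono_on[OF H(1)] by (rule_tac monotone_on_subset) auto
  then show "affine_on (R \<circ> H) x y"
    using affine_on_comp assms(5,6) g gap_act[OF H X g] unfolding gap_affine_def by blast
qed

lemma homeo_strict_mono_on: "homeo_lift F \<Longrightarrow> strict_mono_on A F"
  using homeo_lift_less by (simp add: strict_mono_on_def)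

definition supported :: "(real \<Rightarrow> real) \<Rightarrow> real \<Rightarrow> real \<Rightarrow> bool" where
  "supported F a b \<longleftrightarrow> gen_lift F \<and> (\<forall>x. b \<le> x \<longrightarrow> x \<le> a + 1 \<longrightarrow> F x = x)"

lemma supported_ends:
  assumes "supported F a b" "b \<le> a + 1" shows "F a = a" "F b = b"
proof -
  have "F (a + 1) = a + 1" using assms unfolding supported_def by auto
  then show "F a = a" using homeo_lift_add_one[OF gen_lift_homeo, of F a] assms(1) unfolding supported_def by auto
  show "F b = b" using assms unfolding supported_def by auto
qed

lemma supported_outside:
  assumes "supported F a b" "b - 1 \<le> x" "x \<le> a" shows "F x = x"
proof -
  have "F (x + 1) = x + 1" using assms unfolding supported_def by auto
  then show ?thesis using homeo_lift_add_one[OF gen_lift_homeo, of F x] assms(1) unfolding supported_def by auto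
qed

lemma supported_id: "supported (\<lambda>x. x) a b"
  unfolding supported_def using gen_lift_id by simp

lemma supported_mono: "supported F c d \<Longrightarrow> a \<le> c \<Longrightarrow> d \<le> b \<Longrightarrow> supported F a b"
  unfolding supported_def by auto

lemma supported_comp: "supported F a b \<Longrightarrow> supported G a b \<Longrightarrow> supported (F \<circ> G) a b"
  unfolding supported_def using gen_lift_comp by auto

lemma supported_inv: "supported F a b \<Longrightarrow> supported (the_inv F) a b"
  unfolding supported_def using gen_lift_inv homeo_lift_inv_f[OF gen_lift_homeo] by metis

lemma affine_value:
  assumes "affine_on F a b" "a < b" "x = a + r * (b - a)" "0 \<le> r" "r \<le> 1" "F a = c" "F b = d"
  shows "F x = c + r * (d - c)"
  using affine_on_param[OF assms(1,4,5)] assms by simp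

lemma rotation_right:
  assumes S: "rotation S a b" and ab: "a < b"
    and X: "subdiv a (a + (b - a)/4) X" and root: "(a + (b - a)/16, a + 3/16 * (b - a)) \<in> X"
    and Y: "subdiv (a + (b - a)/4) (b - (b - a)/4) Y" and Z: "subdiv (b - (b - a)/4) b Z"
  defines "W \<equiv> insert (a + (b - a)/4, b - (b - a)/4) (X \<union> Y \<union> Z)"
  shows "subdiv a b (act S W)" "gap_affine S a b W"
    "S (a + (b - a)/16) = a + (b - a)/4" "S (a + 3/16 * (b - a)) = b - (b - a)/4"
proof -
  define L where "L = b - a"
  have L: "0 < L" "b = a + L" using ab by (auto simp: L_def)
  have hS: "homeo_lift S" using S gen_lift_homeo unfolding rotation_def by blast
  have S': "S a = a" "S b = b" "S (a + 3/16 * L) = a + 3/4 * L" "S (a + 1/4 * L) = a + 13/16 * L"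
     and aff: "affine_on S a (a + 3/16 * L)" "affine_on S (a + 3/16 * L) (a + 1/4 * L)" "affine_on S (a + 1/4 * L) b"
    using S unfolding rotation_def L_def by auto
  have e: "a + (b - a)/4 = a + 1/4 * L" "b - (b - a)/4 = a + 3/4 * L" "a + (b - a)/16 = a + 1/16 * L" "a + 3/16 * (b - a) = a + 3/16 * L"
    by (auto simp: L field_simps)
  have S1: "S (a + 1/16 * L) = a + 1/4 * L"
  proof -
    have "S (a + 1/16 * L) = a + 1/3 * (a + 3/4 * L - a)"
      by (rule affine_value[OF aff(1) _ _ _ _ S'(1,3)]) (use L in auto)
    then show ?thesis by simp
  qed
  have S2: "S (a + 3/4 * L) = a + 15/16 * L"
  proof -
    have "S (a + 3/4 * L) = a + 13/16 * L + 2/3 * (b - (a + 13/16 * L))"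
      by (rule affine_value[OF aff(3) _ _ _ _ S'(4,2)]) (use L in auto)
    then show ?thesis by (simp add: L(2))
  qed
  show "S (a + (b - a)/16) = a + (b - a)/4" "S (a + 3/16 * (b - a)) = b - (b - a)/4" unfolding e using S1 S'(3) by auto
  have X': "subdiv a (a + 1/4 * L) X" and Y': "subdiv (a + 1/4 * L) (a + 3/4 * L) Y" and Z': "subdiv (a + 3/4 * L) b Z"
    using X Y Z unfolding e by auto
  have q: "a + (a + 1/4 * L - a)/4 = a + 1/16 * L" "(a + 1/4 * L) - (a + 1/4 * L - a)/4 = a + 3/16 * L" by (auto simp: field_simps)
  obtain P Q T where PQT: "X = insert (a + 1/16 * L, a + 3/16 * L) (P \<union> Q \<union> T)"
    "subdiv a (a + 1/16 * L) P" "subdiv (a + 1/16 * L) (a + 3/16 * L) Q" "subdiv (a + 3/16 * L) (a + 1/4 * L) T"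
    using subdiv_nodeE[OF X'] root unfolding q e by metis
  have W: "W = insert (a + 1/4 * L, a + 3/4 * L) (X \<union> Y \<union> Z)" unfolding W_def e ..
  have affP: "affine_on S a (a + 1/16 * L)" and affQ: "affine_on S (a + 1/16 * L) (a + 3/16 * L)"
    and affY: "affine_on S (a + 1/4 * L) (a + 3/4 * L)" and affZ: "affine_on S (a + 3/4 * L) b"
    using affine_on_subset[OF aff(1)] affine_on_subset[OF aff(3)] L by auto
  have lt: "S u < S v" if "u < v" for u v using homeo_lift_less[OF hS] that by blast
  have P: "subdiv a (a + 1/4 * L) (act S P)"
    using subdiv_affine_image[OF PQT(2) affP lt] L S1 S'(1) by simp
  have Q: "subdiv (a + 1/4 * L) (a + 3/4 * L) (act S Q)"
    using subdiv_affine_image[OF PQT(3) affQ lt] L S1 S'(3) by simp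
  have T: "subdiv (a + 3/4 * L) (a + 13/16 * L) (act S T)"
    using subdiv_affine_image[OF PQT(4) aff(2) lt] L S'(3,4) by simp
  have Yi: "subdiv (a + 13/16 * L) (a + 15/16 * L) (act S Y)"
    using subdiv_affine_image[OF Y' affY lt] L S'(4) S2 by simp
  have Zi: "subdiv (a + 15/16 * L) b (act S Z)"
    using subdiv_affine_image[OF Z' affZ lt] L S'(2) S2 by simp
  have right: "subdiv (a + 3/4 * L) b (insert (a + 13/16 * L, a + 15/16 * L) (act S T \<union> act S Y \<union> act S Z))"
    by (rule subdiv_nodeI[OF T Yi Zi]) (auto simp: L(2) field_simps)
  have "subdiv a b (insert (a + 1/4 * L, a + 3/4 * L) (act S P \<union> act S Q \<union>
      insert (a + 13/16 * L, a + 15/16 * L) (act S T \<union> act S Y \<union> act S Z)))"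
    by (rule subdiv_nodeI[OF P Q right]) (auto simp: L(2) field_simps)
  moreover have "act S W = insert (a + 1/4 * L, a + 3/4 * L) (act S P \<union> act S Q \<union>
      insert (a + 13/16 * L, a + 15/16 * L) (act S T \<union> act S Y \<union> act S Z))"
    unfolding W PQT(1) by (simp only: image_insert image_Un map_prod_simp S1 S2 S'(3,4)) blast
  ultimately show "subdiv a b (act S W)" by simp
  have "gap_affine S a (a + 1/4 * L) X"
    unfolding PQT(1) node_gap_affine[OF PQT(2-4)]
    using gap_affine_of_affine PQT(2-4) affP affQ aff(2) by blast
  then show "gap_affine S a b W"
    unfolding W node_gap_affine[OF X' Y' Z'] using gap_affine_of_affine Y' Z' affY affZ by blast
qed

lemma rotation_left:
  assumes S: "rotation S a b" and ab: "a < b"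
    and X: "subdiv a (a + (b - a)/4) X" and Y: "subdiv (a + (b - a)/4) (b - (b - a)/4) Y"
    and Z: "subdiv (b - (b - a)/4) b Z" and root: "(a + 13/16 * (b - a), a + 15/16 * (b - a)) \<in> Z"
  defines "W \<equiv> insert (a + (b - a)/4, b - (b - a)/4) (X \<union> Y \<union> Z)"
  shows "subdiv a b (act (the_inv S) W)" "gap_affine (the_inv S) a b W"
    "the_inv S (a + 13/16 * (b - a)) = a + (b - a)/4" "the_inv S (a + 15/16 * (b - a)) = b - (b - a)/4"
proof -
  define L where "L = b - a"
  have L: "0 < L" "b = a + L" using ab by (auto simp: L_def)
  have hS: "homeo_lift S" using S gen_lift_homeo unfolding rotation_def by blast
  have S': "S a = a" "S b = b" "S (a + 3/16 * L) = a + 3/4 * L" "S (a + 1/4 * L) = a + 13/16 * L"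
     and aff: "affine_on S a (a + 3/16 * L)" "affine_on S (a + 3/16 * L) (a + 1/4 * L)" "affine_on S (a + 1/4 * L) b"
    using S unfolding rotation_def L_def by auto
  define V where "V = the_inv S"
  have hV: "homeo_lift V" unfolding V_def using homeo_lift_inv[OF hS] .
  have V': "V a = a" "V b = b" "V (a + 3/4 * L) = a + 3/16 * L" "V (a + 13/16 * L) = a + 1/4 * L"
    unfolding V_def using homeo_lift_inv_f[OF hS] S' by metis+
  have vaff: "affine_on V a (a + 3/4 * L)" "affine_on V (a + 3/4 * L) (a + 13/16 * L)" "affine_on V (a + 13/16 * L) b"
    unfolding V_def using affine_on_inv[OF hS aff(1)] affine_on_inv[OF hS aff(2)] affine_on_inv[OF hS aff(3)] S' L by simp_all
  have e: "a + (b - a)/4 = a + 1/4 * L" "b - (b - a)/4 = a + 3/4 * L"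
    "a + 13/16 * (b - a) = a + 13/16 * L" "a + 15/16 * (b - a) = a + 15/16 * L"
    by (auto simp: L field_simps)
  have V1: "V (a + 1/4 * L) = a + 1/16 * L"
  proof -
    have "V (a + 1/4 * L) = a + 1/3 * (a + 3/16 * L - a)"
      by (rule affine_value[OF vaff(1) _ _ _ _ V'(1,3)]) (use L in auto)
    then show ?thesis by simp
  qed
  have V2: "V (a + 15/16 * L) = a + 3/4 * L"
  proof -
    have "V (a + 15/16 * L) = a + 1/4 * L + 2/3 * (b - (a + 1/4 * L))"
      by (rule affine_value[OF vaff(3) _ _ _ _ V'(4,2)]) (use L in auto)
    then show ?thesis by (simp add: L(2))
  qed
  show "the_inv S (a + 13/16 * (b - a)) = a + (b - a)/4" "the_inv S (a + 15/16 * (b - a)) = b - (b - a)/4"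
    unfolding e V_def[symmetric] using V2 V'(4) by auto
  have X': "subdiv a (a + 1/4 * L) X" and Y': "subdiv (a + 1/4 * L) (a + 3/4 * L) Y" and Z': "subdiv (a + 3/4 * L) b Z"
    using X Y Z unfolding e by auto
  have q: "a + 3/4 * L + (b - (a + 3/4 * L))/4 = a + 13/16 * L" "b - (b - (a + 3/4 * L))/4 = a + 15/16 * L"
    by (auto simp: L(2) field_simps)
  obtain P Q T where PQT: "Z = insert (a + 13/16 * L, a + 15/16 * L) (P \<union> Q \<union> T)"
    "subdiv (a + 3/4 * L) (a + 13/16 * L) P" "subdiv (a + 13/16 * L) (a + 15/16 * L) Q" "subdiv (a + 15/16 * L) b T"
    using subdiv_nodeE[OF Z'] root unfolding q e by metis
  have W: "W = insert (a + 1/4 * L, a + 3/4 * L) (X \<union> Y \<union> Z)" unfolding W_def e ..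
  have affX: "affine_on V a (a + 1/4 * L)" and affY: "affine_on V (a + 1/4 * L) (a + 3/4 * L)"
    and affQ: "affine_on V (a + 13/16 * L) (a + 15/16 * L)" and affT: "affine_on V (a + 15/16 * L) b"
    using affine_on_subset[OF vaff(1)] affine_on_subset[OF vaff(3)] L by auto
  have lt: "V u < V v" if "u < v" for u v using homeo_lift_less[OF hV] that by blast
  have Xi: "subdiv a (a + 1/16 * L) (act V X)"
    using subdiv_affine_image[OF X' affX lt] L V1 V'(1) by simp
  have Yi: "subdiv (a + 1/16 * L) (a + 3/16 * L) (act V Y)"
    using subdiv_affine_image[OF Y' affY lt] L V1 V'(3) by simp
  have P: "subdiv (a + 3/16 * L) (a + 1/4 * L) (act V P)"
    using subdiv_affine_image[OF PQT(2) vaff(2) lt] L V'(3,4) by simp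
  have Q: "subdiv (a + 1/4 * L) (a + 3/4 * L) (act V Q)"
    using subdiv_affine_image[OF PQT(3) affQ lt] L V'(4) V2 by simp
  have T: "subdiv (a + 3/4 * L) b (act V T)"
    using subdiv_affine_image[OF PQT(4) affT lt] L V'(2) V2 by simp
  have left: "subdiv a (a + 1/4 * L) (insert (a + 1/16 * L, a + 3/16 * L) (act V X \<union> act V Y \<union> act V P))"
    by (rule subdiv_nodeI[OF Xi Yi P]) (auto simp: L(2) field_simps)
  have "subdiv a b (insert (a + 1/4 * L, a + 3/4 * L) (insert (a + 1/16 * L, a + 3/16 * L) (act V X \<union> act V Y \<union> act V P)
      \<union> act V Q \<union> act V T))"
    by (rule subdiv_nodeI[OF left Q T]) (auto simp: L(2) field_simps)
  moreover have "act V W = insert (a + 1/4 * L, a + 3/4 * L) (insert (a + 1/16 * L, a + 3/16 * L) (act V X \<union> act V Y \<union> act V P)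
      \<union> act V Q \<union> act V T)"
    unfolding W PQT(1) by (simp only: image_insert image_Un map_prod_simp V1 V2 V'(3,4)) blast
  ultimately show "subdiv a b (act (the_inv S) W)" unfolding V_def by simp
  have "gap_affine V (a + 3/4 * L) b Z"
    unfolding PQT(1) node_gap_affine[OF PQT(2-4)]
    using gap_affine_of_affine PQT(2-4) vaff(2) affQ affT by blast
  then show "gap_affine (the_inv S) a b W"
    unfolding V_def[symmetric] W node_gap_affine[OF X' Y' Z'] using gap_affine_of_affine X' Y' affX affY by blast
qed

lemma rotation_supported: "rotation S a b \<Longrightarrow> supported S a b"
  unfolding rotation_def supported_def by blast

lemma act_mem: "(p, q) \<in> X \<Longrightarrow> (F p, F q) \<in> act F X"
  by (rule image_eqI[of _ _ "(p, q)"]) simp_all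

section \<open>Bringing an outermost arc to the root\<close>

definition outermost :: "real \<Rightarrow> real \<Rightarrow> (real \<times> real) set \<Rightarrow> bool" where
  "outermost p q X \<longleftrightarrow> (p, q) \<in> X \<and> (\<forall>(p', q')\<in>X. \<not> (p' < p \<and> q < q'))"

text \<open>
  An outermost arc other than the primary one is in the left or right part, because the middle part is
  under the primary arc. By induction it becomes the primary arc of that part, and a rotation or
  the inverse of a rotation then makes it the primary arc of the whole interval.
\<close>

lemma raise_arc_to_root:
  assumes "subdiv a b X" "modelled a b" "b \<le> a + 1" "outermost p q X"
  shows "\<exists>R. supported R a b \<and> gap_affine R a b X \<and> subdiv a b (act R X) \<and>
    R p = a + (b - a)/4 \<and> R q = b - (b - a)/4"
  using assms
proof (induction rule: subdiv.induct)
  case (empty a b)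
  then show ?case unfolding outermost_def by simp
next
  case (node a b X Y Z)
  define s where "s = a + (b - a)/4"
  define t where "t = b - (b - a)/4"
  have X: "subdiv a s X" and Y: "subdiv s t Y" and Z: "subdiv t b Z" using node.hyps by (auto simp: s_def t_def)
  have less: "a < s" "s < t" "t < b" using subdiv_less X Y Z by auto
  have ab: "a < b" using less by simp
  have W: "subdiv a b (node_set s t X Y Z)" using subdiv_nodeI[OF X Y Z s_def t_def] .
  obtain S where S: "rotation S a b" using rotation_exists node.prems(1) by blast
  have hS: "homeo_lift S" using S gen_lift_homeo unfolding rotation_def by blast
  have sS: "supported S a b" using rotation_supported[OF S] .
  have out: "outermost p q (node_set s t X Y Z)" using node.prems(3) by (simp add: s_def t_def)
  consider "p = s" "q = t" | "(p, q) \<in> X" | "(p, q) \<in> Y" | "(p, q) \<in> Z" using out unfolding outermost_def by auto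
  then have "\<exists>R. supported R a b \<and> gap_affine R a b (node_set s t X Y Z) \<and> subdiv a b (act R (node_set s t X Y Z)) \<and> R p = s \<and> R q = t"
  proof cases
    case 1
    have "act (\<lambda>x. x) V = V" for V :: "(real \<times> real) set" by (rule act_id_on) simp
    then show ?thesis
      using 1 W supported_id gap_affine_of_affine[OF W affine_on_shift(3)] by (intro exI[of _ "\<lambda>x. x"]) simp
  next
    case 2
    have "outermost p q X" using 2 out unfolding outermost_def by blast
    then obtain R where R: "supported R a s" "gap_affine R a s X" "subdiv a s (act R X)"
      "R p = a + (s - a)/4" "R q = s - (s - a)/4"
      using node.IH(1) modelled_children(1)[OF node.prems(1)] less node.prems(2) unfolding s_def[symmetric] by auto
    have sR: "supported R a b" using supported_mono[OF R(1)] less by simp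
    have Rid: "R x = x" if "s \<le> x" "x \<le> b" for x using R(1) that node.prems(2) unfolding supported_def by auto
    have YZ: "act R Y = Y" "act R Z = Z"
      by (rule act_id_on; use subdiv_range[OF Y] subdiv_range[OF Z] Rid less in force)+
    have st: "map_prod R R (s, t) = (s, t)" using Rid less by simp
    have img: "act R (node_set s t X Y Z) = node_set s t (act R X) Y Z" by (simp only: image_insert image_Un st YZ)
    have e: "a + (b - a)/16 = R p" "a + 3/16 * (b - a) = R q" unfolding R(4,5) s_def by (auto simp: field_simps)
    have root: "(a + (b - a)/16, a + 3/16 * (b - a)) \<in> act R X" unfolding e using act_mem[OF 2] .
    note rot = rotation_right[OF S ab R(3)[unfolded s_def] root[unfolded s_def] Y[unfolded s_def t_def] Z[unfolded t_def], folded s_def t_def]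
    have "gap_affine R a b (node_set s t X Y Z)"
      unfolding node_gap_affine[OF X Y Z]
    proof (intro conjI R(2))
      show "gap_affine R s t Y"
        by (rule gap_affine_of_affine[OF Y]) (use affine_on_cong[of s t R "\<lambda>x. x"] Rid less affine_on_shift(3) in auto)
      show "gap_affine R t b Z"
        by (rule gap_affine_of_affine[OF Z]) (use affine_on_cong[of t b R "\<lambda>x. x"] Rid less affine_on_shift(3) in auto)
    qed
    then have "gap_affine (S \<circ> R) a b (node_set s t X Y Z)"
      using gap_affine_comp[OF homeo_strict_mono_on[OF gen_lift_homeo] supported_ends[OF sR node.prems(2)] W] rot(2) img sR
      unfolding supported_def by simp
    moreover have "subdiv a b (act (S \<circ> R) (node_set s t X Y Z))" using rot(1) img act_comp by metis
    moreover have "supported (S \<circ> R) a b" using supported_comp[OF sS sR] .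
    moreover have "(S \<circ> R) p = s" "(S \<circ> R) q = t" using rot(3,4) unfolding e by auto
    ultimately show ?thesis by blast
  next
    case 3
    then have "s < p" "q < t" using subdiv_range[OF Y] by auto
    then show ?thesis using out unfolding outermost_def by auto
  next
    case 4
    have "outermost p q Z" using 4 out unfolding outermost_def by blast
    then obtain R where R: "supported R t b" "gap_affine R t b Z" "subdiv t b (act R Z)"
      "R p = t + (b - t)/4" "R q = b - (b - t)/4"
      using node.IH(3) modelled_children(3)[OF node.prems(1)] less node.prems(2) unfolding t_def[symmetric] by auto
    have sR: "supported R a b" using supported_mono[OF R(1)] less by simp
    have Rid: "R x = x" if "a \<le> x" "x \<le> t" for x using supported_outside[OF R(1)] that node.prems(2) by auto
    have XY: "act R X = X" "act R Y = Y"
      by (rule act_id_on; use subdiv_range[OF X] subdiv_range[OF Y] Rid less in force)+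
    have st: "map_prod R R (s, t) = (s, t)" using Rid less by simp
    have img: "act R (node_set s t X Y Z) = node_set s t X Y (act R Z)" by (simp only: image_insert image_Un st XY)
    have e: "a + 13/16 * (b - a) = R p" "a + 15/16 * (b - a) = R q" unfolding R(4,5) t_def by (auto simp: field_simps)
    have root: "(a + 13/16 * (b - a), a + 15/16 * (b - a)) \<in> act R Z" unfolding e using act_mem[OF 4] .
    note rot = rotation_left[OF S ab X[unfolded s_def] Y[unfolded s_def t_def] R(3)[unfolded t_def] root[unfolded t_def], folded s_def t_def]
    have "gap_affine R a b (node_set s t X Y Z)"
      unfolding node_gap_affine[OF X Y Z]
    proof (intro conjI R(2))
      show "gap_affine R a s X"
        by (rule gap_affine_of_affine[OF X]) (use affine_on_cong[of a s R "\<lambda>x. x"] Rid less affine_on_shift(3) in auto)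
      show "gap_affine R s t Y"
        by (rule gap_affine_of_affine[OF Y]) (use affine_on_cong[of s t R "\<lambda>x. x"] Rid less affine_on_shift(3) in auto)
    qed
    then have "gap_affine (the_inv S \<circ> R) a b (node_set s t X Y Z)"
      using gap_affine_comp[OF homeo_strict_mono_on[OF gen_lift_homeo] supported_ends[OF sR node.prems(2)] W] rot(2) img sR
      unfolding supported_def by simp
    moreover have "subdiv a b (act (the_inv S \<circ> R) (node_set s t X Y Z))" using rot(1) img act_comp by metis
    moreover have "supported (the_inv S \<circ> R) a b" using supported_comp[OF supported_inv[OF sS] sR] .
    moreover have "(the_inv S \<circ> R) p = s" "(the_inv S \<circ> R) q = t" using rot(3,4) unfolding e by auto
    ultimately show ?thesis by blast
  qed
  then show ?case unfolding s_def t_def .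
qed

section \<open>Rearrangements of a single interval\<close>

lemma act_restrict:
  assumes H: "strict_mono_on {a..b} H" "\<And>x. x \<in> {a..b} \<Longrightarrow> H x \<in> {a..b}" and W: "\<And>p q. (p, q) \<in> W \<Longrightarrow> p \<in> {a..b} \<and> q \<in> {a..b}"
    and c: "c \<in> {a..b}" "H c = c" and d: "d \<in> {a..b}" "H d = d" and img: "act H W = W'"
    and A: "A = {(p, q) \<in> W. c < p \<and> q < d}" and A': "A' = {(p, q) \<in> W'. c < p \<and> q < d}"
  shows "act H A = A'"
proof -
  have cd: "c < H p \<longleftrightarrow> c < p" "H p < d \<longleftrightarrow> p < d" if "p \<in> {a..b}" for p
    using strict_mono_on_less[OF H(1), of c p] strict_mono_on_less[OF H(1), of p d] that c d by auto
  show ?thesis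
  proof (intro equalityI subsetI)
    fix z assume "z \<in> act H A"
    then obtain p q where "(p, q) \<in> W" "c < p" "q < d" "z = (H p, H q)" unfolding A by auto
    then show "z \<in> A'" unfolding A' img[symmetric] using act_mem[of p q W H] cd W by auto
  next
    fix z assume z: "z \<in> A'"
    then have "z \<in> act H W" unfolding A' img by blast
    then obtain p q where pq: "(p, q) \<in> W" "z = (H p, H q)" by auto
    then have "(p, q) \<in> A" unfolding A using z cd W[OF pq(1)] unfolding A' by auto
    then show "z \<in> act H A" using act_mem pq(2) by simp
  qed
qed

lemma node_parts:
  assumes X: "subdiv a s X" and Y: "subdiv s t Y" and Z: "subdiv t b Z"
  shows "X = {(p, q) \<in> node_set s t X Y Z. a < p \<and> q < s}" "Y = {(p, q) \<in> node_set s t X Y Z. s < p \<and> q < t}"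
    "Z = {(p, q) \<in> node_set s t X Y Z. t < p \<and> q < b}"
proof -
  have less: "a < s" "s < t" "t < b" using subdiv_less X Y Z by auto
  note r = subdiv_range[OF X] subdiv_range[OF Y] subdiv_range[OF Z]
  have rX: "a < p \<and> p < q \<and> q < s \<and> q < t \<and> \<not> s < p \<and> \<not> t < p \<and> p < s" if "(p, q) \<in> X" for p q
    using r(1)[OF that] less by auto
  have rY: "s < p \<and> p < q \<and> q < t \<and> \<not> q < s \<and> \<not> t < p" if "(p, q) \<in> Y" for p q
    using r(2)[OF that] less by auto
  have rZ: "t < p \<and> p < q \<and> q < b \<and> \<not> q < t \<and> \<not> q < s" if "(p, q) \<in> Z" for p q
    using r(3)[OF that] less by auto
  show "X = {(p, q) \<in> node_set s t X Y Z. a < p \<and> q < s}" using rX rY rZ less by auto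
  show "Y = {(p, q) \<in> node_set s t X Y Z. s < p \<and> q < t}" using rX rY rZ less by auto
  show "Z = {(p, q) \<in> node_set s t X Y Z. t < p \<and> q < b}" using rX rY rZ less by auto
qed

text \<open>
  The image of the primary arc under \<open>H\<close> is outermost, so the generated group can move it back to the
  root. The composite fixes the ends of the primary arc and is a rearrangement of each of the three
  parts, to which the induction hypotheses apply; their results have disjoint supports.
\<close>

lemma interval_rearrangement_generated:
  assumes "subdiv a b X" "modelled a b" "b \<le> a + 1" "subdiv a b X'"
    "strict_mono_on {a..b} H" "H a = a" "H b = b" "act H X = X'" "gap_affine H a b X"
  shows "\<exists>F. supported F a b \<and> (\<forall>x\<in>{a..b}. F x = H x)"
  using assms
proof (induction arbitrary: X' H rule: subdiv.induct)
  case (empty a b)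
  have "gap a b {} a b" using empty.hyps unfolding gap_def points_def by auto
  then have aff: "affine_on H a b" using empty.prems unfolding gap_affine_def by blast
  have "H x = x" if "x \<in> {a..b}" for x
  proof -
    have "x = a + (x - a)/(b - a) * (b - a)" using empty.hyps by simp
    moreover have "H x = a + (x - a)/(b - a) * (b - a)"
      by (rule affine_value[OF aff _ _ _ _ empty.prems(5,6)]) (use empty.hyps that in auto)
    ultimately show ?thesis by simp
  qed
  then show ?case using supported_id by (intro exI[of _ "\<lambda>x. x"]) simp
next
  case (node a b X Y Z)
  define s where "s = a + (b - a)/4"
  define t where "t = b - (b - a)/4"
  have X: "subdiv a s X" and Y: "subdiv s t Y" and Z: "subdiv t b Z" using node.hyps by (auto simp: s_def t_def)
  have less: "a < s" "s < t" "t < b" using subdiv_less X Y Z by auto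
  let ?W = "node_set s t X Y Z"
  have W: "subdiv a b ?W" using subdiv_nodeI[OF X Y Z s_def t_def] .
  note b1 = node.prems(2)
  note mono = node.prems(4)
  have img: "act H ?W = X'" and gaps: "gap_affine H a b ?W" using node.prems(7,8) by (auto simp: s_def t_def)
  have lt: "H x < H y \<longleftrightarrow> x < y" if "x \<in> {a..b}" "y \<in> {a..b}" for x y using strict_mono_on_less[OF mono] that by blast
  have "outermost (H s) (H t) X'"
    unfolding outermost_def
  proof (intro conjI ballI)
    show "(H s, H t) \<in> X'" unfolding img[symmetric] by simp
    fix z assume "z \<in> X'"
    then obtain p q where pq: "(p, q) \<in> ?W" "z = (H p, H q)" unfolding img[symmetric] by auto
    have "a < p" "p < q" "q < b" using subdiv_range[OF W pq(1)] by auto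
    moreover have "\<not> (p < s \<and> t < q)"
      using pq(1) subdiv_range[OF X, of p q] subdiv_range[OF Y, of p q] subdiv_range[OF Z, of p q] less by auto
    ultimately show "case z of (p', q') \<Rightarrow> \<not> (p' < H s \<and> H t < q')"
      using lt[of p s] lt[of t q] less pq(2) by auto
  qed
  then obtain R where R: "supported R a b" "gap_affine R a b X'" "subdiv a b (act R X')" "R (H s) = s" "R (H t) = t"
    using raise_arc_to_root[OF node.prems(3) node.prems(1) b1] unfolding s_def t_def by blast
  have hR: "homeo_lift R" using R(1) gen_lift_homeo unfolding supported_def by blast
  note Re = supported_ends[OF R(1) b1]
  define K where "K = R \<circ> H"
  have K: "K a = a" "K b = b" "K s = s" "K t = t" using node.prems(5,6) Re R(4,5) unfolding K_def by auto
  have Kmono: "strict_mono_on {a..b} K"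
    unfolding K_def strict_mono_on_def using homeo_lift_less[OF hR] lt by auto
  have Kgaps: "gap_affine K a b ?W"
    unfolding K_def using gap_affine_comp[OF mono node.prems(5,6) W gaps] R(2) img by simp
  have Kimg: "act K ?W = act R X'" unfolding K_def using img act_comp by metis
  have st: "(s, t) \<in> act R X'" unfolding Kimg[symmetric] using act_mem[of s t ?W K] K by simp
  then obtain P Q T where PQT: "act R X' = node_set s t P Q T" "subdiv a s P" "subdiv s t Q" "subdiv t b T"
    using subdiv_nodeE[OF R(3), folded s_def t_def, OF st] by metis
  have Kin: "K x \<in> {a..b}" if "x \<in> {a..b}" for x
    using strict_mono_on_leD[OF Kmono, of a x] strict_mono_on_leD[OF Kmono, of x b] that K less by auto
  have Win: "p \<in> {a..b} \<and> q \<in> {a..b}" if "(p, q) \<in> ?W" for p q using subdiv_range[OF W that] by auto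
  have mem: "a \<in> {a..b}" "b \<in> {a..b}" "s \<in> {a..b}" "t \<in> {a..b}" using less by auto
  have Kimg': "act K ?W = node_set s t P Q T" using Kimg PQT(1) by simp
  note np = node_parts[OF X Y Z] and np' = node_parts[OF PQT(2-4)]
  have parts: "act K X = P" "act K Y = Q" "act K Z = T"
    using act_restrict[OF Kmono Kin Win mem(1) K(1) mem(3) K(3) Kimg' np(1) np'(1)]
      act_restrict[OF Kmono Kin Win mem(3) K(3) mem(4) K(4) Kimg' np(2) np'(2)]
      act_restrict[OF Kmono Kin Win mem(4) K(4) mem(2) K(2) Kimg' np(3) np'(3)] by auto
  have sub: "strict_mono_on {c..d} K" if "a \<le> c" "d \<le> b" for c d
    using Kmono that unfolding strict_mono_on_def by auto
  have pg: "gap_affine K a s X" "gap_affine K s t Y" "gap_affine K t b Z" using Kgaps node_gap_affine[OF X Y Z] by auto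
  have g: "modelled a s" "modelled s t" "modelled t b"
    using modelled_children(1)[OF node.prems(1)] modelled_middle[OF node.prems(1)] modelled_children(3)[OF node.prems(1)]
    unfolding s_def t_def by auto
  obtain F1 where F1: "supported F1 a s" "\<forall>x\<in>{a..s}. F1 x = K x"
    using node.IH(1)[folded s_def, OF g(1) _ PQT(2) sub K(1,3) parts(1) pg(1)] less b1 by auto
  obtain F2 where F2: "supported F2 s t" "\<forall>x\<in>{s..t}. F2 x = K x"
    using node.IH(2)[folded s_def t_def, OF g(2) _ PQT(3) sub K(3,4) parts(2) pg(2)] less b1 by auto
  obtain F3 where F3: "supported F3 t b" "\<forall>x\<in>{t..b}. F3 x = K x"
    using node.IH(3)[folded t_def, OF g(3) _ PQT(4) sub K(4,2) parts(3) pg(3)] less b1 by auto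
  define F where "F = the_inv R \<circ> (F1 \<circ> (F2 \<circ> F3))"
  have "supported F a b" unfolding F_def
    using supported_comp supported_inv[OF R(1)] supported_mono[OF F1(1)] supported_mono[OF F2(1)] supported_mono[OF F3(1)] less
    by (metis less_imp_le order_refl order_trans)
  moreover have "F x = H x" if x: "x \<in> {a..b}" for x
  proof -
    have "F1 (F2 (F3 x)) = K x"
    proof -
      have Kle: "K y \<le> K z" if "a \<le> y" "y \<le> z" "z \<le> b" for y z
        using strict_mono_on_leD[OF Kmono, of y z] that by auto
      consider "x \<le> s" | "s \<le> x" "x \<le> t" | "t \<le> x" by linarith
      then show ?thesis
      proof cases
        case 1
        have "F3 x = x" using supported_outside[OF F3(1)] 1 x less b1 by auto
        moreover have "F2 x = x" using supported_outside[OF F2(1)] 1 x less b1 by auto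
        ultimately show ?thesis using F1(2) 1 x by auto
      next
        case 2
        have "F3 x = x" using supported_outside[OF F3(1)] 2 x less b1 by auto
        moreover have "F2 x = K x" using F2(2) 2 by auto
        moreover have "s \<le> K x" "K x \<le> t" using Kle[of s x] Kle[of x t] 2 less K by auto
        then have "F1 (K x) = K x" using F1(1) less b1 unfolding supported_def by auto
        ultimately show ?thesis by simp
      next
        case 3
        have "F3 x = K x" using F3(2) 3 x by auto
        moreover have t: "t \<le> K x" "K x \<le> b" using Kle[of t x] Kle[of x b] 3 x less K by auto
        moreover have "F2 (K x) = K x" using F2(1) t less b1 unfolding supported_def by auto
        moreover have "F1 (K x) = K x" using F1(1) t less b1 unfolding supported_def by auto
        ultimately show ?thesis by simp
      qed
    qed
    then show ?thesis using homeo_lift_inv_f[OF hR] unfolding F_def K_def by simp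
  qed
  ultimately show ?case by blast
qed

text \<open>
  An arc of a subdivision spans the middle part of a modelled interval.
\<close>

lemma arc_moves_to_model:
  assumes "subdiv a b X" "modelled a b" "(p, q) \<in> X" shows "\<exists>F. gen_lift F \<and> F p = 1/3 \<and> F q = 2/3"
  using assms
proof (induction rule: subdiv.induct)
  case (node a b X Y Z)
  consider "p = a + (b - a)/4" "q = b - (b - a)/4" | "(p, q) \<in> X" | "(p, q) \<in> Y" | "(p, q) \<in> Z" using node.prems(2) by auto
  then show ?case
  proof cases
    case 1 then show ?thesis using modelled_children(2)[OF node.prems(1)] unfolding mid_lift_def by auto
  qed (use node.IH modelled_children(1,3)[OF node.prems(1)] modelled_middle[OF node.prems(1)] in auto)
qed simp

section \<open>Arc diagrams as pairs of subdivisions\<close>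

definition arcs :: "(real \<times> real) set \<Rightarrow> complex set set" where
  "arcs X = (\<lambda>(p, q). {pt p, pt q}) ` X"

text \<open>
  The arc with ends \<open>u\<close> and \<open>w\<close> cuts the disk into two parts, and the arcs in each part form a
  subdivision of the circle interval that bounds it.
\<close>

definition represents :: "real \<Rightarrow> real \<Rightarrow> (real \<times> real) set \<Rightarrow> (real \<times> real) set \<Rightarrow> complex set set \<Rightarrow> bool" where
  "represents u w X Y D \<longleftrightarrow> w < u + 1 \<and> subdiv u w X \<and> subdiv w (u + 1) Y \<and>
     D = insert {pt u, pt w} (arcs X \<union> arcs Y)"

lemma arcs_translate: "arcs (act (\<lambda>x. x + 1) X) = arcs X"
  unfolding arcs_def image_image by (rule image_cong) (simp_all add: case_prod_beta)

text \<open>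
  Exchanging the two parts reduces statements about the second one to statements about the first.
\<close>

lemma represents_swap:
  assumes "represents u w X Y D" shows "represents w (u + 1) Y (act (\<lambda>x. x + 1) X) D"
proof -
  have "u < w" "subdiv (u + 1) (w + 1) (act (\<lambda>x. x + 1) X)"
    using assms subdiv_less subdiv_affine_image[OF _ affine_on_shift(1)] unfolding represents_def by auto
  then show ?thesis using assms arcs_translate unfolding represents_def by (auto simp: insert_commute)
qed

lemma Union_arcs: "\<Union>(arcs X) = pt ` (fst ` X \<union> snd ` X)"
proof -
  have "\<Union>(arcs X) = (\<Union>z\<in>X. {pt (fst z), pt (snd z)})" unfolding arcs_def by (simp add: case_prod_beta)
  also have "\<dots> = pt ` (fst ` X \<union> snd ` X)" by blast
  finally show ?thesis .
qed

lemma represents_Union: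
  assumes "represents u w X Y D" shows "\<Union>D = pt ` (points u w X \<union> points w (u + 1) Y)"
proof -
  have "\<Union>D = {pt u, pt w, pt (u + 1)} \<union> \<Union>(arcs X) \<union> \<Union>(arcs Y)"
    using assms unfolding represents_def pt_add_one by auto
  also have "\<dots> = pt ` ({u, w, u + 1} \<union> (fst ` X \<union> snd ` X) \<union> (fst ` Y \<union> snd ` Y))"
    by (simp only: Union_arcs image_Un image_insert image_empty)
  also have "{u, w, u + 1} \<union> (fst ` X \<union> snd ` X) \<union> (fst ` Y \<union> snd ` Y) = points u w X \<union> points w (u + 1) Y"
    unfolding points_def by (rule Set.set_eqI) (simp only: Un_iff insert_iff empty_iff, argo)
  finally show ?thesis .
qed

lemma represents_vertices:
  assumes "represents u w X Y D" and x: "u \<le> x" "x \<le> w"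
  shows "pt x \<in> \<Union>D \<longleftrightarrow> x \<in> points u w X"
proof
  have w: "w < u + 1" and X: "subdiv u w X" and Y: "subdiv w (u + 1) Y" using assms unfolding represents_def by auto
  have ends: "u \<in> points u w X" "w \<in> points u w X" unfolding points_def by auto
  assume "pt x \<in> \<Union>D"
  then consider v where "pt x = pt v" "v \<in> points u w X" | v where "pt x = pt v" "v \<in> points w (u + 1) Y"
    unfolding represents_Union[OF assms(1)] by auto
  then show "x \<in> points u w X"
  proof cases
    case (1 v)
    have "\<bar>x - v\<bar> < 1" using points_range[OF X 1(2)] x w by linarith
    then show ?thesis using pt_eq_near[OF 1(1)] 1(2) by simp
  next
    case (2 v)
    show ?thesis
    proof (cases "x = u")
      case False
      then have "\<bar>x - v\<bar> < 1" using points_range[OF Y 2(2)] x by linarith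
      then have "x = w" using pt_eq_near[OF 2(1)] points_range[OF Y 2(2)] x by linarith
      then show ?thesis using ends by simp
    qed (use ends in simp)
  qed
qed (unfold represents_Union[OF assms(1)], blast)

lemma represents_gap_iff:
  assumes rep: "represents u w X Y D" and r: "u \<le> x" "x \<le> w" "u \<le> y" "y \<le> w"
  shows "gap u w X x y \<longleftrightarrow> circle_interval D x y"
proof -
  have "(z \<in> points u w X) \<longleftrightarrow> (pt z \<in> \<Union>D)" if "x < z" "z < y" for z
    using represents_vertices[OF rep, of z] that r by auto
  then show ?thesis
    unfolding gap_def circle_interval_def represents_vertices[OF rep r(1,2)] represents_vertices[OF rep r(3,4)] by blast
qed

text \<open>
  The arcs recorded by \<open>X\<close> are recognized among all arcs by the position of their ends, which have
  unique representatives strictly between \<open>u\<close> and \<open>w\<close>.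
\<close>

lemma represents_arc_iff:
  assumes rep: "represents u w X Y D" and pq: "u < p" "p < q" "q < w"
  shows "{pt p, pt q} \<in> D \<longleftrightarrow> (p, q) \<in> X"
proof
  have w: "w < u + 1" and X: "subdiv u w X" and Y: "subdiv w (u + 1) Y" and D: "D = insert {pt u, pt w} (arcs X \<union> arcs Y)"
    using rep unfolding represents_def by auto
  have near: "x = y" if "pt x = pt y" "u < x" "x < w" "u \<le> y" "y \<le> u + 1" for x y
    by (rule pt_eq_near[OF that(1)]) (use that w in linarith)
  assume "{pt p, pt q} \<in> D"
  then consider "{pt p, pt q} = {pt u, pt w}" | r s where "(r, s) \<in> X" "{pt p, pt q} = {pt r, pt s}"
    | r s where "(r, s) \<in> Y" "{pt p, pt q} = {pt r, pt s}"
    unfolding D arcs_def by auto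
  then show "(p, q) \<in> X"
  proof cases
    case 1
    then have "pt p = pt u \<or> pt p = pt w" by (auto simp: doubleton_eq_iff)
    then show ?thesis using near[of p u] near[of p w] pq w by auto
  next
    case (2 r s)
    have r: "u < r" "r < s" "s < w" using subdiv_range[OF X 2(1)] by auto
    have "(pt p = pt r \<and> pt q = pt s) \<or> (pt p = pt s \<and> pt q = pt r)" using 2(2) by (auto simp: doubleton_eq_iff)
    then have "(p = r \<and> q = s) \<or> (p = s \<and> q = r)"
      using near[of p r] near[of q s] near[of p s] near[of q r] pq r w by auto
    then show ?thesis using 2(1) pq r by auto
  next
    case (3 r s)
    have r: "w < r" "r < s" "s < u + 1" using subdiv_range[OF Y 3(1)] by auto
    have "pt p = pt r \<or> pt p = pt s" using 3(2) by (auto simp: doubleton_eq_iff)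
    then show ?thesis using near[of p r] near[of p s] pq r by auto
  qed
qed (use rep in \<open>auto simp: represents_def arcs_def\<close>)

lemma subdiv_expand:
  assumes "subdiv a b X" "gap a b X x y" shows "subdiv a b (insert (x + (y - x)/4, y - (y - x)/4) X)"
  using assms
proof (induction rule: subdiv.induct)
  case (empty a b)
  then have xy: "x = a" "y = b" unfolding gap_def points_def by auto
  have "subdiv a (a + (b - a)/4) {}" "subdiv (a + (b - a)/4) (b - (b - a)/4) {}" "subdiv (b - (b - a)/4) b {}"
    using empty.hyps by (auto intro!: subdiv.empty simp: field_simps)
  from subdiv.node[OF this] show ?case unfolding xy by simp
next
  case (node a b X Y Z)
  let ?n = "(x + (y - x)/4, y - (y - x)/4)"
  from node_gap_split[OF node.hyps node.prems] show ?case
  proof (elim disjE)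
    assume "gap a (a + (b - a)/4) X x y"
    from subdiv.node[OF node.IH(1)[OF this] node.hyps(2,3)] show ?thesis by (simp add: insert_commute)
  next
    assume "gap (a + (b - a)/4) (b - (b - a)/4) Y x y"
    from subdiv.node[OF node.hyps(1) node.IH(2)[OF this] node.hyps(3)] show ?thesis by (simp add: insert_commute)
  next
    assume "gap (b - (b - a)/4) b Z x y"
    from subdiv.node[OF node.hyps(1,2) node.IH(3)[OF this]] show ?thesis by (simp add: insert_commute)
  qed
qed

lemma represents_expand:
  assumes rep: "represents u w X Y D" and ci: "circle_interval D x y" and x: "u \<le> x" "x < w"
  shows "\<exists>X'. represents u w X' Y (insert (primary_arc x y) D)"
proof -
  have X: "subdiv u w X" using rep unfolding represents_def by blast
  have "pt w \<in> \<Union>D" "x < y" using rep ci unfolding represents_def circle_interval_def by auto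
  then have y: "u \<le> y" "y \<le> w" using ci x unfolding circle_interval_def by (auto simp: not_le[symmetric])
  let ?n = "(x + (y - x)/4, y - (y - x)/4)"
  have "gap u w X x y" using represents_gap_iff[OF rep x(1) less_imp_le[OF x(2)] y] ci by blast
  then have "subdiv u w (insert ?n X)" by (rule subdiv_expand[OF X])
  moreover have "arcs (insert ?n X) = insert (primary_arc x y) (arcs X)" unfolding arcs_def primary_arc_def by simp
  ultimately have "represents u w (insert ?n X) Y (insert (primary_arc x y) D)"
    using rep unfolding represents_def by auto
  then show ?thesis by blast
qed

lemma arc_diagram_represented: "arc_diagram D \<Longrightarrow> \<exists>X Y. represents (1/6) (5/6) X Y D"
proof (induction rule: arc_diagram.induct)
  case base
  have "subdiv (1/6) (5/6) (insert (1/3, 2/3) ({} \<union> {} \<union> {}))"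
    by (rule subdiv_nodeI) (auto intro: subdiv.empty)
  moreover have "subdiv (5/6) (1/6 + 1) {}" by (rule subdiv.empty) simp
  moreover have "base_diagram = insert {pt (1/6), pt (5/6)} (arcs (insert (1/3, 2/3) ({} \<union> {} \<union> {})) \<union> arcs {})"
    unfolding arcs_def by auto
  ultimately show ?case unfolding represents_def by force
next
  case (expand D a b)
  then obtain X Y where rep: "represents (1/6) (5/6) X Y D" by blast
  obtain k :: int where k: "1/6 \<le> a + of_int k" "a + of_int k < 1/6 + 1" using shift_into_period by blast
  define x where "x = a + of_int k"
  define y where "y = b + of_int k"
  have ci: "circle_interval D x y" unfolding x_def y_def using circle_interval_shift[OF expand.hyps(2)] .
  have prim: "primary_arc a b = primary_arc x y" unfolding x_def y_def using primary_arc_shift by simp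
  show ?case
  proof (cases "x < 5/6")
    case True
    then show ?thesis using represents_expand[OF rep ci] k(1) unfolding prim x_def[symmetric] by blast
  next
    case False
    \<comment> \<open>The complementary interval is handled by the same lemma after a turn of the circle.\<close>
    then obtain Y' where "represents (5/6) (1/6 + 1) Y' (act (\<lambda>x. x + 1) X) (insert (primary_arc x y) D)"
      using represents_expand[OF represents_swap[OF rep] ci] k(2) unfolding x_def[symmetric] by force
    then have Y': "subdiv (5/6) (1/6 + 1) Y'"
      "insert (primary_arc x y) D = insert {pt (5/6), pt (1/6 + 1)} (arcs Y' \<union> arcs (act (\<lambda>x. x + 1) X))"
      unfolding represents_def by auto
    then have "represents (1/6) (5/6) X Y' (insert (primary_arc a b) D)"
      using rep arcs_translate unfolding represents_def prim pt_add_one by (auto simp: insert_commute Un_commute)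
    then show ?thesis by blast
  qed
qed

section \<open>Generation\<close>

lemma push_arc_iff:
  assumes H: "homeo_lift H" and D: "\<Union>D \<subseteq> S1"
  shows "{pt (H p), pt (H q)} \<in> push H D \<longleftrightarrow> {pt p, pt q} \<in> D"
proof
  assume "{pt (H p), pt (H q)} \<in> push H D"
  then obtain A where A: "A \<in> D" "circ H ` {pt p, pt q} = circ H ` A" unfolding push_def push_pair[OF H, symmetric] by blast
  have "inj_on (circ H) S1" using circ_Bij[OF H] unfolding Bij_def bij_betw_def by blast
  then have "{pt p, pt q} = A" using A D inj_on_image_eq_iff[of "circ H" S1 "{pt p, pt q}" A] by auto
  then show "{pt p, pt q} \<in> D" using A by simp
next
  assume "{pt p, pt q} \<in> D"
  then show "{pt (H p), pt (H q)} \<in> push H D" unfolding push_def push_pair[OF H, symmetric] by blast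
qed

lemma act_eq_of_arcs:
  assumes H: "homeo_lift H" "H u = u" "H w = w"
    and X: "\<And>p q. (p, q) \<in> X \<Longrightarrow> u < p \<and> p < q \<and> q < w" and X': "\<And>p q. (p, q) \<in> X' \<Longrightarrow> u < p \<and> p < q \<and> q < w"
    and iff: "\<And>p q. u < p \<Longrightarrow> p < q \<Longrightarrow> q < w \<Longrightarrow> (p, q) \<in> X \<longleftrightarrow> (H p, H q) \<in> X'"
  shows "act H X = X'"
proof (intro equalityI subsetI)
  fix z assume "z \<in> act H X"
  then obtain p q where "(p, q) \<in> X" "z = (H p, H q)" by auto
  then show "z \<in> X'" using iff X by blast
next
  fix z assume z: "z \<in> X'"
  obtain p q where pq: "z = (H p, H q)" using homeo_lift_surj[OF H(1)] by (metis prod.exhaust)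
  then have "H u < H p" "H p < H q" "H q < H w" using X'[of "H p" "H q"] z H by auto
  then have "u < p" "p < q" "q < w" using homeo_lift_less[OF H(1)] by auto
  then have "(p, q) \<in> X" using iff z pq by blast
  then show "z \<in> act H X" using act_mem pq by simp
qed

lemma modelled_opposite: "modelled (5/6) (7/6)"
  by (rule modelled_transport[OF gen_lift_minus_half affine_on_shift(2)]) (use model_good[of "1/3" "2/3"] in \<open>simp add: model_def\<close>)

lemma modelled_upper: "modelled (1/6) (5/6)"
proof -
  have "modelled (lift_alpha (1/3)) (lift_alpha (2/3))"
    by (rule modelled_transport_inv[OF gen_lift_alpha alpha_affine]) (use model_good[of "1/3" "2/3"] in \<open>auto simp: model_def\<close>)
  then show ?thesis unfolding pl_alpha_values .
qed

lemma one_sided_generated: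
  assumes H: "rearr H D" "H u = u" "H w = w" and "modelled u w"
    and rep: "represents u w X Y D" "represents u w X' Y' (push H D)"
  shows "\<exists>F. supported F u w \<and> (\<forall>x\<in>{u..w}. F x = H x)"
proof -
  have h: "homeo_lift H" and D: "arc_diagram D" using H(1) unfolding rearr_def by auto
  have X: "subdiv u w X" and X': "subdiv u w X'" and w: "w \<le> u + 1" using rep unfolding represents_def by auto
  have lt: "H x < H y \<longleftrightarrow> x < y" for x y using homeo_lift_less[OF h] .
  have "act H X = X'"
  proof (rule act_eq_of_arcs[OF h H(2,3) subdiv_range[OF X] subdiv_range[OF X']])
    fix p q :: real assume pq: "u < p" "p < q" "q < w"
    have "u < H p" "H p < H q" "H q < w" using lt[of u p] lt[of p q] lt[of q w] pq H(2,3) by auto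
    then show "(p, q) \<in> X \<longleftrightarrow> (H p, H q) \<in> X'"
      using represents_arc_iff[OF rep(1) pq] represents_arc_iff[OF rep(2)]
        push_arc_iff[OF h arc_diagram_subset_S1[OF D]] by blast
  qed
  moreover have "gap_affine H u w X"
    unfolding gap_affine_def
  proof (intro allI impI)
    fix x y assume g: "gap u w X x y"
    then have "x \<in> points u w X" "y \<in> points u w X" unfolding gap_def by auto
    then have "circle_interval D x y" using represents_gap_iff[OF rep(1)] points_range[OF X] g by blast
    then show "affine_on H x y" using H(1) unfolding rearr_def by blast
  qed
  ultimately show ?thesis
    using interval_rearrangement_generated[OF X assms(4) w X' homeo_strict_mono_on[OF h] H(2,3)] by blast
qed

text \<open>
  A lift that fixes \<open>1/6\<close> and \<open>5/6\<close> maps \<open>[1/6, 5/6]\<close> and \<open>[5/6, 7/6]\<close> to themselves, and the two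
  restrictions are rearrangements of single intervals.
\<close>

lemma fixing_arc_generated:
  assumes H: "rearr H D" "H (1/6) = 1/6" "H (5/6) = 5/6"
  shows "circ H \<in> generate (BijGroup S1) TB_gens"
proof -
  have h: "homeo_lift H" and D: "arc_diagram D" "arc_diagram (push H D)" using H(1) unfolding rearr_def by auto
  have e: "1/6 + 1 = (7/6 :: real)" by simp
  have H7: "H (7/6) = 7/6" using homeo_lift_add_one[OF h, of "1/6"] H(2) by simp
  obtain X Y where rep: "represents (1/6) (5/6) X Y D" using arc_diagram_represented[OF D(1)] by blast
  obtain X' Y' where rep': "represents (1/6) (5/6) X' Y' (push H D)" using arc_diagram_represented[OF D(2)] by blast
  obtain F1 where F1: "supported F1 (1/6) (5/6)" "\<forall>x\<in>{1/6..5/6}. F1 x = H x"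
    using one_sided_generated[OF H modelled_upper rep rep'] by blast
  obtain F2 where F2: "supported F2 (5/6) (7/6)" "\<forall>x\<in>{5/6..7/6}. F2 x = H x"
    using one_sided_generated[OF H(1,3) H7 modelled_opposite represents_swap[OF rep, unfolded e] represents_swap[OF rep', unfolded e]] by blast
  have lt: "H x < H y \<longleftrightarrow> x < y" for x y using homeo_lift_less[OF h] .
  have gen: "gen_lift (F1 \<circ> F2)" using F1(1) F2(1) gen_lift_comp unfolding supported_def by blast
  have eq: "(F1 \<circ> F2) x = H x" if x: "1/6 \<le> x" "x < 7/6" for x
  proof (cases "x \<le> 5/6")
    case True
    then have "F2 x = x" using supported_outside[OF F2(1)] x by auto
    then show ?thesis using F1(2) x True by simp
  next
    case False
    then have "F2 x = H x" using F2(2) x by simp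
    moreover have "H (5/6) \<le> H x" "H x \<le> H (7/6)" using lt[of "5/6" x] lt[of x "7/6"] False x by auto
    then have "5/6 \<le> H x" "H x \<le> 1/6 + 1" unfolding H(3) H7 by simp_all
    then have "F1 (H x) = H x" using F1(1) unfolding supported_def by blast
    ultimately show ?thesis by simp
  qed
  have "circ H = circ (F1 \<circ> F2)"
  proof (rule extensionalityI[OF circ_extensional circ_extensional])
    fix z assume "z \<in> S1"
    then obtain x where x: "1/6 \<le> x" "x < 1/6 + 1" "z = pt x" by (rule S1_obtain_pt)
    then show "circ H z = circ (F1 \<circ> F2) z" using eq[of x] circ_pt[OF h] circ_pt[OF gen_lift_homeo[OF gen]] by simp
  qed
  then show ?thesis using gen unfolding gen_lift_def by simp
qed

lemma rearr_translate:
  assumes "rearr H D" shows "rearr (\<lambda>x. H x + of_int k) D" "circ (\<lambda>x. H x + of_int k) = circ H"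
proof -
  have h: "homeo_lift H" and D: "arc_diagram D" "arc_diagram (push H D)"
    and aff: "\<And>a b. circle_interval D a b \<Longrightarrow> affine_on H a b" using assms unfolding rearr_def by auto
  have hk: "homeo_lift (\<lambda>x. H x + of_int k)" using homeo_lift_comp[OF homeo_lift_translate h] by (simp add: o_def)
  show c: "circ (\<lambda>x. H x + of_int k) = circ H"
    by (rule circ_eqI[symmetric]) (simp_all add: hk circ_pt[OF h])
  have "affine_on (\<lambda>x. H x + of_int k) a b" if "circle_interval D a b" for a b
    using affine_on_comp[OF aff[OF that] affine_on_shift(1) homeo_lift_mono_on[OF h]] by (simp add: o_def)
  then show "rearr (\<lambda>x. H x + of_int k) D" using hk D c unfolding rearr_def push_def by simp
qed

text \<open>
  The image arc can be moved to the arc from \<open>1/3\<close> to \<open>2/3\<close>. If the orientations agree, \<open>\<alpha>\<close> takes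
  \<open>1/3, 2/3\<close> to \<open>1/6, 5/6\<close>; otherwise \<open>\<delta>\<close> takes \<open>2/3, 1/3\<close> to \<open>1/6, 5/6\<close>.
\<close>

lemma base_arc_returns:
  assumes F: "rearr F D"
  obtains E where "gen_lift E" "pt (E (F (1/6))) = pt (1/6)" "pt (E (F (5/6))) = pt (5/6)"
proof -
  have h: "homeo_lift F" and D: "arc_diagram D" "arc_diagram (push F D)" using F unfolding rearr_def by auto
  obtain X Y where XY: "represents (1/6) (5/6) X Y (push F D)" using arc_diagram_represented[OF D(2)] by blast
  have "1/6 + 1 = (7/6 :: real)" by simp
  then have X: "subdiv (1/6) (5/6) X" and Y: "subdiv (5/6) (7/6) Y" using XY unfolding represents_def by auto
  have "{pt (1/6), pt (5/6)} \<in> D" using base_diagram_subset[OF D(1)] by blast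
  then have "{pt (F (1/6)), pt (F (5/6))} \<in> push F D" unfolding push_def push_pair[OF h, symmetric] by blast
  then have "{pt (F (1/6)), pt (F (5/6))} \<in> insert {pt (1/6), pt (5/6)} (arcs X \<union> arcs Y)"
    using XY unfolding represents_def by simp
  then consider "{pt (F (1/6)), pt (F (5/6))} = {pt (1/6), pt (5/6)}"
    | p q where "(p, q) \<in> X" "{pt (F (1/6)), pt (F (5/6))} = {pt p, pt q}"
    | p q where "(p, q) \<in> Y" "{pt (F (1/6)), pt (F (5/6))} = {pt p, pt q}"
    unfolding arcs_def by auto
  then have "\<exists>p q E. gen_lift E \<and> E p = 1/3 \<and> E q = 2/3 \<and> {pt (F (1/6)), pt (F (5/6))} = {pt p, pt q}"
  proof cases
    case 1
    have "the_inv lift_alpha (1/6) = 1/3" "the_inv lift_alpha (5/6) = 2/3"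
      using homeo_lift_inv_f[OF gen_lift_homeo[OF gen_lift_alpha], of "1/3"]
        homeo_lift_inv_f[OF gen_lift_homeo[OF gen_lift_alpha], of "2/3"] by (simp_all only: pl_alpha_values)
    then show ?thesis using 1 gen_lift_inv[OF gen_lift_alpha] by blast
  next
    case 2 then show ?thesis using arc_moves_to_model[OF X modelled_upper] by blast
  next
    case 3 then show ?thesis using arc_moves_to_model[OF Y modelled_opposite] by blast
  qed
  then obtain p q E where E: "gen_lift E" "E p = 1/3" "E q = 2/3" "{pt (F (1/6)), pt (F (5/6))} = {pt p, pt q}" by blast
  have tr: "pt (G (E x)) = pt (G (E y))" if "pt x = pt y" "homeo_lift G" for x y G
    using that homeo_lift_pt_eq gen_lift_homeo[OF E(1)] by blast
  have "(pt (F (1/6)) = pt p \<and> pt (F (5/6)) = pt q) \<or> (pt (F (1/6)) = pt q \<and> pt (F (5/6)) = pt p)"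
    using E(4) by (auto simp: doubleton_eq_iff)
  then show ?thesis
  proof
    assume *: "pt (F (1/6)) = pt p \<and> pt (F (5/6)) = pt q"
    have "pt ((lift_alpha \<circ> E) (F (1/6))) = pt (1/6)" "pt ((lift_alpha \<circ> E) (F (5/6))) = pt (5/6)"
      using tr[OF conjunct1[OF *] gen_lift_homeo[OF gen_lift_alpha]] tr[OF conjunct2[OF *] gen_lift_homeo[OF gen_lift_alpha]]
      by (simp_all only: E(2,3) pl_alpha_values comp_apply)
    then show ?thesis using that gen_lift_comp[OF gen_lift_alpha E(1)] by blast
  next
    assume *: "pt (F (1/6)) = pt q \<and> pt (F (5/6)) = pt p"
    have "2/3 + 1/2 = (7/6 :: real)" "1/3 + 1/2 = (5/6 :: real)" by simp_all
    then have "pt (((\<lambda>x. x + 1/2) \<circ> E) (F (1/6))) = pt (1/6)" "pt (((\<lambda>x. x + 1/2) \<circ> E) (F (5/6))) = pt (5/6)"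
      using tr[OF conjunct1[OF *] gen_lift_homeo[OF gen_lift_half]] tr[OF conjunct2[OF *] gen_lift_homeo[OF gen_lift_half]]
      by (simp_all only: E(2,3) pt_representatives(1) comp_apply)
    then show ?thesis using that gen_lift_comp[OF gen_lift_half E(1)] by blast
  qed
qed

lemma rearr_generated:
  assumes F: "rearr F D" shows "circ F \<in> generate (BijGroup S1) TB_gens"
proof -
  interpret group "BijGroup S1" by (rule group_BijGroup)
  have hF: "homeo_lift F" using F unfolding rearr_def by blast
  obtain E where E: "gen_lift E" "pt (E (F (1/6))) = pt (1/6)" "pt (E (F (5/6))) = pt (5/6)"
    using base_arc_returns[OF F] .
  have hE: "homeo_lift E" using gen_lift_homeo[OF E(1)] .
  have "generate (BijGroup S1) TB_gens \<subseteq> rearrangements"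
    using alpha_rearr beta_rearr gamma_rearr delta_rearr by (intro generate_subgroup_incl rearr_subgroup) blast
  then have "circ E \<in> rearrangements" using E(1) unfolding gen_lift_def by blast
  then have "circ E \<otimes>\<^bsub>BijGroup S1\<^esub> circ F \<in> rearrangements"
    using subgroup.m_closed[OF rearr_subgroup] F by blast
  then obtain H D' where H: "circ E \<otimes>\<^bsub>BijGroup S1\<^esub> circ F = circ H" "rearr H D'" by blast
  have hH: "homeo_lift H" using H(2) unfolding rearr_def by blast
  have HE: "pt (H x) = pt (E (F x))" for x
    using H(1) circ_mult[OF hE hF] circ_pt[OF hH, of x] circ_pt[OF homeo_lift_comp[OF hE hF], of x] by simp
  have "pt (1/6) = pt (H (1/6))" using HE E(2) by simp
  then obtain k :: int where k: "1/6 = H (1/6) + of_int k" unfolding pt_eq_iff by blast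
  define J where "J x = H x + of_int k" for x
  have J: "rearr J D'" "circ J = circ H" unfolding J_def using rearr_translate[OF H(2)] by auto
  have hJ: "homeo_lift J" using J(1) unfolding rearr_def by blast
  have J6: "J (1/6) = 1/6" using k unfolding J_def by simp
  have J7: "J (7/6) = 7/6" using homeo_lift_add_one[OF hJ, of "1/6"] J6 by simp
  have "1/6 < J (5/6)" "J (5/6) < 7/6" using homeo_lift_less[OF hJ, of "1/6" "5/6"] homeo_lift_less[OF hJ, of "5/6" "7/6"] J6 J7 by auto
  moreover have "pt (J (5/6)) = pt (5/6)" unfolding J_def using HE E(3) by simp
  ultimately have J5: "J (5/6) = 5/6" by (intro pt_eq_near) auto
  have gen: "circ J \<in> generate (BijGroup S1) TB_gens" using fixing_arc_generated[OF J(1) J6 J5] .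
  have carrier: "circ E \<in> carrier (BijGroup S1)" "circ F \<in> carrier (BijGroup S1)"
    using circ_Bij hE hF unfolding BijGroup_def by auto
  have "circ F = inv\<^bsub>BijGroup S1\<^esub> (circ E) \<otimes>\<^bsub>BijGroup S1\<^esub> circ J"
    unfolding J(2) H(1)[symmetric] using carrier by (simp add: m_assoc[symmetric])
  then show ?thesis
    using generate.eng[OF generate_m_inv_closed[OF gens_subset_carrier] gen, of "circ E"] E(1) unfolding gen_lift_def by simp
qed

theorem theorem7p1:
  shows "TB = generate (BijGroup S1) {alpha, beta, gamma, delta}"
proof
  show "generate (BijGroup S1) {alpha, beta, gamma, delta} \<subseteq> TB"
    unfolding TB_eq using alpha_rearr beta_rearr gamma_rearr delta_rearr
    by (intro group.generate_subgroup_incl[OF group_BijGroup] rearr_subgroup) blast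
  show "TB \<subseteq> generate (BijGroup S1) {alpha, beta, gamma, delta}"
    unfolding TB_eq using rearr_generated by blast
qed

end
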